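(* Let $A\subset\mathbb{R}$ be a $2$-convex set of size $N$. Then \[ |A-A|\gtrsim N^{1+151/234}\ (\approx N^{1.645}),\qquad |A+A|\gtrsim N^{1+229/390}\ (\approx N^{1.587}), \] and, if $N$ is sufficiently large, $E(A)\leq N^{2.4554}$.
   Context: A finite real sequence $(x_1,\dots,x_m)$ is $0$-convex if strictly monotone, and for $s\geq1$ it is $s$-convex if $(x_{i+1}-x_i)_{i=1}^{m-1}$ is $(s-1)$-convex; a finite set is $s$-convex if its increasing enumeration is an $s$-convex sequence. $E(A)$ is the number of $(a_1,a_2,a_3,a_4)\in A^4$ with $a_1+a_2=a_3+a_4$. $X\gtrsim Y$ means $X\geq cY(\log Y)^{-C}$ for absolute constants $c,C>0$. (The paper's displayed statement writes the exponent for $|A+A|$ as $1+229/309$, but its proof and stated approximation $\approx1.587$ correspond to $1+229/390$.) *)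

theory Defs
  imports Complex_Main
begin

definition diffs :: "real list \<Rightarrow> real list" where
  "diffs xs = map (\<lambda>(a, b). b - a) (zip xs (tl xs))"

fun convex_seq :: "nat \<Rightarrow> real list \<Rightarrow> bool" where
  "convex_seq 0 xs = (sorted_wrt (<) xs \<or> sorted_wrt (>) xs)"
| "convex_seq (Suc s) xs = convex_seq s (diffs xs)"

definition convex_set :: "nat \<Rightarrow> real set \<Rightarrow> bool" where
  "convex_set s A = (finite A \<and> convex_seq s (sorted_list_of_set A))"

definition sumset :: "real set \<Rightarrow> real set" where
  "sumset A = {a + b | a b. a \<in> A \<and> b \<in> A}"

definition diffset :: "real set \<Rightarrow> real set" where
  "diffset A = {a - b | a b. a \<in> A \<and> b \<in> A}"

definition add_energy :: "real set \<Rightarrow> nat" where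
  "add_energy A = card {(a1, a2, a3, a4). a1 \<in> A \<and> a2 \<in> A \<and> a3 \<in> A \<and> a4 \<in> A
                                         \<and> a1 + a2 = a3 + a4}"

definition gtrsim_bound :: "real \<Rightarrow> real \<Rightarrow> real \<Rightarrow> real \<Rightarrow> bool" where
  "gtrsim_bound c C X Y = (X \<ge> c * Y * (ln Y) powr (- C))"

end

theory Submission
  imports Defs "HOL-Analysis.Analysis" "HOL-Real_Asymp.Real_Asymp"
begin

text \<open>
  Incidence geometry is replaced by Garaev's squeezing. If \<open>z\<close> has many representations
  \<open>z = a\<^sub>1 + \<dots> + a\<^sub>k\<close>, then the index tuples of these representations form an antichain, so that
  cutting the index cube into boxes of side \<open>H\<close> leaves many pairs of representations in a common
  box. Subtracting two of them gives a relation \<open>d\<^sub>1 + \<dots> + d\<^sub>k = 0\<close> between differences of elements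
  of \<open>A\<close> at index distance less than \<open>H\<close>. For a fixed index distance these differences form a convex
  set if \<open>A\<close> is 2-convex, which bounds the number of relations.

  For \<open>k = 2\<close> this gives the Szemeredi-Trotter type bounds for convex sets, in particular a third
  energy of order \<open>N\<^sup>3 log N\<close>. A triangle count with a Perron vector of the graph of popular
  differences then yields Shkredov's bound \<open>N^(32/13)\<close> for the energy of a convex set. This feeds the
  squeezing for \<open>k = 4\<close>: for 2-convex \<open>A\<close> the elements of a set \<open>Z\<close> have at most
  \<open>N^(36/13) |Z|^(4/7)\<close> representations \<open>a\<^sub>1 + a\<^sub>2 - a\<^sub>3 - a\<^sub>4\<close>, up to logarithms.
  Comparing this with the lower bound for the number of pairs \<open>x, y\<close> of popular differences (or sums)
  with popular \<open>x + y\<close> (or \<open>x - y\<close>), which follows from the third energy by Cauchy-Schwarz, gives the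
  exponents. All inequalities between monomials are combined after taking logarithms.
\<close>

subsection \<open>Counting collisions\<close>

text \<open>The box side \<open>H\<close> is where squeezing is tuned. If \<open>X\<close> tuples of
  length \<open>k\<close> have their sum in \<open>Z\<close>, then
  \<open>X^2 \<le> |Z| * boxes * pairs\<close>: the solutions for one sum meet about
  \<open>(N/H)^(k-1)\<close> boxes, and the pairs are the \<open>X\<close> diagonal ones plus about
  \<open>H^k\<close> times a number of zero sums in sets of differences. Choosing \<open>H\<close>
  with \<open>|Z| * boxes = X/2\<close> absorbs the diagonal, and the rest is solved for
  \<open>X\<close>. Differences of a 2-convex set at a fixed index distance are only convex, so for
  \<open>k = 4\<close> the zero sums are bounded by the energy of convex sets; this is how 32/13
  leads to 36/13 = 3/7 * (4 + 32/13).

  For \<open>k \<ge> 3\<close> a further obstacle is pairs of tuples that share some coordinates;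
  they are counted separately.

  For the final energy bound the estimate from \<open>k = 4\<close> deteriorates as the popularity
  of the sums grows. It is therefore paired with one derived from \<open>k = 3\<close>, which
  improves.

  Second differences of a 2-convex set may change sign. All estimates are proved for sets on which
  they do not, and are then transferred from two such pieces.\<close>

definition coll :: "('a \<Rightarrow> 'b) \<Rightarrow> 'a set \<Rightarrow> nat" where
  "coll f P = card {(p, q). p \<in> P \<and> q \<in> P \<and> f p = f q}"

lemma card_matches:
  assumes "finite P" "finite Q" "finite Y" "f ` P \<subseteq> Y"
  shows "card {(p, q). p \<in> P \<and> q \<in> Q \<and> f p = g q}
       = (\<Sum>y\<in>Y. card {p \<in> P. f p = y} * card {q \<in> Q. g q = y})"
proof -
  have "{(p, q). p \<in> P \<and> q \<in> Q \<and> f p = g q}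
      = (\<Union>y\<in>Y. {p \<in> P. f p = y} \<times> {q \<in> Q. g q = y})"
    using assms(4) by auto
  also have "card \<dots> = (\<Sum>y\<in>Y. card ({p \<in> P. f p = y} \<times> {q \<in> Q. g q = y}))"
    using assms by (intro card_UN_disjoint) auto
  finally show ?thesis by (simp add: card_cartesian_product)
qed

lemma coll_eq_sum:
  assumes "finite P" "finite Y" "f ` P \<subseteq> Y"
  shows "coll f P = (\<Sum>y\<in>Y. (card {p \<in> P. f p = y})\<^sup>2)"
  unfolding coll_def card_matches[OF assms(1) assms(1) assms(2,3)] by (simp add: power2_eq_square)

lemma card_eq_sum_fibres:
  assumes "finite P" "finite Y" "f ` P \<subseteq> Y"
  shows "card P = (\<Sum>y\<in>Y. card {p \<in> P. f p = y})"
proof -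
  have "P = (\<Union>y\<in>Y. {p \<in> P. f p = y})" using assms by auto
  then have "card P = card (\<Union>y\<in>Y. {p \<in> P. f p = y})" by simp
  also have "\<dots> = (\<Sum>y\<in>Y. card {p \<in> P. f p = y})"
    using assms by (intro card_UN_disjoint) auto
  finally show ?thesis .
qed

lemma card_square_le_coll:
  assumes "finite P" "finite Y" "f ` P \<subseteq> Y"
  shows "(card P)\<^sup>2 \<le> card Y * coll f P"
proof -
  have "(real (card P))\<^sup>2 = (\<Sum>y\<in>Y. 1 * real (card {p \<in> P. f p = y}))\<^sup>2"
    using card_eq_sum_fibres[OF assms] by simp
  also have "\<dots> \<le> (\<Sum>y\<in>Y. 1\<^sup>2) * (\<Sum>y\<in>Y. (real (card {p \<in> P. f p = y}))\<^sup>2)"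
    by (rule Cauchy_Schwarz_ineq_sum)
  also have "\<dots> = real (card Y * coll f P)"
    by (simp add: coll_eq_sum[OF assms])
  finally show ?thesis unfolding of_nat_power[symmetric] of_nat_le_iff .
qed

lemma coll_pos:
  assumes "finite P" "P \<noteq> {}" shows "coll f P > 0"
proof -
  have "finite {(p, q). p \<in> P \<and> q \<in> P \<and> f p = f q}"
    by (rule finite_subset[of _ "P \<times> P"]) (use assms in auto)
  then show ?thesis using assms by (auto simp: coll_def card_gt_0_iff)
qed

lemma card_matches_square_le:
  assumes "finite P" "finite Q"
  shows "(card {(p, q). p \<in> P \<and> q \<in> Q \<and> f p = g q})\<^sup>2 \<le> coll f P * coll g Q"
proof -
  let ?Y = "f ` P \<union> g ` Q"
  have Y: "finite ?Y" "f ` P \<subseteq> ?Y" "g ` Q \<subseteq> ?Y" using assms by auto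
  have "(real (card {(p, q). p \<in> P \<and> q \<in> Q \<and> f p = g q}))\<^sup>2
      = (\<Sum>y\<in>?Y. real (card {p \<in> P. f p = y}) * real (card {q \<in> Q. g q = y}))\<^sup>2"
    using card_matches[OF assms Y(1,2)] by simp
  also have "\<dots> \<le> (\<Sum>y\<in>?Y. (real (card {p \<in> P. f p = y}))\<^sup>2) * (\<Sum>y\<in>?Y. (real (card {q \<in> Q. g q = y}))\<^sup>2)"
    by (rule Cauchy_Schwarz_ineq_sum)
  also have "\<dots> = real (coll f P * coll g Q)"
    using coll_eq_sum[OF assms(1) Y(1,2)] coll_eq_sum[OF assms(2) Y(1,3)] by simp
  finally show ?thesis unfolding of_nat_power[symmetric] of_nat_le_iff .
qed

text \<open>Cauchy-Schwarz inside each fibre of \<open>f\<close>: a fibre spread over at most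
  \<open>M\<close> boxes keeps at least the fraction \<open>1/M\<close> of its pairs within common
  boxes. This is the squeezing step in abstract form.\<close>

lemma coll_le_boxes:
  assumes "finite P" and M: "\<And>z. card (bx ` {p \<in> P. f p = z}) \<le> M"
  shows "coll f P \<le> M * coll (\<lambda>p. (f p, bx p)) P"
proof -
  have 1: "(card {p \<in> P. f p = z})\<^sup>2 \<le> M * coll bx {p \<in> P. f p = z}" for z
    by (rule order_trans[OF card_square_le_coll[of _ "bx ` {p \<in> P. f p = z}" bx] mult_le_mono1[OF M]])
       (use assms in auto)
  have "coll (\<lambda>p. (f p, bx p)) P = card (\<Union>z\<in>f ` P. {(p, q). p \<in> {p \<in> P. f p = z} \<and> q \<in> {p \<in> P. f p = z} \<and> bx p = bx q})"
    unfolding coll_def by (rule arg_cong[where f=card]) auto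
  also have "\<dots> = (\<Sum>z\<in>f ` P. coll bx {p \<in> P. f p = z})"
    unfolding coll_def
    by (rule card_UN_disjoint)
       (use assms in \<open>auto intro: finite_subset[of _ "P \<times> P"]\<close>)
  finally have 2: "coll (\<lambda>p. (f p, bx p)) P = (\<Sum>z\<in>f ` P. coll bx {p \<in> P. f p = z})" .
  have "coll f P = (\<Sum>z\<in>f ` P. (card {p \<in> P. f p = z})\<^sup>2)"
    using assms by (intro coll_eq_sum) auto
  also have "\<dots> \<le> (\<Sum>z\<in>f ` P. M * coll bx {p \<in> P. f p = z})"
    by (intro sum_mono 1)
  finally show ?thesis by (simp add: 2 sum_distrib_left)
qed

subsection \<open>Squeezing for two summands\<close>

text \<open>For \<open>a \<in> A\<close> this is the zero-based position of \<open>a\<close> in the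
  increasing enumeration of \<open>A\<close>.\<close>

definition rk :: "real set \<Rightarrow> real \<Rightarrow> nat" where
  "rk A a = card {x \<in> A. x < a}"

lemma rk_mono: "finite A \<Longrightarrow> a \<le> b \<Longrightarrow> rk A a \<le> rk A b"
  unfolding rk_def by (rule card_mono) auto

lemma rk_strict_mono: "finite A \<Longrightarrow> a \<in> A \<Longrightarrow> a < b \<Longrightarrow> rk A a < rk A b"
  unfolding rk_def by (rule psubset_card_mono) auto

lemma rk_inj: "finite A \<Longrightarrow> a \<in> A \<Longrightarrow> b \<in> A \<Longrightarrow> rk A a = rk A b \<Longrightarrow> a = b"
  by (metis less_irrefl neqE rk_strict_mono)

lemma rk_less_card: "finite A \<Longrightarrow> a \<in> A \<Longrightarrow> rk A a < card A"
  unfolding rk_def by (rule psubset_card_mono) auto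

lemma rk_div_less: "finite A \<Longrightarrow> rk A a div H < rk A b div H \<Longrightarrow> a < b"
  by (meson div_le_mono linorder_not_le rk_mono)

lemma rk_uminus:
  assumes "finite A" "a \<in> A"
  shows "int (rk (uminus ` A) (- a)) = int (card A) - 1 - int (rk A a)"
proof -
  have "{x \<in> uminus ` A. x < - a} = uminus ` {x \<in> A. a < x}" by force
  then have 1: "rk (uminus ` A) (- a) = card {x \<in> A. a < x}"
    unfolding rk_def by (simp add: card_image)
  have "A = insert a ({x \<in> A. x < a} \<union> {x \<in> A. a < x})" using assms by auto
  then have "card A = card (insert a ({x \<in> A. x < a} \<union> {x \<in> A. a < x}))" by simp
  also have "\<dots> = Suc (card {x \<in> A. x < a} + card {x \<in> A. a < x})"
    using assms by (subst card_insert_disjoint, simp, simp, subst card_Un_disjoint) auto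
  finally show ?thesis unfolding 1 by (simp add: rk_def)
qed

text \<open>
  The only consequence of convexity that squeezing uses: a nonzero index offset together with the
  corresponding difference determines the pair of elements. Unlike convexity itself, it is
  insensitive to the signs of the first and second differences.
\<close>

definition cvx :: "real set \<Rightarrow> bool" where
  "cvx A \<longleftrightarrow> finite A \<and> (\<forall>a\<in>A. \<forall>a'\<in>A. \<forall>b\<in>A. \<forall>b'\<in>A. a \<noteq> a' \<longrightarrow>
     int (rk A a') - int (rk A a) = int (rk A b') - int (rk A b) \<longrightarrow> a' - a = b' - b \<longrightarrow> a = b)"

lemma cvx_finite: "cvx A \<Longrightarrow> finite A"
  by (simp add: cvx_def)

lemma cvxD:
  assumes "cvx A" "a \<in> A" "a' \<in> A" "b \<in> A" "b' \<in> A" "a \<noteq> a'"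
    "int (rk A a') - int (rk A a) = int (rk A b') - int (rk A b)" "a' - a = b' - b"
  shows "a = b" "a' = b'"
proof -
  show "a = b" using assms unfolding cvx_def by blast
  then show "a' = b'" using assms(8) by simp
qed

lemma cvx_uminus:
  assumes "cvx A" shows "cvx (uminus ` A)"
  unfolding cvx_def
proof (intro conjI ballI impI)
  show "finite (uminus ` A)" using assms by (simp add: cvx_def)
  fix x x' y y' assume "x \<in> uminus ` A" "x' \<in> uminus ` A" "y \<in> uminus ` A" "y' \<in> uminus ` A"
  then obtain a a' b b' where ab: "x = - a" "x' = - a'" "y = - b" "y' = - b'"
     "a \<in> A" "a' \<in> A" "b \<in> A" "b' \<in> A" by blast
  assume "x \<noteq> x'" and r: "int (rk (uminus ` A) x') - int (rk (uminus ` A) x) =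
       int (rk (uminus ` A) y') - int (rk (uminus ` A) y)" and d: "x' - x = y' - y"
  have fin: "finite A" using assms by (simp add: cvx_def)
  have "int (rk A a') - int (rk A a) = int (rk A b') - int (rk A b)"
    using r by (simp add: ab rk_uminus fin)
  moreover have "a' - a = b' - b" using d by (simp add: ab)
  ultimately show "x = y" using cvxD[OF assms ab(5-8)] \<open>x \<noteq> x'\<close> ab by auto
qed

text \<open>
  The solutions of \<open>a + b = z\<close> form an antichain, so a box that they meet is determined by the
  difference of its coordinates.
\<close>

lemma card_box_differences_2:
  assumes "finite A" "finite B" "H1 \<ge> 1" "H2 \<ge> 1" "P \<subseteq> A \<times> B"
  shows "card ((\<lambda>(a, b). (rk A a div H1, rk B b div H2)) ` {p \<in> P. fst p + snd p = z})
     \<le> card A div H1 + card B div H2 + 1" (is "card ?S \<le> _")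
proof -
  let ?g = "\<lambda>(i, j). int i - int j"
  have "card ?S \<le> card {- int (card B div H2) .. int (card A div H1)}"
  proof (rule card_inj_on_le[of ?g])
    show "inj_on ?g ?S"
    proof (rule inj_onI, clarsimp)
      fix a b a' b' assume h: "(a, b) \<in> P" "(a', b') \<in> P" "z = a + b" "a' + b' = a + b"
        and e: "int (rk A a div H1) - int (rk B b div H2) = int (rk A a' div H1) - int (rk B b' div H2)"
      have "rk A a div H1 = rk A a' div H1"
      proof (rule ccontr)
        assume "rk A a div H1 \<noteq> rk A a' div H1"
        then consider "rk A a div H1 < rk A a' div H1" "rk B b div H2 < rk B b' div H2" |
          "rk A a div H1 > rk A a' div H1" "rk B b div H2 > rk B b' div H2" using e by linarith
        then show False using rk_div_less[OF assms(1)] rk_div_less[OF assms(2)] h(4)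
          by cases (smt (verit))+
      qed
      then show "rk A a div H1 = rk A a' div H1 \<and> rk B b div H2 = rk B b' div H2" using e by auto
    qed
    show "?g ` ?S \<subseteq> {- int (card B div H2) .. int (card A div H1)}"
    proof clarsimp
      fix a b assume "(a, b) \<in> P"
      then have "rk A a \<le> card A" "rk B b \<le> card B"
        using assms rk_less_card less_imp_le by blast+
      then have "int (rk A a div H1) \<le> int (card A div H1)" "int (rk B b div H2) \<le> int (card B div H2)"
        by (simp_all only: of_nat_le_iff div_le_mono)
      then show "- int (card B div H2) \<le> int (rk A a div H1) - int (rk B b div H2) \<and>
        int (rk A a div H1) - int (rk B b div H2) \<le> int (card A div H1)" by linarith
    qed
  qed simp
  then show ?thesis by simp
qed

text \<open>The possible index offsets between distinct elements of one block of \<open>H\<close>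
  consecutive indices.\<close>

definition shifts :: "nat \<Rightarrow> int set" where
  "shifts H = {h. h \<noteq> 0 \<and> \<bar>h\<bar> < int H}"

lemma finite_shifts [simp]: "finite (shifts H)"
  by (rule finite_subset[of _ "{- int H .. int H}"]) (auto simp: shifts_def)

lemma card_shifts: "card (shifts H) \<le> 2 * H"
proof -
  have "shifts H \<subseteq> {- int H<..<0} \<union> {0<..<int H}" by (auto simp: shifts_def)
  then have "card (shifts H) \<le> card ({- int H<..<0} \<union> {0<..<int H})"
    by (intro card_mono) auto
  also have "\<dots> \<le> card {- int H<..<0} + card {0<..<int H}" by (rule card_Un_le)
  also have "\<dots> \<le> 2 * H" by simp
  finally show ?thesis .
qed

lemma div_eq_imp_shift:
  assumes "finite A" "H \<ge> 1" "a \<in> A" "a' \<in> A" "a \<noteq> a'" "rk A a div H = rk A a' div H"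
  shows "int (rk A a') - int (rk A a) \<in> shifts H"
proof -
  have "rk A a \<noteq> rk A a'" using assms rk_inj by blast
  moreover have "rk A a = H * (rk A a div H) + rk A a mod H" "rk A a' = H * (rk A a div H) + rk A a' mod H"
    by (simp, unfold assms(6), simp)
  moreover have "rk A a mod H < H" "rk A a' mod H < H" using assms by auto
  ultimately have "\<bar>int (rk A a') - int (rk A a)\<bar> < int H \<and> int (rk A a') - int (rk A a) \<noteq> 0" by linarith
  then show ?thesis unfolding shifts_def by simp
qed

text \<open>The diagonal accounts for \<open>card P\<close>. Off the diagonal both coordinates
  change, because the sums agree. The first element of \<open>B\<close> and the two index offsets
  fix the second element of \<open>B\<close>, hence the difference in \<open>A\<close>, and
  \<open>cvx\<close> then recovers the pair in \<open>A\<close>. Convexity enters through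
  \<open>A\<close> alone, so that \<open>B\<close> can later be a set of popular
  differences.\<close>

lemma coll_box_2:
  assumes A: "cvx A" and B: "finite B" and H: "H1 \<ge> 1" "H2 \<ge> 1" and P: "P \<subseteq> A \<times> B"
  shows "coll (\<lambda>p. (fst p + snd p, (\<lambda>(a, b). (rk A a div H1, rk B b div H2)) p)) P
    \<le> card P + 4 * H1 * H2 * card B"
proof -
  have fA: "finite A" using A by (rule cvx_finite)
  have fP: "finite P" using P fA B finite_subset by blast
  let ?S = "{(p, q). p \<in> P \<and> q \<in> P \<and> fst p + snd p = fst q + snd q \<and>
     rk A (fst p) div H1 = rk A (fst q) div H1 \<and> rk B (snd p) div H2 = rk B (snd q) div H2}"
  let ?T = "{(p, q) \<in> ?S. p \<noteq> q}"
  let ?g = "\<lambda>(p, q). (snd p, int (rk B (snd q)) - int (rk B (snd p)), int (rk A (fst q)) - int (rk A (fst p)))"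
  have "card ?T \<le> card (B \<times> shifts H2 \<times> shifts H1)"
  proof (rule card_inj_on_le[of ?g])
    show "inj_on ?g ?T"
    proof (rule inj_onI)
      fix x y assume x: "x \<in> ?T" and y: "y \<in> ?T" and e: "?g x = ?g y"
      obtain a b a' b' where xx: "x = ((a, b), (a', b'))" by (metis surj_pair)
      obtain c d c' d' where yy: "y = ((c, d), (c', d'))" by (metis surj_pair)
      have m: "(a, b) \<in> P" "(a', b') \<in> P" "(c, d) \<in> P" "(c', d') \<in> P"
        and s: "a + b = a' + b'" "c + d = c' + d'" and n: "a = a' \<longrightarrow> b \<noteq> b'"
        and bd: "b = d" and r: "int (rk B b') = int (rk B d')"
          "int (rk A a') - int (rk A a) = int (rk A c') - int (rk A c)"
        using x y e unfolding xx yy by auto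
      have "b' = d'" using r(1) m P B rk_inj by (metis (no_types) SigmaD2 of_nat_eq_iff subsetD)
      moreover have "a \<noteq> a'" using s n by auto
      moreover have "a' - a = c' - c" using s \<open>b' = d'\<close> bd by linarith
      ultimately show "x = y"
        using cvxD[OF A _ _ _ _ \<open>a \<noteq> a'\<close> r(2)] m P bd unfolding xx yy by blast
    qed
    show "?g ` ?T \<subseteq> B \<times> shifts H2 \<times> shifts H1"
    proof (rule image_subsetI)
      fix x assume x: "x \<in> ?T"
      obtain a b a' b' where xx: "x = ((a, b), (a', b'))" by (metis surj_pair)
      have m: "(a, b) \<in> P" "(a', b') \<in> P" and s: "a + b = a' + b'" and n: "a = a' \<longrightarrow> b \<noteq> b'"
        and d: "rk A a div H1 = rk A a' div H1" "rk B b div H2 = rk B b' div H2"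
        using x unfolding xx by auto
      have "a \<noteq> a'" "b \<noteq> b'" using s n by auto
      then have "b \<in> B \<and> int (rk B b') - int (rk B b) \<in> shifts H2 \<and> int (rk A a') - int (rk A a) \<in> shifts H1"
        using m P d div_eq_imp_shift fA B H by blast
      then show "?g x \<in> B \<times> shifts H2 \<times> shifts H1" unfolding xx by simp
    qed
  qed (use B in simp)
  also have "\<dots> \<le> card B * ((2 * H2) * (2 * H1))"
    unfolding card_cartesian_product by (intro mult_le_mono card_shifts order.refl)
  finally have T: "card ?T \<le> 4 * H1 * H2 * card B" by (simp add: mult_ac)
  have "coll (\<lambda>p. (fst p + snd p, (\<lambda>(a, b). (rk A a div H1, rk B b div H2)) p)) P = card ?S"
    unfolding coll_def by (rule arg_cong[where f=card]) auto
  also have "?S \<subseteq> (\<lambda>p. (p, p)) ` P \<union> ?T" by auto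
  then have "card ?S \<le> card ((\<lambda>p. (p, p)) ` P \<union> ?T)"
    using fP by (intro card_mono) (auto intro: finite_subset[of _ "P \<times> P"])
  also have "\<dots> \<le> card ((\<lambda>p. (p, p)) ` P) + card ?T" by (rule card_Un_le)
  also have "\<dots> \<le> card P + 4 * H1 * H2 * card B"
    using T card_image_le[OF fP] by (intro add_mono) auto
  finally show ?thesis .
qed

lemma coll_sum_le:
  assumes A: "cvx A" and B: "finite B" and H: "H1 \<ge> 1" "H2 \<ge> 1" and P: "P \<subseteq> A \<times> B"
  shows "coll (\<lambda>p. fst p + snd p) P
    \<le> (card A div H1 + card B div H2 + 1) * (card P + 4 * H1 * H2 * card B)"
proof -
  have fA: "finite A" using A by (rule cvx_finite)
  have fP: "finite P" using P fA B finite_subset by blast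
  have "coll (\<lambda>p. fst p + snd p) P
    \<le> (card A div H1 + card B div H2 + 1) * 
      coll (\<lambda>p. (fst p + snd p, (\<lambda>(a, b). (rk A a div H1, rk B b div H2)) p)) P"
    by (rule coll_le_boxes[OF fP card_box_differences_2[OF fA B H P]])
  also have "\<dots> \<le> (card A div H1 + card B div H2 + 1) * (card P + 4 * H1 * H2 * card B)"
    by (intro mult_le_mono order.refl coll_box_2 assms)
  finally show ?thesis .
qed

lemma ex_nat_between:
  fixes y :: real assumes "y \<ge> 1" "y \<le> real M"
  obtains H :: nat where "1 \<le> H" "H \<le> M" "y \<le> real H" "real H \<le> 2 * y"
proof
  show "1 \<le> nat \<lceil>y\<rceil>" "y \<le> real (nat \<lceil>y\<rceil>)" "real (nat \<lceil>y\<rceil>) \<le> 2 * y" using assms by linarith+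
  show "nat \<lceil>y\<rceil> \<le> M" using assms by (simp add: ceiling_le_iff)
qed

text \<open>Block lengths of about \<open>card A / K\<close> and \<open>card B / K\<close> cut both
  index ranges into about \<open>K\<close> blocks, so \<open>K\<close> becomes the free parameter.
  The bounds on \<open>K\<close> keep both lengths between 1 and the cardinalities.\<close>

lemma coll_sum_le_real:
  assumes A: "cvx A" and B: "finite B" and P: "P \<subseteq> A \<times> B"
    and K: "1 \<le> K" "K \<le> real (card A)" "K \<le> real (card B)"
  shows "real (coll (\<lambda>p. fst p + snd p) P)
    \<le> 3 * K * (real (card P) + 16 * real (card A) * (real (card B))\<^sup>2 / K\<^sup>2)"
proof -
  have Kp: "K > 0" using K by simp
  have "real (card A) / K \<ge> 1" "real (card B) / K \<ge> 1"
    "real (card A) / K \<le> real (card A)" "real (card B) / K \<le> real (card B)"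
    using K by (auto simp: field_simps mult_le_cancel_left1)
  then obtain H1 H2 where H1: "H1 \<ge> 1" "real (card A) / K \<le> real H1" "real H1 \<le> 2 * (real (card A) / K)"
    and H2: "H2 \<ge> 1" "real (card B) / K \<le> real H2" "real H2 \<le> 2 * (real (card B) / K)"
    by (metis ex_nat_between)
  have q1: "real (card A div H1) \<le> K" "real (card B div H2) \<le> K"
  proof -
    have "real (card A div H1) \<le> real (card A) / real H1" by (rule of_nat_div_le_of_nat)
    also have "\<dots> \<le> K" using H1 Kp by (simp add: field_simps)
    finally show "real (card A div H1) \<le> K" .
    have "real (card B div H2) \<le> real (card B) / real H2" by (rule of_nat_div_le_of_nat)
    also have "\<dots> \<le> K" using H2 Kp by (simp add: field_simps)
    finally show "real (card B div H2) \<le> K" .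
  qed
  have "real (coll (\<lambda>p. fst p + snd p) P)
     \<le> real ((card A div H1 + card B div H2 + 1) * (card P + 4 * H1 * H2 * card B))"
    using coll_sum_le[OF A B H1(1) H2(1) P] by (simp only: of_nat_le_iff)
  also have "\<dots> = (real (card A div H1) + real (card B div H2) + 1) *
      (real (card P) + 4 * (real H1 * real H2) * real (card B))" by (simp add: algebra_simps)
  also have "\<dots> \<le> (3 * K) * (real (card P) + 4 * (2 * (real (card A) / K) * (2 * (real (card B) / K))) * real (card B))"
    using q1 K H1 H2 by (intro mult_mono add_mono order.refl) (auto simp: mult_nonneg_nonneg)
  also have "\<dots> = 3 * K * (real (card P) + 16 * real (card A) * (real (card B))\<^sup>2 / K\<^sup>2)"
    by (simp add: power2_eq_square field_simps)
  finally show ?thesis .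
qed

section \<open>Energies and popular sums of a convex set and an arbitrary set\<close>

definition sum_energy :: "real set \<Rightarrow> real set \<Rightarrow> nat" where
  "sum_energy A B = coll (\<lambda>p. fst p + snd p) (A \<times> B)"

lemma sum_energy_le_trivial:
  assumes "finite A" "finite B"
  shows "sum_energy A B \<le> card A * card A * card B"
proof -
  have "card {(p, q). p \<in> A \<times> B \<and> q \<in> A \<times> B \<and> fst p + snd p = fst q + snd q} \<le> card (A \<times> A \<times> B)"
    by (rule card_inj_on_le[of "\<lambda>(p, q). (fst p, fst q, snd p)"]) (use assms in \<open>auto simp: inj_on_def\<close>)
  then show ?thesis by (simp add: sum_energy_def coll_def card_cartesian_product mult_ac)
qed

text \<open>The diagonal contributes \<open>K * n * m\<close> and the other pairs
  \<open>n * m^2 / K\<close>, with \<open>n = card A\<close> and \<open>m = card B\<close>;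
  \<open>K = sqrt m\<close> balances them, and 51 = 3 * (1 + 16). Once \<open>m > n^2\<close> this
  \<open>K\<close> exceeds \<open>n\<close>, and there the trivial bound \<open>n^2 * m\<close> is
  the stronger one.\<close>

lemma sum_energy_le:
  assumes A: "cvx A" and B: "finite B"
  shows "real (sum_energy A B) \<le> 51 * real (card A) * real (card B) * sqrt (real (card B))"
proof -
  have fA: "finite A" using A by (rule cvx_finite)
  let ?n = "real (card A)" and ?m = "real (card B)"
  consider "card B = 0" | "card B > 0" "?m \<le> ?n\<^sup>2" | "?m > ?n\<^sup>2" by linarith
  then show ?thesis
  proof cases
    case 1
    then have "B = {}" using B by simp
    then show ?thesis by (simp add: sum_energy_def coll_def)
  next
    case 2
    have "sqrt ?m \<le> ?n" using 2 real_le_lsqrt by fastforce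
    moreover have "sqrt ?m \<le> ?m" "1 \<le> sqrt ?m" using 2 by (auto simp: real_le_lsqrt power2_eq_square)
    ultimately have "real (sum_energy A B) \<le> 3 * sqrt ?m * (real (card (A \<times> B)) + 16 * ?n * ?m\<^sup>2 / (sqrt ?m)\<^sup>2)"
      unfolding sum_energy_def by (intro coll_sum_le_real A B) auto
    also have "\<dots> = 51 * ?n * ?m * sqrt ?m"
      using 2 by (simp add: card_cartesian_product power2_eq_square field_simps)
    finally show ?thesis .
  next
    case 3
    have "real (sum_energy A B) \<le> real (card A * card A * card B)"
      using sum_energy_le_trivial[OF fA B] by (simp only: of_nat_le_iff)
    also have "\<dots> = (?n * ?m) * ?n" by simp
    also have "\<dots> \<le> (?n * ?m) * sqrt ?m"
      using 3 by (intro mult_left_mono) (auto simp: real_le_rsqrt)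
    also have "\<dots> \<le> 51 * ?n * ?m * sqrt ?m" by (simp add: mult_ac)
    finally show ?thesis .
  qed
qed

text \<open>The substitute for an incidence bound. \<open>B\<close> and \<open>Z\<close> stay
  arbitrary because \<open>Z\<close> is later a set of popular sums, a set of negated differences or
  a translate of a target set.\<close>

lemma card_sum_in_le:
  assumes A: "cvx A" and B: "finite B" and Z: "finite Z"
  shows "(real (card {p \<in> A \<times> B. fst p + snd p \<in> Z})) ^ 3
    \<le> 576 * real (card A) * (real (card B))\<^sup>2 * (real (card Z))\<^sup>2"
proof -
  have fA: "finite A" using A by (rule cvx_finite)
  define P where "P = {p \<in> A \<times> B. fst p + snd p \<in> Z}"
  define X where "X = real (card P)"
  define z where "z = real (card Z)"
  let ?n = "real (card A)" and ?m = "real (card B)"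
  have fP: "finite P" and PA: "P \<subseteq> A \<times> B" and PZ: "(\<lambda>p. fst p + snd p) ` P \<subseteq> Z"
    using fA B by (auto simp: P_def)
  have sq: "X\<^sup>2 \<le> z * real (coll (\<lambda>p. fst p + snd p) P)"
  proof -
    have "(card P)\<^sup>2 \<le> card Z * coll (\<lambda>p. fst p + snd p) P"
      by (rule card_square_le_coll[OF fP Z PZ])
    then have "real ((card P)\<^sup>2) \<le> real (card Z * coll (\<lambda>p. fst p + snd p) P)" by (simp only: of_nat_le_iff)
    then show ?thesis by (simp add: X_def z_def)
  qed
  have X1: "X \<le> z * ?n"
  proof -
    have "card P \<le> card (Z \<times> A)"
      by (rule card_inj_on_le[of "\<lambda>p. (fst p + snd p, fst p)"]) (use Z fA PA PZ in \<open>auto simp: inj_on_def\<close>)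
    then have "real (card P) \<le> real (card Z * card A)" unfolding card_cartesian_product of_nat_le_iff .
    then show ?thesis by (simp add: X_def z_def)
  qed
  have X2: "X \<le> z * ?m"
  proof -
    have "card P \<le> card (Z \<times> B)"
      by (rule card_inj_on_le[of "\<lambda>p. (fst p + snd p, snd p)"]) (use Z B PA PZ in \<open>auto simp: inj_on_def\<close>)
    then have "real (card P) \<le> real (card Z * card B)" unfolding card_cartesian_product of_nat_le_iff .
    then show ?thesis by (simp add: X_def z_def)
  qed
  have X3: "X \<le> ?n * ?m"
    using card_mono[OF _ PA] fA B by (simp add: X_def card_cartesian_product flip: of_nat_mult)
  have X0: "X \<ge> 0" "z \<ge> 0" by (simp_all add: X_def z_def)
  have "X ^ 3 \<le> 576 * ?n * ?m\<^sup>2 * z\<^sup>2"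
  proof (cases "X \<le> 6 * z")
    case True
    have "X ^ 3 = X * (X * X)" by (simp add: power3_eq_cube)
    also have "\<dots> \<le> (?n * ?m) * ((6 * z) * (6 * z))"
      using X0 X3 True by (intro mult_mono) auto
    also have "\<dots> \<le> 36 * (?n * (?m * ?m) * z\<^sup>2)"
    proof -
      have "?m \<le> ?m * ?m" by (metis of_nat_le_iff of_nat_mult le_square)
      then have "(36 * z\<^sup>2 * ?n) * ?m \<le> (36 * z\<^sup>2 * ?n) * (?m * ?m)" by (intro mult_left_mono) auto
      then show ?thesis by (simp add: power2_eq_square mult_ac)
    qed
    also have "\<dots> \<le> 576 * (?n * (?m * ?m) * z\<^sup>2)" by (intro mult_right_mono) auto
    finally show ?thesis by (simp add: power2_eq_square mult_ac)
  next
    case False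
    then have zp: "z > 0" using X0 X1 by (cases "z = 0") auto
    then have Xp: "X > 0" using False X0 by simp
    \<comment> \<open>This makes \<open>z * (3 * K) = X / 2\<close>, which absorbs the diagonal
      term; what remains is \<open>X \<le> 16 * n * m^2 / K^2\<close>, and 16 * 6^2 = 576. The
      trivial bounds \<open>X1\<close> and \<open>X2\<close> make this \<open>K\<close>
      admissible.\<close>
    define K where "K = X / (6 * z)"
    have K: "1 \<le> K" "K \<le> ?n" "K \<le> ?m"
      using False zp X1 X2 by (auto simp: K_def field_simps)
    have "X * X \<le> z * (3 * K * (X + 16 * ?n * ?m\<^sup>2 / K\<^sup>2))"
      using order_trans[OF sq mult_left_mono[OF coll_sum_le_real[OF A B PA K]]] X0
      by (simp add: X_def power2_eq_square)
    also have "\<dots> = X * ((X + 16 * ?n * ?m\<^sup>2 / K\<^sup>2) / 2)"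
      using zp by (simp add: K_def)
    finally have "X \<le> (X + 16 * ?n * ?m\<^sup>2 / K\<^sup>2) / 2" using Xp by (simp only: mult_le_cancel_left_pos)
    then have "X \<le> 16 * ?n * ?m\<^sup>2 / K\<^sup>2" by simp
    also have "\<dots> = 576 * ?n * ?m\<^sup>2 * z\<^sup>2 / X\<^sup>2"
      using zp by (simp add: K_def power2_eq_square)
    finally have "X * X\<^sup>2 \<le> 576 * ?n * ?m\<^sup>2 * z\<^sup>2" using Xp by (simp add: pos_le_divide_eq)
    then show ?thesis by (simp add: power3_eq_cube power2_eq_square mult_ac)
  qed
  then show ?thesis by (simp add: X_def P_def z_def)
qed

text \<open>Each \<open>w \<in> W\<close> contributes at least \<open>\<tau>\<close> to the count of
  the previous lemma; after cubing, a factor \<open>(card W)^2\<close> cancels.\<close>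

lemma card_popular_sums_le:
  assumes A: "cvx A" and B: "finite B" and W: "finite W" and \<tau>: "\<tau> \<ge> 0"
    and pop: "\<And>w. w \<in> W \<Longrightarrow> \<tau> \<le> real (card {p \<in> A \<times> B. fst p + snd p = w})"
  shows "real (card W) * \<tau> ^ 3 \<le> 576 * real (card A) * (real (card B))\<^sup>2"
proof (cases "card W = 0")
  case False
  let ?P = "{p \<in> A \<times> B. fst p + snd p \<in> W}"
  have fA: "finite A" using A by (rule cvx_finite)
  have "real (card W) * \<tau> = (\<Sum>w\<in>W. \<tau>)" by simp
  also have "\<dots> \<le> (\<Sum>w\<in>W. real (card {p \<in> ?P. fst p + snd p = w}))"
  proof (rule sum_mono)
    fix w assume "w \<in> W"
    then have "{p \<in> ?P. fst p + snd p = w} = {p \<in> A \<times> B. fst p + snd p = w}" by auto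
    then show "\<tau> \<le> real (card {p \<in> ?P. fst p + snd p = w})" using pop[OF \<open>w \<in> W\<close>] by simp
  qed
  also have "\<dots> = real (card ?P)"
    by (subst card_eq_sum_fibres[of ?P W "\<lambda>p. fst p + snd p"]) (use fA B W in auto)
  finally have "(real (card W) * \<tau>) ^ 3 \<le> (real (card ?P)) ^ 3" using \<tau> by (intro power_mono) auto
  also have "\<dots> \<le> 576 * real (card A) * (real (card B))\<^sup>2 * (real (card W))\<^sup>2"
    by (rule card_sum_in_le[OF A B W])
  finally have "(real (card W))\<^sup>2 * (real (card W) * \<tau> ^ 3)
     \<le> (real (card W))\<^sup>2 * (576 * real (card A) * (real (card B))\<^sup>2)"
    by (simp add: power_mult_distrib power3_eq_cube power2_eq_square mult_ac)
  then show ?thesis using False by (subst (asm) mult_le_cancel_left_pos) auto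
qed simp

lemma card_zero_sums_3_le:
  assumes A: "cvx A" and B: "finite B" and C: "finite C"
    and N: "real (card A) \<le> N" "real (card B) \<le> N" "real (card C) \<le> N"
  shows "(real (card {(a, b, c). a \<in> A \<and> b \<in> B \<and> c \<in> C \<and> a + b + c = 0})) ^ 3 \<le> 576 * N ^ 5"
proof -
  have fA: "finite A" using A by (rule cvx_finite)
  have N0: "N \<ge> 0" using N(1) by linarith
  have "card {(a, b, c). a \<in> A \<and> b \<in> B \<and> c \<in> C \<and> a + b + c = 0}
     \<le> card {p \<in> A \<times> B. fst p + snd p \<in> uminus ` C}"
  proof (rule card_inj_on_le[of "\<lambda>(a, b, c). (a, b)"])
    show "inj_on (\<lambda>(a, b, c). (a, b)) {(a, b, c). a \<in> A \<and> b \<in> B \<and> c \<in> C \<and> a + b + c = 0}"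
      by (auto simp: inj_on_def)
    show "(\<lambda>(a, b, c). (a, b)) ` {(a, b, c). a \<in> A \<and> b \<in> B \<and> c \<in> C \<and> a + b + c = 0}
       \<subseteq> {p \<in> A \<times> B. fst p + snd p \<in> uminus ` C}"
      by (auto simp: image_iff) (metis add.inverse_inverse eq_neg_iff_add_eq_0)
  qed (use fA B in auto)
  then have "(real (card {(a, b, c). a \<in> A \<and> b \<in> B \<and> c \<in> C \<and> a + b + c = 0})) ^ 3
    \<le> (real (card {p \<in> A \<times> B. fst p + snd p \<in> uminus ` C})) ^ 3" by (intro power_mono) auto
  also have "\<dots> \<le> 576 * real (card A) * (real (card B))\<^sup>2 * (real (card (uminus ` C)))\<^sup>2"
    using C by (intro card_sum_in_le A B) auto
  also have "\<dots> \<le> 576 * N * N\<^sup>2 * N\<^sup>2"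
    using N N0 by (intro mult_mono power_mono) (auto simp: card_image)
  finally show ?thesis by (simp add: power2_eq_square eval_nat_numeral mult_ac)
qed

section \<open>Representations of differences and the third energy\<close>

definition diff_rep :: "real set \<Rightarrow> real \<Rightarrow> nat" where
  "diff_rep A x = card {p \<in> A \<times> A. fst p - snd p = x}"

lemma card_diff_eq_sum: "card {p \<in> A \<times> B. fst p - snd p = x} = card {p \<in> A \<times> uminus ` B. fst p + snd p = (x :: real)}"
  by (rule bij_betw_same_card[of "\<lambda>p. (fst p, - snd p)"], rule bij_betw_byWitness[of _ "\<lambda>p. (fst p, - snd p)"]) auto

lemma card_popular_diffs_le:
  assumes A: "cvx A" and W: "finite W" and \<tau>: "\<tau> \<ge> 0" and pop: "\<And>w. w \<in> W \<Longrightarrow> \<tau> \<le> real (diff_rep A w)"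
  shows "real (card W) * \<tau> ^ 3 \<le> 576 * (real (card A)) ^ 3"
  using card_popular_sums_le[OF A _ W \<tau>, of "uminus ` A"] pop cvx_finite[OF A]
  by (simp add: diff_rep_def card_diff_eq_sum card_image power3_eq_cube power2_eq_square mult_ac)

text \<open>
  Avoids dyadic sums: ordering \<open>D\<close> decreasingly, the \<open>n\<close>-th value is bounded by \<open>\<phi> n\<close>.
\<close>

lemma sum_le_sum_of_min_bound:
  fixes g :: "'a \<Rightarrow> real"
  assumes "finite D" "\<And>S. S \<subseteq> D \<Longrightarrow> S \<noteq> {} \<Longrightarrow> \<exists>x\<in>S. g x \<le> \<phi> (card S)"
  shows "sum g D \<le> (\<Sum>n=1..card D. \<phi> n)"
  using assms
proof (induction "card D" arbitrary: D)
  case (Suc n)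
  then have "D \<noteq> {}" by auto
  then obtain x where x: "x \<in> D" "g x \<le> \<phi> (card D)" using Suc.prems by blast
  have D: "card D = Suc n" using Suc.hyps(2) by simp
  have c: "card (D - {x}) = n" using D x by simp
  have "sum g (D - {x}) \<le> (\<Sum>n=1..card (D - {x}). \<phi> n)"
  proof (rule Suc.hyps(1))
    fix S assume "S \<subseteq> D - {x}" "S \<noteq> {}"
    then show "\<exists>x\<in>S. g x \<le> \<phi> (card S)" using Suc.prems(2) by blast
  qed (use c Suc.prems in auto)
  moreover have "sum g D = g x + sum g (D - {x})" using x Suc.prems(1) by (simp add: sum.remove)
  ultimately show ?case using x(2) unfolding c D by simp
qed simp

text \<open>The third energy, i.e. the sum of the cubes of the representation numbers of
  differences: equality of both consecutive differences means
  \<open>a - a' = b - b' = c - c'\<close>. The form chosen here is the one that Cauchy-Schwarz over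
  pairs of differences produces.\<close>

definition triple_energy :: "real set \<Rightarrow> nat" where
  "triple_energy A = coll (\<lambda>(a, b, c). (a - b, b - c)) (A \<times> A \<times> A)"

lemma triple_energy_le_sum_diff_rep:
  assumes "finite A"
  shows "triple_energy A \<le> (\<Sum>x\<in>diffset A. diff_rep A x ^ 3)"
proof -
  let ?R = "\<lambda>x. {p \<in> A \<times> A. fst p - snd p = x}"
  have fin: "finite (diffset A)"
    by (rule finite_subset[of _ "(\<lambda>(a, b). a - b) ` (A \<times> A)"]) (use assms in \<open>auto simp: diffset_def\<close>)
  let ?S = "{(p, q). p \<in> A \<times> A \<times> A \<and> q \<in> A \<times> A \<times> A \<and> (\<lambda>(a, b, c). (a - b, b - c)) p = (\<lambda>(a, b, c). (a - b, b - c)) q}"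
  have "card ?S \<le> card (\<Union>x\<in>diffset A. ?R x \<times> ?R x \<times> ?R x)"
  proof (rule card_inj_on_le[of "\<lambda>((a, b, c), (a', b', c')). ((a, a'), (b, b'), (c, c'))"])
    show "finite (\<Union>x\<in>diffset A. ?R x \<times> ?R x \<times> ?R x)" using fin assms by auto
    show "inj_on (\<lambda>((a, b, c), (a', b', c')). ((a, a'), (b, b'), (c, c'))) ?S"
      by (rule inj_onI) (auto split: prod.splits)
    show "(\<lambda>((a, b, c), (a', b', c')). ((a, a'), (b, b'), (c, c'))) ` ?S \<subseteq> (\<Union>x\<in>diffset A. ?R x \<times> ?R x \<times> ?R x)"
    proof (rule image_subsetI)
      fix y assume y: "y \<in> ?S"
      obtain a b c a' b' c' where yy: "y = ((a, b, c), (a', b', c'))" by (metis surj_pair)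
      have m: "a \<in> A" "b \<in> A" "c \<in> A" "a' \<in> A" "b' \<in> A" "c' \<in> A" and e: "a - b = a' - b'" "b - c = b' - c'"
        using y unfolding yy by auto
      have "a - a' \<in> diffset A" "b - b' = a - a'" "c - c' = a - a'" using m e by (auto simp: diffset_def)
      then show "(\<lambda>((a, b, c), (a', b', c')). ((a, a'), (b, b'), (c, c'))) y \<in> (\<Union>x\<in>diffset A. ?R x \<times> ?R x \<times> ?R x)"
        unfolding yy using m by auto
    qed
  qed
  also have "\<dots> \<le> (\<Sum>x\<in>diffset A. card (?R x \<times> ?R x \<times> ?R x))"
    by (rule card_UN_le[OF fin])
  finally show ?thesis by (simp add: triple_energy_def coll_def diff_rep_def card_cartesian_product power3_eq_cube mult_ac)
qed

lemma card_diffset_le: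
  assumes "finite A" shows "finite (diffset A)" "card (diffset A) \<le> (card A)\<^sup>2"
proof -
  have "diffset A = (\<lambda>(a, b). a - b) ` (A \<times> A)" by (auto simp: diffset_def)
  then show "finite (diffset A)" "card (diffset A) \<le> (card A)\<^sup>2"
    using assms card_image_le[of "A \<times> A" "\<lambda>(a, b). a - b"] by (auto simp: card_cartesian_product power2_eq_square)
qed

text \<open>The \<open>k\<close>-th most popular difference \<open>x\<close> satisfies
  \<open>k * (diff_rep A x)^3 \<le> 576 * N^3\<close>, so the cubes are dominated by a harmonic
  series over at most \<open>N^2\<close> differences.\<close>

lemma triple_energy_le:
  assumes A: "cvx A"
  shows "real (triple_energy A) \<le> 576 * (real (card A)) ^ 3 * (1 + 2 * ln (real (card A)))"
proof (cases "A = {}")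
  case True
  then show ?thesis by (simp add: triple_energy_def coll_def)
next
  case False
  have fA: "finite A" using A by (rule cvx_finite)
  let ?D = "diffset A" let ?n = "real (card A)"
  note D = card_diffset_le[OF fA]
  have "card A > 0" using False fA by auto
  have Dp: "card ?D > 0" using False D(1) by (auto simp: card_gt_0_iff diffset_def)
  have "real (triple_energy A) \<le> (\<Sum>x\<in>?D. real (diff_rep A x ^ 3))"
    using triple_energy_le_sum_diff_rep[OF fA] by (simp only: of_nat_le_iff of_nat_sum[symmetric])
  also have "\<dots> \<le> (\<Sum>k=1..card ?D. 576 * ?n ^ 3 * inverse (real k))"
  proof (rule sum_le_sum_of_min_bound[OF D(1)])
    fix S assume S: "S \<subseteq> ?D" "S \<noteq> {}"
    have fS: "finite S" using S D finite_subset by blast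
    define m where "m = Min (diff_rep A ` S)"
    have "m \<in> diff_rep A ` S" unfolding m_def using fS S by (intro Min_in) auto
    then obtain x where x: "x \<in> S" "diff_rep A x = m" by auto
    have "real (card S) * real m ^ 3 \<le> 576 * ?n ^ 3"
      using fS S by (intro card_popular_diffs_le A) (auto simp: m_def)
    then have "real (diff_rep A x ^ 3) \<le> 576 * ?n ^ 3 * inverse (real (card S))"
      using x S fS by (simp add: field_simps card_gt_0_iff)
    then show "\<exists>x\<in>S. real (diff_rep A x ^ 3) \<le> 576 * ?n ^ 3 * inverse (real (card S))" using x by blast
  qed
  also have "\<dots> = 576 * ?n ^ 3 * harm (card ?D)"
    by (simp add: harm_def sum_distrib_left)
  also have "\<dots> \<le> 576 * ?n ^ 3 * (1 + 2 * ln ?n)"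
  proof (rule mult_left_mono)
    \<comment> \<open>\<open>harm n - ln n\<close> decreases and equals 1 at
      \<open>n = 1\<close>.\<close>
    have "harm (card ?D) \<le> ln (real (card ?D)) + 1"
      using decseq_harm_diff_ln[THEN decseqD, of 0 "card ?D - 1"] Dp by (simp add: harm_expand)
    also have "ln (real (card ?D)) \<le> ln (?n ^ 2)"
      using D(2) Dp \<open>card A > 0\<close> by (simp flip: of_nat_power)
    also have "\<dots> = 2 * ln ?n" using \<open>card A > 0\<close> by (subst ln_realpow) auto
    finally show "harm (card ?D) \<le> 1 + 2 * ln ?n" by simp
  qed simp
  finally show ?thesis .
qed

subsection \<open>The Perron vector of the graph of popular differences\<close>

text \<open>\<open>\<mu>\<close> is the maximum of the quadratic form over nonnegative unit vectors
  and \<open>f\<close> a maximiser, which exists by compactness. Lowering a single coordinate of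
  \<open>f\<close> yields the entrywise inequality, which can afterwards be tested against any
  nonnegative vector. The constant unit vector shows that \<open>\<mu>\<close> is at least the
  average row sum.\<close>

lemma perron_vector:
  fixes M :: "'a \<Rightarrow> 'a \<Rightarrow> real"
  assumes A: "finite A" "A \<noteq> {}" and sym: "\<And>a b. M a b = M b a" and nn: "\<And>a b. M a b \<ge> 0"
  obtains f \<mu> where "\<And>a. f a \<ge> 0" "(\<Sum>a\<in>A. (f a)\<^sup>2) = 1"
    "\<And>a. a \<in> A \<Longrightarrow> \<mu> * f a \<le> (\<Sum>b\<in>A. M a b * f b)"
    "(\<Sum>a\<in>A. \<Sum>b\<in>A. M a b * f a * f b) = \<mu>"
    "(\<Sum>a\<in>A. \<Sum>b\<in>A. M a b) \<le> \<mu> * real (card A)"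
proof -
  define q where "q = (\<lambda>f. \<Sum>a\<in>A. \<Sum>b\<in>A. M a b * f a * f b)"
  define s where "s = (\<lambda>f::'a \<Rightarrow> real. \<Sum>a\<in>A. (f a)\<^sup>2)"
  \<comment> \<open>Coordinates outside \<open>A\<close> are pinned to 0, so that compactness of the
    box follows from Tychonoff's theorem on the whole function space. On \<open>A\<close> the range
    up to 1 loses nothing for vectors of norm 1.\<close>
  define K where "K = PiE UNIV (\<lambda>a. if a \<in> A then {0..1::real} else {0}) \<inter> {f. s f = 1}"
  have cont: "continuous_on UNIV s" "continuous_on UNIV q"
    unfolding s_def q_def by (intro continuous_intros; simp)+
  have "compactin (product_topology (\<lambda>_. euclidean) UNIV) (PiE UNIV (\<lambda>a. if a \<in> A then {0..1::real} else {0}))"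
    by (subst compactin_PiE) auto
  then have "compact (PiE UNIV (\<lambda>a. if a \<in> A then {0..1::real} else {0}))"
    by (simp add: euclidean_product_topology)
  moreover have "closed {f. s f = 1}"
    by (intro closed_Collect_eq cont continuous_intros)
  ultimately have "compact K" unfolding K_def by (rule compact_Int_closed)
  have memK: "g \<in> K" if "\<And>a. a \<in> A \<Longrightarrow> g a \<ge> 0" "\<And>a. a \<notin> A \<Longrightarrow> g a = 0" "s g = 1" for g
  proof -
    have "g a \<le> 1" if "a \<in> A" for a
    proof -
      have "(g a)\<^sup>2 \<le> s g" unfolding s_def using that A by (intro member_le_sum) auto
      then show ?thesis using \<open>s g = 1\<close> by (simp add: power2_le_iff_abs_le[of 1, simplified])
    qed
    then show ?thesis using that by (auto simp: K_def PiE_def)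
  qed
  define c where "c = 1 / sqrt (real (card A))"
  have cA: "real (card A) > 0" using A by (simp add: card_gt_0_iff)
  define u where "u = (\<lambda>a. if a \<in> A then c else 0)"
  have uK: "u \<in> K"
    by (rule memK) (use cA in \<open>auto simp: u_def s_def c_def power_divide\<close>)
  then have "K \<noteq> {}" by auto
  then obtain f where f: "f \<in> K" "\<And>g. g \<in> K \<Longrightarrow> q g \<le> q f"
    using continuous_attains_sup[OF \<open>compact K\<close> _ continuous_on_subset[OF cont(2)]] by auto
  have f0: "f a \<ge> 0" for a
  proof -
    have "f a \<in> (if a \<in> A then {0..1} else {0})" using f(1) unfolding K_def PiE_def by blast
    then show ?thesis by (auto split: if_splits)
  qed
  have fo: "f a = 0" if "a \<notin> A" for a
  proof -
    have "f a \<in> (if a \<in> A then {0..1} else {0})" using f(1) unfolding K_def PiE_def by blast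
    then show ?thesis using that by auto
  qed
  have sf: "s f = 1" using f(1) by (simp add: K_def)
  define \<mu> where "\<mu> = q f"
  \<comment> \<open>Both sides are homogeneous of degree 2, which frees the maximality from the
    normalisation and permits perturbations of \<open>f\<close>.\<close>
  have max: "q g \<le> \<mu> * s g" if g: "\<And>a. a \<in> A \<Longrightarrow> g a \<ge> 0" "\<And>a. a \<notin> A \<Longrightarrow> g a = 0" for g
  proof (cases "s g = 0")
    case True
    then have "\<forall>a\<in>A. g a = 0" using A unfolding s_def by (subst (asm) sum_nonneg_eq_0_iff) auto
    then show ?thesis using True by (simp add: q_def)
  next
    case False
    have "s g \<ge> 0" unfolding s_def by (intro sum_nonneg) auto
    then have sg: "s g > 0" using False by simp
    define h where "h = (\<lambda>a. g a / sqrt (s g))"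
    have "s h = (\<Sum>a\<in>A. (g a)\<^sup>2 / s g)"
      using sg by (subst s_def) (simp add: h_def power_divide)
    also have "\<dots> = 1" using sg by (simp add: s_def flip: sum_divide_distrib)
    finally have "h \<in> K" by (intro memK) (use g sg in \<open>auto simp: h_def\<close>)
    have "q h = (\<Sum>a\<in>A. \<Sum>b\<in>A. M a b * g a * g b / s g)"
      unfolding q_def h_def using sg by (simp add: field_simps flip: power2_eq_square)
    also have "\<dots> = q g / s g" by (simp add: q_def sum_divide_distrib)
    finally have "q g / s g \<le> \<mu>" using f(2)[OF \<open>h \<in> K\<close>] by (simp add: \<mu>_def)
    then show ?thesis using sg by (simp add: field_simps)
  qed
  have "\<mu> * f a \<le> (\<Sum>b\<in>A. M a b * f b)" if a: "a \<in> A" for a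
  proof (cases "f a = 0")
    case True
    then show ?thesis using f0 nn by (auto intro!: sum_nonneg)
  next
    case False
    then have fa: "f a > 0" using f0[of a] by simp
    define v where "v = (\<Sum>b\<in>A. M a b * f b)"
    have key: "\<mu> * f a \<le> v + e * \<bar>\<mu>\<bar>" if e: "0 < e" "e < f a" for e
    proof -
      define d where "d = (\<lambda>x. if x = a then e else 0)"
      have "q (\<lambda>x. f x - d x) \<le> \<mu> * s (\<lambda>x. f x - d x)"
        by (rule max) (use e f0 fo a in \<open>auto simp: d_def\<close>)
      also have "s (\<lambda>x. f x - d x) = s f - (\<Sum>x\<in>A. (2 * f x * e - e\<^sup>2) * of_bool (x = a))"
        unfolding s_def sum_subtractf[symmetric]
        by (intro sum.cong) (auto simp: d_def power2_eq_square algebra_simps)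
      also have "(\<Sum>x\<in>A. (2 * f x * e - e\<^sup>2) * of_bool (x = a)) = 2 * f a * e - e\<^sup>2"
        using A a by (simp add: of_bool_def if_distrib cong: if_cong)
      also have "q (\<lambda>x. f x - d x) = q f - (\<Sum>x\<in>A. \<Sum>y\<in>A. M x y * d x * f y)
          - (\<Sum>x\<in>A. \<Sum>y\<in>A. M x y * f x * d y) + (\<Sum>x\<in>A. \<Sum>y\<in>A. M x y * d x * d y)"
        unfolding q_def sum_subtractf[symmetric] sum.distrib[symmetric]
        by (intro sum.cong) (auto simp: algebra_simps)
      also have "(\<Sum>x\<in>A. \<Sum>y\<in>A. M x y * d x * f y) = (\<Sum>x\<in>A. if x = a then e * v else 0)"
        by (intro sum.cong) (auto simp: d_def v_def sum_distrib_left mult_ac)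
      also have "\<dots> = e * v" using A a by simp
      also have "(\<Sum>x\<in>A. \<Sum>y\<in>A. M x y * f x * d y) = (\<Sum>y\<in>A. \<Sum>x\<in>A. M x y * f x * d y)"
        by (rule sum.swap)
      also have "\<dots> = (\<Sum>y\<in>A. if y = a then e * v else 0)"
        by (intro sum.cong refl) (auto simp: d_def v_def sum_distrib_left mult_ac sym[of _ a])
      also have "\<dots> = e * v" using A a by simp
      finally have "\<mu> - e * v - e * v + (\<Sum>x\<in>A. \<Sum>y\<in>A. M x y * d x * d y) \<le> \<mu> * (1 - (2 * f a * e - e\<^sup>2))"
        by (simp add: sf \<mu>_def)
      moreover have "(\<Sum>x\<in>A. \<Sum>y\<in>A. M x y * d x * d y) \<ge> 0"
        using nn e by (intro sum_nonneg) (auto simp: d_def)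
      ultimately have "e * (2 * (\<mu> * f a)) \<le> e * (2 * v + e * \<mu>)"
        by (simp add: algebra_simps power2_eq_square)
      then have "2 * (\<mu> * f a) \<le> 2 * v + e * \<mu>" using e by simp
      moreover have "e * \<mu> \<le> e * \<bar>\<mu>\<bar>" "0 \<le> e * \<bar>\<mu>\<bar>" using e by (auto intro: mult_left_mono)
      ultimately show ?thesis by linarith
    qed
    have "\<mu> * f a \<le> v + r" if r: "r > 0" for r
    proof -
      define e where "e = min (f a / 2) (r / (\<bar>\<mu>\<bar> + 1))"
      have e: "0 < e" "e < f a" using fa r by (auto simp: e_def)
      have "e * \<bar>\<mu>\<bar> \<le> r / (\<bar>\<mu>\<bar> + 1) * \<bar>\<mu>\<bar>" by (intro mult_right_mono) (auto simp: e_def)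
      also have "\<dots> \<le> r" using r by (simp add: field_simps)
      finally show ?thesis using key[OF e] by linarith
    qed
    then show ?thesis unfolding v_def by (rule field_le_epsilon)
  qed
  moreover have "(\<Sum>a\<in>A. \<Sum>b\<in>A. M a b) \<le> \<mu> * real (card A)"
  proof -
    have "q u = (\<Sum>a\<in>A. \<Sum>b\<in>A. M a b / real (card A))"
      unfolding q_def by (intro sum.cong refl) (use cA in \<open>auto simp: u_def c_def field_simps\<close>)
    also have "\<dots> = (\<Sum>a\<in>A. \<Sum>b\<in>A. M a b) / real (card A)" by (simp add: sum_divide_distrib)
    finally have "(\<Sum>a\<in>A. \<Sum>b\<in>A. M a b) = q u * real (card A)" using cA by simp
    also have "\<dots> \<le> \<mu> * real (card A)" unfolding \<mu>_def by (intro mult_right_mono f(2)[OF uK]) auto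
    finally show ?thesis .
  qed
  moreover have "(\<Sum>a\<in>A. (f a)\<^sup>2) = 1" using sf by (simp only: s_def)
  moreover have "(\<Sum>a\<in>A. \<Sum>b\<in>A. M a b * f a * f b) = \<mu>" by (simp only: \<mu>_def q_def)
  ultimately show ?thesis using f0 by (intro that[of f \<mu>])
qed

text \<open>A representation of \<open>a - c\<close> is a translation carrying the pair
  \<open>a\<close>, \<open>c\<close> into \<open>A\<close>. This is what turns the matrix of
  representation numbers into a Gram matrix.\<close>

lemma diff_rep_eq_card_translations:
  assumes "a \<in> A" "c \<in> A"
  shows "card {t \<in> diffset A. a + t \<in> A \<and> c + t \<in> A} = diff_rep A (a - c)"
  unfolding diff_rep_def
proof (rule bij_betw_same_card, rule bij_betw_byWitness)
  show "\<forall>t\<in>{t \<in> diffset A. a + t \<in> A \<and> c + t \<in> A}. fst (a + t, c + t) - a = t" by simp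
  show "\<forall>p\<in>{p \<in> A \<times> A. fst p - snd p = a - c}. (a + (fst p - a), c + (fst p - a)) = p"
  proof
    fix p assume "p \<in> {p \<in> A \<times> A. fst p - snd p = a - c}"
    then have "c + (fst p - a) = snd p" by simp
    then show "(a + (fst p - a), c + (fst p - a)) = p" by (simp add: prod_eq_iff)
  qed
  show "(\<lambda>t. (a + t, c + t)) ` {t \<in> diffset A. a + t \<in> A \<and> c + t \<in> A} \<subseteq> {p \<in> A \<times> A. fst p - snd p = a - c}" by auto
  show "(\<lambda>p. fst p - a) ` {p \<in> A \<times> A. fst p - snd p = a - c} \<subseteq> {t \<in> diffset A. a + t \<in> A \<and> c + t \<in> A}"
  proof clarsimp
    fix x y assume h: "x \<in> A" "y \<in> A" "x - y = a - c"
    then have y: "c + (x - a) = y" by simp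
    have "x - a \<in> diffset A" using h assms by (auto simp: diffset_def)
    then show "x - a \<in> diffset A \<and> c + (x - a) \<in> A" unfolding y using h by blast
  qed
qed

text \<open>
  The matrix \<open>diff_rep A (a - c)\<close> is a sum of squares of the indicator vectors of \<open>A - t\<close> and dominates
  \<open>\<Delta>\<close> times the adjacency matrix; each square is tested against the Perron vector of the latter.
\<close>

lemma sum_popular_paths_ge:
  assumes A: "finite A" "A \<noteq> {}" and sym: "\<And>x. x \<in> P \<longleftrightarrow> - x \<in> P"
    and \<Delta>: "\<Delta> \<ge> 0" "\<And>x. x \<in> P \<Longrightarrow> \<Delta> \<le> real (diff_rep A x)"
  shows "\<Delta> * (real (card {p \<in> A \<times> A. fst p - snd p \<in> P}) / real (card A)) ^ 3
    \<le> (\<Sum>a\<in>A. \<Sum>b\<in>A. \<Sum>c\<in>A. of_bool (a - b \<in> P) * of_bool (b - c \<in> P) * real (diff_rep A (a - c)))"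
proof -
  define M :: "real \<Rightarrow> real \<Rightarrow> real" where "M = (\<lambda>a b. of_bool (a - b \<in> P))"
  have Msym: "M a b = M b a" for a b using sym[of "a - b"] by (simp add: M_def)
  have Mnn: "M a b \<ge> 0" for a b by (simp add: M_def)
  obtain f \<mu> where f: "\<And>a. f a \<ge> 0" "(\<Sum>a\<in>A. (f a)\<^sup>2) = 1"
    "\<And>a. a \<in> A \<Longrightarrow> \<mu> * f a \<le> (\<Sum>b\<in>A. M a b * f b)"
    "(\<Sum>a\<in>A. \<Sum>b\<in>A. M a b * f a * f b) = \<mu>"
    "(\<Sum>a\<in>A. \<Sum>b\<in>A. M a b) \<le> \<mu> * real (card A)"
    by (rule perron_vector[OF A, of M, OF Msym Mnn], rule that)
  define T where "T = diffset A"
  have fT: "finite T" using card_diffset_le A by (simp add: T_def)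
  define u :: "real \<Rightarrow> real \<Rightarrow> real" where "u = (\<lambda>t a. of_bool (a + t \<in> A))"
  have u0: "u t a \<ge> 0" for t a by (simp add: u_def)
  have R: "real (diff_rep A (a - c)) = (\<Sum>t\<in>T. u t a * u t c)" if "a \<in> A" "c \<in> A" for a c
  proof -
    have "(\<Sum>t\<in>T. u t a * u t c) = (\<Sum>t\<in>T. if a + t \<in> A \<and> c + t \<in> A then 1 else 0)"
      by (intro sum.cong) (auto simp: u_def)
    also have "\<dots> = real (card {t \<in> T. a + t \<in> A \<and> c + t \<in> A})"
      using fT by (simp add: sum.If_cases Int_def)
    finally show ?thesis using diff_rep_eq_card_translations[OF that] by (simp add: T_def)
  qed
  have card_m: "real (card {p \<in> A \<times> A. fst p - snd p \<in> P}) = (\<Sum>a\<in>A. \<Sum>b\<in>A. M a b)"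
  proof -
    have "(\<Sum>a\<in>A. \<Sum>b\<in>A. M a b) = (\<Sum>p\<in>A \<times> A. if fst p - snd p \<in> P then 1 else 0)"
      by (simp add: sum.cartesian_product M_def of_bool_def case_prod_beta)
    also have "\<dots> = real (card {p \<in> A \<times> A. fst p - snd p \<in> P})"
      using A by (simp add: sum.If_cases Int_def)
    finally show ?thesis by simp
  qed
  have cA: "real (card A) > 0" using A by (simp add: card_gt_0_iff)
  define w where "w = (\<Sum>a\<in>A. \<Sum>b\<in>A. M a b) / real (card A)"
  have w0: "w \<ge> 0" unfolding w_def using Mnn by (intro divide_nonneg_nonneg sum_nonneg) auto
  have w\<mu>: "w \<le> \<mu>" using f(5) cA by (simp add: w_def field_simps)
  then have \<mu>0: "\<mu> \<ge> 0" using w0 by linarith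
  define v where "v = (\<lambda>t b. \<Sum>a\<in>A. M b a * u t a)"
  have 1: "(\<mu> * (\<Sum>a\<in>A. u t a * f a))\<^sup>2 \<le> (\<Sum>b\<in>A. (v t b)\<^sup>2)" for t
  proof -
    have "\<mu> * (\<Sum>a\<in>A. u t a * f a) = (\<Sum>a\<in>A. u t a * (\<mu> * f a))" by (simp add: sum_distrib_left mult_ac)
    also have "\<dots> \<le> (\<Sum>a\<in>A. u t a * (\<Sum>b\<in>A. M a b * f b))"
      by (intro sum_mono mult_left_mono f(3) u0)
    also have "\<dots> = (\<Sum>a\<in>A. \<Sum>b\<in>A. M b a * u t a * f b)"
      by (simp add: sum_distrib_left mult_ac Msym)
    also have "\<dots> = (\<Sum>b\<in>A. v t b * f b)"
      by (subst sum.swap) (simp add: v_def sum_distrib_right)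
    finally have "(\<mu> * (\<Sum>a\<in>A. u t a * f a))\<^sup>2 \<le> (\<Sum>b\<in>A. v t b * f b)\<^sup>2"
      using \<mu>0 u0 f(1) by (intro power_mono mult_nonneg_nonneg sum_nonneg) auto
    also have "\<dots> \<le> (\<Sum>b\<in>A. (v t b)\<^sup>2) * (\<Sum>b\<in>A. (f b)\<^sup>2)" by (rule Cauchy_Schwarz_ineq_sum)
    finally show ?thesis using f(2) by simp
  qed
  have "\<Delta> * w ^ 3 \<le> \<Delta> * \<mu> ^ 3"
    using \<Delta>(1) w0 w\<mu> by (intro mult_left_mono power_mono) auto
  also have "\<dots> = \<mu>\<^sup>2 * (\<Delta> * \<mu>)" by (simp add: power2_eq_square power3_eq_cube)
  also have "\<Delta> * \<mu> = (\<Sum>a\<in>A. \<Sum>c\<in>A. \<Delta> * M a c * (f a * f c))"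
    unfolding f(4)[symmetric] by (simp add: sum_distrib_left mult_ac)
  also have "\<mu>\<^sup>2 * \<dots> \<le> \<mu>\<^sup>2 * (\<Sum>a\<in>A. \<Sum>c\<in>A. real (diff_rep A (a - c)) * (f a * f c))"
  proof (intro mult_left_mono sum_mono mult_right_mono)
    show "\<Delta> * M a c \<le> real (diff_rep A (a - c))" for a c using \<Delta> by (cases "a - c \<in> P") (auto simp: M_def)
  qed (use f(1) in auto)
  also have "(\<Sum>a\<in>A. \<Sum>c\<in>A. real (diff_rep A (a - c)) * (f a * f c))
     = (\<Sum>a\<in>A. \<Sum>c\<in>A. \<Sum>t\<in>T. (u t a * f a) * (u t c * f c))"
    by (intro sum.cong refl) (simp add: R sum_distrib_right sum_distrib_left mult_ac)
  also have "\<dots> = (\<Sum>a\<in>A. \<Sum>t\<in>T. \<Sum>c\<in>A. (u t a * f a) * (u t c * f c))"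
    by (rule sum.cong[OF refl], rule sum.swap)
  also have "\<dots> = (\<Sum>t\<in>T. \<Sum>a\<in>A. \<Sum>c\<in>A. (u t a * f a) * (u t c * f c))"
    by (rule sum.swap)
  also have "\<dots> = (\<Sum>t\<in>T. (\<Sum>a\<in>A. u t a * f a)\<^sup>2)"
    by (simp add: power2_eq_square sum_product)
  also have "\<mu>\<^sup>2 * \<dots> = (\<Sum>t\<in>T. (\<mu> * (\<Sum>a\<in>A. u t a * f a))\<^sup>2)"
    unfolding power_mult_distrib by (rule sum_distrib_left)
  also have "\<dots> \<le> (\<Sum>t\<in>T. \<Sum>b\<in>A. (v t b)\<^sup>2)" by (intro sum_mono 1)
  also have "\<dots> = (\<Sum>t\<in>T. \<Sum>b\<in>A. \<Sum>a\<in>A. \<Sum>c\<in>A. M a b * M b c * (u t a * u t c))"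
    unfolding v_def power2_eq_square sum_product
    by (intro sum.cong refl) (simp add: Msym mult_ac)
  also have "\<dots> = (\<Sum>b\<in>A. \<Sum>t\<in>T. \<Sum>a\<in>A. \<Sum>c\<in>A. M a b * M b c * (u t a * u t c))"
    by (rule sum.swap)
  also have "\<dots> = (\<Sum>b\<in>A. \<Sum>a\<in>A. \<Sum>t\<in>T. \<Sum>c\<in>A. M a b * M b c * (u t a * u t c))"
    by (rule sum.cong[OF refl], rule sum.swap)
  also have "\<dots> = (\<Sum>b\<in>A. \<Sum>a\<in>A. \<Sum>c\<in>A. \<Sum>t\<in>T. M a b * M b c * (u t a * u t c))"
    by (rule sum.cong[OF refl], rule sum.cong[OF refl], rule sum.swap)
  also have "\<dots> = (\<Sum>a\<in>A. \<Sum>b\<in>A. \<Sum>c\<in>A. \<Sum>t\<in>T. M a b * M b c * (u t a * u t c))"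
    by (rule sum.swap)
  also have "\<dots> = (\<Sum>a\<in>A. \<Sum>b\<in>A. \<Sum>c\<in>A. M a b * M b c * real (diff_rep A (a - c)))"
    by (intro sum.cong refl) (simp add: R sum_distrib_left)
  finally show ?thesis by (simp add: w_def card_m M_def)
qed

subsection \<open>The additive energy of convex sets\<close>

definition dyadic_levels :: "nat \<Rightarrow> nat" where
  "dyadic_levels N = Suc (nat \<lfloor>log 2 (real N)\<rfloor>)"

lemma dyadic_level:
  assumes "1 \<le> m" "m \<le> N"
  obtains k where "k < dyadic_levels N" "(2::nat) ^ k \<le> m" "m < 2 ^ Suc k"
proof -
  obtain k where k: "(2::nat) ^ k \<le> m" "m < 2 ^ (k + 1)" using ex_power_ivl1[of 2 m] assms by auto
  have "(2::real) ^ k \<le> real N" using k(1) assms(2) by (metis of_nat_le_iff of_nat_numeral of_nat_power order_trans)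
  then have "real k \<le> log 2 (real N)" using assms by (simp add: le_log_iff powr_realpow)
  then have "k < dyadic_levels N" unfolding dyadic_levels_def by linarith
  then show ?thesis using that k by simp
qed

lemma dyadic_levels_le:
  assumes "N \<ge> 1" shows "1 \<le> real (dyadic_levels N)" "real (dyadic_levels N) \<le> 1 + 2 * ln (real N)"
proof -
  show "1 \<le> real (dyadic_levels N)" by (simp add: dyadic_levels_def)
  have "ln (2::real) \<ge> 1 / 2" using ln_le_minus_one[of "1 / 2 :: real"] by (simp add: ln_div)
  then have "ln (real N) * 1 \<le> ln (real N) * (2 * ln 2)" using assms by (intro mult_left_mono) auto
  then have "log 2 (real N) \<le> 2 * ln (real N)" by (simp add: log_def field_simps)
  moreover have "log 2 (real N) \<ge> 0" using assms by simp
  ultimately show "real (dyadic_levels N) \<le> 1 + 2 * ln (real N)" unfolding dyadic_levels_def by linarith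
qed

lemma dyadic_pigeonhole:
  fixes w :: "'a \<Rightarrow> real"
  assumes X: "finite X" and r: "\<And>x. x \<in> X \<Longrightarrow> 1 \<le> r x \<and> r x \<le> N" and w: "\<And>x. x \<in> X \<Longrightarrow> w x \<ge> 0"
  shows "\<exists>k. sum w X \<le> real (dyadic_levels N) * (\<Sum>x | x \<in> X \<and> 2 ^ k \<le> r x \<and> r x < 2 ^ Suc k. w x)"
proof (rule ccontr)
  let ?L = "\<lambda>k. {x. x \<in> X \<and> 2 ^ k \<le> r x \<and> r x < 2 ^ Suc k}"
  assume "\<not> ?thesis"
  then have less: "real (dyadic_levels N) * sum w (?L k) < sum w X" for k by (simp add: not_le)
  have "X \<subseteq> (\<Union>k<dyadic_levels N. ?L k)"
  proof
    fix x assume "x \<in> X"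
    then obtain k where "k < dyadic_levels N" "2 ^ k \<le> r x" "r x < 2 ^ Suc k" using r dyadic_level by metis
    then show "x \<in> (\<Union>k<dyadic_levels N. ?L k)" using \<open>x \<in> X\<close> by blast
  qed
  then have "1 \<le> (\<Sum>k<dyadic_levels N. of_bool (2 ^ k \<le> r x \<and> r x < 2 ^ Suc k) :: real)" if "x \<in> X" for x
    using that by (subst sum_of_bool_eq) (auto simp: Suc_le_eq card_gt_0_iff simp del: power_Suc)
  then have "sum w X \<le> (\<Sum>x\<in>X. w x * (\<Sum>k<dyadic_levels N. of_bool (2 ^ k \<le> r x \<and> r x < 2 ^ Suc k)))"
    using w by (intro sum_mono) (metis mult.right_neutral mult_left_mono)
  also have "\<dots> = (\<Sum>k<dyadic_levels N. \<Sum>x\<in>X. w x * of_bool (2 ^ k \<le> r x \<and> r x < 2 ^ Suc k))"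
    unfolding sum_distrib_left by (rule sum.swap)
  also have "\<dots> = (\<Sum>k<dyadic_levels N. sum w (?L k))"
    by (rule sum.cong[OF refl], subst sum.inter_filter[OF X]) (auto intro!: sum.cong)
  finally have "real (dyadic_levels N) * sum w X \<le> (\<Sum>k<dyadic_levels N. real (dyadic_levels N) * sum w (?L k))"
    by (simp add: sum_distrib_left[symmetric] mult_left_mono)
  also have "\<dots> < (\<Sum>k<dyadic_levels N. sum w X)"
    by (intro sum_strict_mono less) (auto simp: dyadic_levels_def)
  finally show False by simp
qed

section \<open>Popular differences and the spectral inequality\<close>

lemma diff_rep_le_card: "finite A \<Longrightarrow> diff_rep A x \<le> card A"
  unfolding diff_rep_def by (rule card_inj_on_le[of fst]) (auto simp: inj_on_def)

lemma diff_rep_uminus: "diff_rep A (- x) = diff_rep A x"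
  unfolding diff_rep_def
  by (rule bij_betw_same_card[of "\<lambda>p. (snd p, fst p)"], rule bij_betw_byWitness[of _ "\<lambda>p. (snd p, fst p)"]) auto

lemma diff_rep_pos_iff: "finite A \<Longrightarrow> diff_rep A x > 0 \<longleftrightarrow> x \<in> diffset A"
  unfolding diff_rep_def card_gt_0_iff diffset_def by fastforce

lemma sum_popular_diff_rep_le:
  assumes "finite A" "finite T" and pop: "\<And>t. t \<in> T \<Longrightarrow> \<tau> \<le> real (diff_rep A (h t))"
  shows "\<tau> * real (card T) \<le> real (card (SIGMA t:T. {p \<in> A \<times> A. fst p - snd p = h t}))"
proof -
  have "\<tau> * real (card T) \<le> (\<Sum>t\<in>T. real (diff_rep A (h t)))"
    using sum_mono[of T "\<lambda>_. \<tau>" "\<lambda>t. real (diff_rep A (h t))"] pop by (simp add: mult.commute)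
  also have "\<dots> = real (card (SIGMA t:T. {p \<in> A \<times> A. fst p - snd p = h t}))"
    using assms by (simp add: card_SigmaI diff_rep_def)
  finally show ?thesis .
qed

text \<open>The additive energy with its equation rearranged into differences; the representation
  numbers become invariant under negation, and so do their level sets.\<close>

definition diff_energy :: "real set \<Rightarrow> nat" where
  "diff_energy A = coll (\<lambda>p. fst p - snd p) (A \<times> A)"

lemma diff_energy_eq_sum:
  assumes "finite A" shows "real (diff_energy A) = (\<Sum>x\<in>diffset A. (real (diff_rep A x))\<^sup>2)"
proof -
  have "diff_energy A = (\<Sum>x\<in>diffset A. (diff_rep A x)\<^sup>2)"
    unfolding diff_energy_def diff_rep_def
  proof (rule coll_eq_sum)
    show "(\<lambda>p. fst p - snd p) ` (A \<times> A) \<subseteq> diffset A" by (fastforce simp: diffset_def)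
  qed (use card_diffset_le[OF assms] assms in auto)
  then show ?thesis by simp
qed

text \<open>One dyadic level carries the energy up to the number of levels. Its invariance under
  negation makes the graph on \<open>A\<close> of popular differences undirected, as the Perron
  vector requires.\<close>

lemma popular_level_set:
  assumes A: "finite A"
  obtains P k where "P \<subseteq> diffset A" "finite P" "\<And>x. x \<in> P \<longleftrightarrow> - x \<in> P"
    "\<And>x. x \<in> P \<Longrightarrow> 2 ^ k \<le> diff_rep A x"
    "real (diff_energy A) \<le> real (dyadic_levels (card A)) * (4 * (2 ^ k)\<^sup>2 * real (card P))"
proof -
  have "\<exists>k. (\<Sum>x\<in>diffset A. (real (diff_rep A x))\<^sup>2) \<le> real (dyadic_levels (card A)) *
     (\<Sum>x | x \<in> diffset A \<and> 2 ^ k \<le> diff_rep A x \<and> diff_rep A x < 2 ^ Suc k. (real (diff_rep A x))\<^sup>2)"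
    by (rule dyadic_pigeonhole) (use A card_diffset_le diff_rep_le_card diff_rep_pos_iff in \<open>auto simp: Suc_le_eq\<close>)
  then obtain k where k: "real (diff_energy A) \<le> real (dyadic_levels (card A)) *
     (\<Sum>x | x \<in> diffset A \<and> 2 ^ k \<le> diff_rep A x \<and> diff_rep A x < 2 ^ Suc k. (real (diff_rep A x))\<^sup>2)"
    using diff_energy_eq_sum[OF A] by auto
  define P where "P = {x. x \<in> diffset A \<and> 2 ^ k \<le> diff_rep A x \<and> diff_rep A x < 2 ^ Suc k}"
  have fP: "finite P" using card_diffset_le[OF A] by (simp add: P_def)
  have "(\<Sum>x\<in>P. (real (diff_rep A x))\<^sup>2) \<le> (\<Sum>x\<in>P. (2 * 2 ^ k)\<^sup>2)"
  proof (intro sum_mono power_mono)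
    fix x assume "x \<in> P"
    then have "diff_rep A x \<le> 2 * 2 ^ k" by (simp add: P_def)
    then have "real (diff_rep A x) \<le> real (2 * 2 ^ k)" by (simp only: of_nat_le_iff)
    then show "real (diff_rep A x) \<le> 2 * 2 ^ k" by simp
  qed simp
  also have "\<dots> = 4 * (2 ^ k)\<^sup>2 * real (card P)" by (simp add: power_mult_distrib)
  finally have "real (diff_energy A) \<le> real (dyadic_levels (card A)) * (4 * (2 ^ k)\<^sup>2 * real (card P))"
    using k unfolding P_def by (meson mult_left_mono of_nat_0_le_iff order_trans)
  moreover have "x \<in> P \<longleftrightarrow> - x \<in> P" for x
    using diff_rep_pos_iff[OF A, of x] diff_rep_pos_iff[OF A, of "- x"] by (simp add: P_def diff_rep_uminus)
  moreover have "P \<subseteq> diffset A" "\<And>x. x \<in> P \<Longrightarrow> 2 ^ k \<le> diff_rep A x" by (auto simp: P_def)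
  ultimately show ?thesis using fP by (intro that[of P k])
qed

text \<open>Count paths \<open>a\<close>, \<open>b\<close>, \<open>c\<close> in the graph of popular
  differences, weighted by the representation number of \<open>a - c\<close>. The Perron vector
  bounds this from below. From above, group the paths by their two steps and apply Cauchy-Schwarz:
  the squared numbers of paths with given steps sum to at most the third energy, and the squared
  weights are concentrated by pigeonholing on one level \<open>W\<close> of sums of two
  steps.\<close>

lemma spectral_step:
  assumes A: "finite A" "A \<noteq> {}"
  obtains P W and D t :: real where "P \<subseteq> diffset A" "finite P" "\<And>x. x \<in> P \<longleftrightarrow> - x \<in> P" "finite W"
    "D \<ge> 1" "t \<ge> 1" "\<And>x. x \<in> P \<Longrightarrow> D \<le> real (diff_rep A x)" "\<And>x. x \<in> W \<Longrightarrow> t \<le> real (diff_rep A x)"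
    "real (diff_energy A) \<le> real (dyadic_levels (card A)) * (4 * D\<^sup>2 * real (card P))"
    "(D ^ 4 * real (card P) ^ 3 / real (card A) ^ 3)\<^sup>2
      \<le> real (triple_energy A) * (real (dyadic_levels (card A)) * (4 * t\<^sup>2 * real (card {p \<in> P \<times> P. fst p + snd p \<in> W})))"
proof -
  obtain P k where P: "P \<subseteq> diffset A" "finite P" "\<And>x. x \<in> P \<longleftrightarrow> - x \<in> P"
    "\<And>x. x \<in> P \<Longrightarrow> 2 ^ k \<le> diff_rep A x"
    "real (diff_energy A) \<le> real (dyadic_levels (card A)) * (4 * (2 ^ k)\<^sup>2 * real (card P))"
    by (rule popular_level_set[OF A(1)], rule that)
  define D :: real where "D = 2 ^ k"
  have D: "D \<le> real (diff_rep A x)" if "x \<in> P" for x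
    using P(4)[OF that] unfolding D_def by (metis of_nat_le_iff of_nat_numeral of_nat_power)
  have D1: "D \<ge> 1" by (simp add: D_def)
  define m where "m = real (card {p \<in> A \<times> A. fst p - snd p \<in> P})"
  have m: "real (card P) * D \<le> m"
  proof -
    have "D * real (card P) \<le> real (card (SIGMA t:P. {p \<in> A \<times> A. fst p - snd p = t}))"
      by (rule sum_popular_diff_rep_le[OF A(1) P(2) D])
    also have "\<dots> \<le> m" unfolding m_def of_nat_le_iff
      by (rule card_inj_on_le[of snd]) (use A in \<open>auto simp: inj_on_def\<close>)
    finally show ?thesis by (simp add: mult.commute)
  qed
  define F where "F = (\<lambda>(a, b, c). (a - b :: real, b - c :: real))"
  define TT where "TT = {p \<in> A \<times> A \<times> A. F p \<in> P \<times> P}"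
  have fTT: "finite TT" using A by (simp add: TT_def)
  define S where "S = (\<Sum>a\<in>A. \<Sum>b\<in>A. \<Sum>c\<in>A. of_bool (a - b \<in> P) * of_bool (b - c \<in> P) * real (diff_rep A (a - c)))"
  define g where "g = (\<lambda>p. real (diff_rep A (fst p + snd p)))"
  have "S = (\<Sum>p\<in>A \<times> A \<times> A. if F p \<in> P \<times> P then g (F p) else 0)"
    unfolding S_def g_def sum.cartesian_product F_def
    by (intro sum.cong refl) (auto simp: case_prod_beta)
  also have "\<dots> = (\<Sum>p\<in>TT. g (F p))"
    unfolding TT_def using A by (subst sum.inter_filter) auto
  also have "\<dots> = (\<Sum>y\<in>P \<times> P. \<Sum>p | p \<in> TT \<and> F p = y. g (F p))"
    by (rule sum.group[symmetric]) (use fTT P in \<open>auto simp: TT_def\<close>)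
  also have "\<dots> = (\<Sum>y\<in>P \<times> P. real (card {p \<in> TT. F p = y}) * g y)"
    by (intro sum.cong refl) simp
  finally have S: "S = (\<Sum>y\<in>P \<times> P. real (card {p \<in> TT. F p = y}) * g y)" .
  have "S\<^sup>2 \<le> (\<Sum>y\<in>P \<times> P. (real (card {p \<in> TT. F p = y}))\<^sup>2) * (\<Sum>y\<in>P \<times> P. (g y)\<^sup>2)"
    unfolding S by (rule Cauchy_Schwarz_ineq_sum)
  also have "(\<Sum>y\<in>P \<times> P. (real (card {p \<in> TT. F p = y}))\<^sup>2) = real (coll F TT)"
    by (subst coll_eq_sum[OF fTT, of "P \<times> P" F]) (use P(2) in \<open>auto simp: TT_def\<close>)
  also have "coll F TT \<le> triple_energy A"
    unfolding coll_def triple_energy_def F_def[symmetric]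
    by (rule card_mono) (use A in \<open>auto simp: TT_def intro: finite_subset[of _ "(A \<times> A \<times> A) \<times> (A \<times> A \<times> A)"]\<close>)
  finally have S2: "S\<^sup>2 \<le> real (triple_energy A) * (\<Sum>y\<in>P \<times> P. (g y)\<^sup>2)"
    by (simp add: mult_right_mono sum_nonneg)
  \<comment> \<open>Pairs whose sum has no representation contribute 0 and lie in no dyadic level,
    since the levels start at 1.\<close>
  define X where "X = {p \<in> P \<times> P. 1 \<le> diff_rep A (fst p + snd p)}"
  have "\<exists>j. (\<Sum>y\<in>X. (g y)\<^sup>2) \<le> real (dyadic_levels (card A)) *
      (\<Sum>y | y \<in> X \<and> 2 ^ j \<le> diff_rep A (fst y + snd y) \<and> diff_rep A (fst y + snd y) < 2 ^ Suc j. (g y)\<^sup>2)"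
    by (rule dyadic_pigeonhole) (use P A diff_rep_le_card in \<open>auto simp: X_def\<close>)
  then obtain j where j: "(\<Sum>y\<in>X. (g y)\<^sup>2) \<le> real (dyadic_levels (card A)) *
      (\<Sum>y | y \<in> X \<and> 2 ^ j \<le> diff_rep A (fst y + snd y) \<and> diff_rep A (fst y + snd y) < 2 ^ Suc j. (g y)\<^sup>2)" by blast
  define W where "W = {x \<in> diffset A. 2 ^ j \<le> diff_rep A x \<and> diff_rep A x < 2 ^ Suc j}"
  define t :: real where "t = 2 ^ j"
  have fW: "finite W" using card_diffset_le[OF A(1)] by (simp add: W_def)
  have W: "t \<le> real (diff_rep A x)" "real (diff_rep A x) \<le> 2 * t" if "x \<in> W" for x
  proof -
    have "2 ^ j \<le> diff_rep A x" "diff_rep A x \<le> 2 * 2 ^ j" using that by (auto simp: W_def)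
    then have "real (2 ^ j) \<le> real (diff_rep A x)" "real (diff_rep A x) \<le> real (2 * 2 ^ j)" by (simp_all only: of_nat_le_iff)
    then show "t \<le> real (diff_rep A x)" "real (diff_rep A x) \<le> 2 * t" by (auto simp: t_def)
  qed
  have XW: "{y. y \<in> X \<and> 2 ^ j \<le> diff_rep A (fst y + snd y) \<and> diff_rep A (fst y + snd y) < 2 ^ Suc j}
     = {p \<in> P \<times> P. fst p + snd p \<in> W}"
    using diff_rep_pos_iff[OF A(1)] by (auto simp: X_def W_def Suc_le_eq)
  have "(\<Sum>y\<in>P \<times> P. (g y)\<^sup>2) = (\<Sum>y\<in>X. (g y)\<^sup>2)"
    by (rule sum.mono_neutral_right) (use P in \<open>auto simp: X_def g_def\<close>)
  also have "\<dots> \<le> real (dyadic_levels (card A)) * (\<Sum>y | y \<in> P \<times> P \<and> fst y + snd y \<in> W. (g y)\<^sup>2)"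
    using j XW by simp
  also have "\<dots> \<le> real (dyadic_levels (card A)) * (\<Sum>y | y \<in> P \<times> P \<and> fst y + snd y \<in> W. (2 * t)\<^sup>2)"
    by (intro mult_left_mono sum_mono power_mono) (auto simp: g_def W(2))
  also have "\<dots> = real (dyadic_levels (card A)) * (4 * t\<^sup>2 * real (card {p \<in> P \<times> P. fst p + snd p \<in> W}))"
    by (simp add: power_mult_distrib)
  finally have Y: "(\<Sum>y\<in>P \<times> P. (g y)\<^sup>2) \<le> real (dyadic_levels (card A)) * (4 * t\<^sup>2 * real (card {p \<in> P \<times> P. fst p + snd p \<in> W}))" .
  have cA: "real (card A) > 0" using A by (simp add: card_gt_0_iff)
  \<comment> \<open>The average degree of the graph is \<open>m / card A\<close>, which is at least
    \<open>card P * D / card A\<close>.\<close>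
  have "D ^ 4 * real (card P) ^ 3 / real (card A) ^ 3 = D * (real (card P) * D / real (card A)) ^ 3"
    by (simp add: power_divide power_mult_distrib eval_nat_numeral)
  also have "\<dots> \<le> D * (m / real (card A)) ^ 3"
    using D1 m cA by (intro mult_left_mono power_mono divide_right_mono) auto
  also have "\<dots> \<le> S"
    unfolding m_def S_def using sum_popular_paths_ge[OF A P(3) _ D] D1 by simp
  finally have "D ^ 4 * real (card P) ^ 3 / real (card A) ^ 3 \<le> S" .
  then have "(D ^ 4 * real (card P) ^ 3 / real (card A) ^ 3)\<^sup>2 \<le> S\<^sup>2"
    using D1 by (intro power_mono) auto
  also note S2
  also have "real (triple_energy A) * (\<Sum>y\<in>P \<times> P. (g y)\<^sup>2) \<le> real (triple_energy A) *
      (real (dyadic_levels (card A)) * (4 * t\<^sup>2 * real (card {p \<in> P \<times> P. fst p + snd p \<in> W})))"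
    by (intro mult_left_mono Y) simp
  finally show ?thesis
    using P(1-3) P(5)[folded D_def] D D1 fW W(1) by (intro that[of P W D t]) (auto simp: t_def)
qed

section \<open>From zero sums and popular pairs to energies\<close>

lemma real_square_le_mult: "x\<^sup>2 \<le> y * z \<Longrightarrow> (real x)\<^sup>2 \<le> real y * real z"
  unfolding of_nat_power[symmetric] of_nat_mult[symmetric] of_nat_le_iff .

text \<open>Rewriting \<open>a + b = a' + b'\<close> as \<open>a - a' = b' - b\<close> separates the
  two sets before Cauchy-Schwarz is applied.\<close>

lemma coll_sum_square_le:
  assumes "finite A" "finite B"
  shows "(coll (\<lambda>p. fst p + snd p) (A \<times> B))\<^sup>2 \<le> diff_energy A * diff_energy B"
proof -
  have "coll (\<lambda>p. fst p + snd p) (A \<times> B)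
     = card {(p, q). p \<in> A \<times> A \<and> q \<in> B \<times> B \<and> fst p - snd p = fst q - snd q}"
    unfolding coll_def
    by (rule bij_betw_same_card[of "\<lambda>(p, q). ((fst p, fst q), (snd q, snd p))"],
        rule bij_betw_byWitness[of _ "\<lambda>(p, q). ((fst p, snd q), (snd p, fst q))"]) auto
  then show ?thesis
    unfolding diff_energy_def using assms by (simp add: card_matches_square_le)
qed

definition zero_sums_4 :: "real set \<Rightarrow> real set \<Rightarrow> real set \<Rightarrow> real set \<Rightarrow> (real \<times> real \<times> real \<times> real) set" where
  "zero_sums_4 A B C D = {(a, b, c, d). a \<in> A \<and> b \<in> B \<and> c \<in> C \<and> d \<in> D \<and> a + b + c + d = 0}"

text \<open>Cauchy-Schwarz twice: first the pair \<open>A\<close>, \<open>B\<close> against the pair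
  \<open>C\<close>, \<open>D\<close>, then within each pair. Mixed counts are thus reduced to the
  energies of single sets.\<close>

lemma card_zero_sums_4_le:
  assumes fin: "finite A" "finite B" "finite C" "finite D"
    and E: "real (diff_energy A) \<le> E" "real (diff_energy B) \<le> E" "real (diff_energy C) \<le> E" "real (diff_energy D) \<le> E"
  shows "real (card (zero_sums_4 A B C D)) \<le> E"
proof -
  have E0: "E \<ge> 0" using E(1) by linarith
  have c: "real (coll (\<lambda>p. fst p + snd p) (X \<times> Y)) \<le> E"
    if "finite X" "finite Y" "real (diff_energy X) \<le> E" "real (diff_energy Y) \<le> E" for X Y
  proof -
    have "(real (coll (\<lambda>p. fst p + snd p) (X \<times> Y)))\<^sup>2 \<le> real (diff_energy X) * real (diff_energy Y)"
      by (rule real_square_le_mult[OF coll_sum_square_le[OF that(1,2)]])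
    also have "\<dots> \<le> E\<^sup>2" unfolding power2_eq_square by (intro mult_mono that E0) auto
    finally show ?thesis using E0 by (rule power2_le_imp_le)
  qed
  have "card (zero_sums_4 A B C D)
     = card {(p, q). p \<in> A \<times> B \<and> q \<in> C \<times> D \<and> fst p + snd p = - (fst q + snd q)}"
    unfolding zero_sums_4_def
    by (rule bij_betw_same_card[of "\<lambda>(a, b, c, d). ((a, b), (c, d))"],
        rule bij_betw_byWitness[of _ "\<lambda>((a, b), (c, d)). (a, b, c, d)"]) auto
  then have "(card (zero_sums_4 A B C D))\<^sup>2
     \<le> coll (\<lambda>p. fst p + snd p) (A \<times> B) * coll (\<lambda>q. - (fst q + snd q)) (C \<times> D)"
    using fin by (simp add: card_matches_square_le)
  also have "coll (\<lambda>q. - (fst q + snd q)) (C \<times> D) = coll (\<lambda>q. fst q + snd q) (C \<times> D)"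
    unfolding coll_def by (rule arg_cong[where f=card]) auto
  finally have "(real (card (zero_sums_4 A B C D)))\<^sup>2
     \<le> real (coll (\<lambda>p. fst p + snd p) (A \<times> B)) * real (coll (\<lambda>q. fst q + snd q) (C \<times> D))"
    by (rule real_square_le_mult)
  also have "\<dots> \<le> E\<^sup>2" unfolding power2_eq_square by (intro mult_mono c fin E E0) auto
  finally show ?thesis using E0 by (rule power2_le_imp_le)
qed

lemma matches_square_le_sum_energy:
  assumes "finite A" "finite B" "finite C"
  shows "(card {(p, q). p \<in> A \<times> B \<and> q \<in> A \<times> C \<and> fst p + snd p = fst q + snd q})\<^sup>2 \<le> sum_energy A B * sum_energy A C"
  unfolding sum_energy_def using assms by (intro card_matches_square_le) auto

text \<open>Exploits the popularity of the sum: \<open>p + q = c - d\<close> becomes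
  \<open>d + p = c + (- q)\<close>, and \<open>- q \<in> P\<close> by symmetry.\<close>

lemma popular_pairs_le_sum_energy:
  assumes A: "finite A" and P: "finite P" "\<And>x. x \<in> P \<longleftrightarrow> - x \<in> P" and W: "finite W"
    and t: "\<And>x. x \<in> W \<Longrightarrow> t \<le> real (diff_rep A x)"
  shows "t * real (card {p \<in> P \<times> P. fst p + snd p \<in> W}) \<le> real (sum_energy A P)"
proof -
  let ?T = "{p \<in> P \<times> P. fst p + snd p \<in> W}"
  let ?S = "SIGMA p:?T. {q \<in> A \<times> A. fst q - snd q = fst p + snd p}"
  have fS: "finite ?T" using P by simp
  have "t * real (card ?T) \<le> real (card ?S)"
    by (rule sum_popular_diff_rep_le[OF A fS]) (use t in auto)
  also have "card ?S \<le> sum_energy A P"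
    unfolding sum_energy_def coll_def
  proof (rule card_inj_on_le[of "\<lambda>(p, q). ((snd q, fst p), (fst q, - snd p))"])
    show "(\<lambda>(p, q). ((snd q, fst p), (fst q, - snd p))) ` ?S
      \<subseteq> {(p, q). p \<in> A \<times> P \<and> q \<in> A \<times> P \<and> fst p + snd p = fst q + snd q}"
    proof (rule image_subsetI)
      fix y assume y: "y \<in> ?S"
      obtain a b c d where yy: "y = ((a, b), (c, d))" by (metis surj_pair)
      have m: "a \<in> P" "b \<in> P" "c \<in> A" "d \<in> A" "c - d = a + b" using y unfolding yy by auto
      have "- b \<in> P" using m(2) P(2)[of b] by blast
      then show "(\<lambda>(p, q). ((snd q, fst p), (fst q, - snd p))) y
         \<in> {(p, q). p \<in> A \<times> P \<and> q \<in> A \<times> P \<and> fst p + snd p = fst q + snd q}"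
        using m unfolding yy by auto
    qed
    show "finite {(p, q). p \<in> A \<times> P \<and> q \<in> A \<times> P \<and> fst p + snd p = fst q + snd q}"
      by (rule finite_subset[of _ "(A \<times> P) \<times> (A \<times> P)"]) (use A P(1) in auto)
  qed (auto simp: inj_on_def)
  finally show ?thesis by simp
qed

text \<open>Exploits the popularity of a summand instead: if \<open>q = c - d\<close> and
  \<open>w = p + q\<close>, then \<open>c + p = d + w\<close>, an equation between
  \<open>A + P\<close> and \<open>A + W\<close>.\<close>

lemma popular_pairs_square_le_sum_energy:
  assumes A: "finite A" and P: "finite P" and W: "finite W"
    and D: "\<And>x. x \<in> P \<Longrightarrow> D \<le> real (diff_rep A x)" "D \<ge> 0"
  shows "(D * real (card {p \<in> P \<times> P. fst p + snd p \<in> W}))\<^sup>2 \<le> real (sum_energy A P) * real (sum_energy A W)"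
proof -
  let ?T = "{p \<in> P \<times> P. fst p + snd p \<in> W}"
  let ?S = "SIGMA p:?T. {q \<in> A \<times> A. fst q - snd q = snd p}"
  let ?M = "{(p, q). p \<in> A \<times> P \<and> q \<in> A \<times> W \<and> fst p + snd p = fst q + snd q}"
  have fS: "finite ?T" using P by simp
  have "D * real (card ?T) \<le> real (card ?S)"
    by (rule sum_popular_diff_rep_le[OF A fS]) (use D in auto)
  also have "card ?S \<le> card ?M"
  proof (rule card_inj_on_le[of "\<lambda>(p, q). ((fst q, fst p), (snd q, fst p + snd p))"])
    show "finite ?M"
      by (rule finite_subset[of _ "(A \<times> P) \<times> (A \<times> W)"]) (use A P W in auto)
    show "(\<lambda>(p, q). ((fst q, fst p), (snd q, fst p + snd p))) ` ?S \<subseteq> ?M"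
    proof (rule image_subsetI)
      fix y assume y: "y \<in> ?S"
      obtain a b c d where yy: "y = ((a, b), (c, d))" by (metis surj_pair)
      show "(\<lambda>(p, q). ((fst q, fst p), (snd q, fst p + snd p))) y \<in> ?M" using y unfolding yy by auto
    qed
  qed (simp add: inj_on_def)
  finally have "(D * real (card ?T))\<^sup>2 \<le> (real (card ?M))\<^sup>2" using D by (intro power_mono) auto
  also have "\<dots> \<le> real (sum_energy A P) * real (sum_energy A W)"
    by (rule real_square_le_mult[OF matches_square_le_sum_energy[OF A P W]])
  finally show ?thesis .
qed

text \<open>
  Powers of \<open>log N\<close> are recorded as multiples of \<open>loglog N\<close> once logarithms are taken.
\<close>

definition loglog :: "nat \<Rightarrow> real" where "loglog N = ln (1 + 2 * ln (real N))"

lemma loglog_nonneg: "N \<ge> 1 \<Longrightarrow> loglog N \<ge> 0"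
  by (simp add: loglog_def)

lemma loglog_mono: "1 \<le> M \<Longrightarrow> M \<le> N \<Longrightarrow> loglog M \<le> loglog N"
  by (simp add: loglog_def add_pos_nonneg)

lemma ln_dyadic_levels_le:
  assumes "N \<ge> 1" shows "0 \<le> ln (real (dyadic_levels N))" "ln (real (dyadic_levels N)) \<le> loglog N"
  using dyadic_levels_le[OF assms] by (auto simp: loglog_def)

text \<open>Only exponents of \<open>N\<close> matter, so a numerical constant \<open>c\<close>
  enters a logarithmic inequality through the crude \<open>ln c \<le> c\<close>, which leaves
  rational arithmetic.\<close>

lemma ln_le_self: "x > 0 \<Longrightarrow> ln x \<le> (x :: real)"
  using ln_le_minus_one[of x] by linarith

section \<open>The estimates in logarithmic form\<close>

lemma ln_sum_energy_le:
  assumes A: "cvx A" "A \<noteq> {}" and B: "finite B" "B \<noteq> {}" and X: "0 < X" "X \<le> real (sum_energy A B)"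
  shows "ln X \<le> 51 + ln (real (card A)) + 3 / 2 * ln (real (card B))"
proof -
  have c: "real (card A) > 0" "real (card B) > 0"
    using A B cvx_finite by (auto simp: card_gt_0_iff)
  have "X \<le> 51 * real (card A) * real (card B) * sqrt (real (card B))"
    using X sum_energy_le[OF A(1) B(1)] by linarith
  then have "ln X \<le> ln (51 * real (card A) * real (card B) * sqrt (real (card B)))"
    using X c by (subst ln_le_cancel_iff) auto
  also have "\<dots> = ln 51 + ln (real (card A)) + 3 / 2 * ln (real (card B))"
    using c by (simp add: ln_mult ln_sqrt)
  finally show ?thesis using ln_le_self[of 51] by linarith
qed

lemma ln_popular_diffs_le:
  assumes A: "cvx A" "A \<noteq> {}" and W: "finite W" "W \<noteq> {}" and t: "t > 0" "\<And>w. w \<in> W \<Longrightarrow> t \<le> real (diff_rep A w)"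
  shows "ln (real (card W)) + 3 * ln t \<le> 576 + 3 * ln (real (card A))"
proof -
  have c: "real (card A) > 0" "real (card W) > 0"
    using A W cvx_finite by (auto simp: card_gt_0_iff)
  have "ln (real (card W) * t ^ 3) \<le> ln (576 * real (card A) ^ 3)"
    using card_popular_diffs_le[OF A(1) W(1) _ t(2)] t c by (subst ln_le_cancel_iff) auto
  then have "ln (real (card W)) + 3 * ln t \<le> ln 576 + 3 * ln (real (card A))"
    using c t by (simp add: ln_mult ln_realpow)
  then show ?thesis using ln_le_self[of 576] by linarith
qed

lemma ln_triple_energy_le:
  assumes A: "cvx A" "A \<noteq> {}"
  shows "0 < triple_energy A" "ln (real (triple_energy A)) \<le> 576 + 3 * ln (real (card A)) + loglog (card A)"
proof -
  have fA: "finite A" using A cvx_finite by blast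
  show p: "0 < triple_energy A" unfolding triple_energy_def by (rule coll_pos) (use fA A in auto)
  have c: "card A \<ge> 1" using fA A by (simp add: Suc_le_eq card_gt_0_iff)
  then have c': "1 + 2 * ln (real (card A)) > 0" by (simp add: add_pos_nonneg)
  have "ln (real (triple_energy A)) \<le> ln (576 * real (card A) ^ 3 * (1 + 2 * ln (real (card A))))"
    using triple_energy_le[OF A(1)] p c c' by (subst ln_le_cancel_iff) auto
  also have "\<dots> = ln 576 + 3 * ln (real (card A)) + loglog (card A)"
    using c c' by (simp add: ln_mult ln_realpow loglog_def)
  finally show "ln (real (triple_energy A)) \<le> 576 + 3 * ln (real (card A)) + loglog (card A)"
    using ln_le_self[of 576] by linarith
qed

lemma spectral_step_ln:
  assumes A: "cvx A" "A \<noteq> {}"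
  obtains P W D t and T where "P \<subseteq> diffset A" "finite P" "P \<noteq> {}" "\<And>x. x \<in> P \<longleftrightarrow> - x \<in> P" "finite W" "W \<noteq> {}"
    "D \<ge> 1" "t \<ge> 1" "\<And>x. x \<in> P \<Longrightarrow> D \<le> real (diff_rep A x)" "\<And>x. x \<in> W \<Longrightarrow> t \<le> real (diff_rep A x)"
    "T = {p \<in> P \<times> P. fst p + snd p \<in> W}" "card T > 0"
    "ln (real (diff_energy A)) \<le> 4 + loglog (card A) + 2 * ln D + ln (real (card P))"
    "8 * ln D + 6 * ln (real (card P))
      \<le> 580 + 9 * ln (real (card A)) + 2 * loglog (card A) + 2 * ln t + ln (real (card T))"
proof -
  have fA: "finite A" using A cvx_finite by blast
  have c: "card A \<ge> 1" using fA A by (simp add: Suc_le_eq card_gt_0_iff)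
  obtain P W and D t :: real where P: "P \<subseteq> diffset A" "finite P" "\<And>x. x \<in> P \<longleftrightarrow> - x \<in> P" and W: "finite W"
    and D: "D \<ge> 1" and t: "t \<ge> 1" and DP: "\<And>x. x \<in> P \<Longrightarrow> D \<le> real (diff_rep A x)" and tW: "\<And>x. x \<in> W \<Longrightarrow> t \<le> real (diff_rep A x)"
    and E: "real (diff_energy A) \<le> real (dyadic_levels (card A)) * (4 * D\<^sup>2 * real (card P))"
    and S: "(D ^ 4 * real (card P) ^ 3 / real (card A) ^ 3)\<^sup>2
      \<le> real (triple_energy A) * (real (dyadic_levels (card A)) * (4 * t\<^sup>2 * real (card {p \<in> P \<times> P. fst p + snd p \<in> W})))"
    by (rule spectral_step[OF fA A(2)], rule that)
  define T where "T = {p \<in> P \<times> P. fst p + snd p \<in> W}"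
  have nlp: "real (dyadic_levels (card A)) > 0" using dyadic_levels_le(1)[OF c] by linarith
  have dep: "real (diff_energy A) > 0" using coll_pos[of "A \<times> A"] fA A by (simp add: diff_energy_def)
  have Pp: "real (card P) > 0" using dep E by (cases "card P = 0") auto
  have lhs: "0 < (D ^ 4 * real (card P) ^ 3 / real (card A) ^ 3)\<^sup>2" using D Pp c by simp
  have Tp: "card T > 0" using lhs S by (cases "card T = 0") (auto simp: T_def)
  have Wn: "W \<noteq> {}" using Tp by (auto simp: T_def)
  have "ln (real (diff_energy A)) \<le> ln (real (dyadic_levels (card A)) * (4 * D\<^sup>2 * real (card P)))"
    using E dep Pp D nlp by (subst ln_le_cancel_iff) auto
  also have "\<dots> = ln (real (dyadic_levels (card A))) + (ln 4 + 2 * ln D + ln (real (card P)))"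
    using Pp D nlp by (simp add: ln_mult ln_realpow)
  finally have e: "ln (real (diff_energy A)) \<le> 4 + loglog (card A) + 2 * ln D + ln (real (card P))"
    using ln_le_self[of 4] ln_dyadic_levels_le[OF c] by linarith
  have "ln ((D ^ 4 * real (card P) ^ 3 / real (card A) ^ 3)\<^sup>2)
     \<le> ln (real (triple_energy A) * (real (dyadic_levels (card A)) * (4 * t\<^sup>2 * real (card T))))"
    using S lhs Tp t nlp ln_triple_energy_le(1)[OF A] unfolding T_def[symmetric] by (subst ln_le_cancel_iff) auto
  also have "\<dots> = ln (real (triple_energy A)) + (ln (real (dyadic_levels (card A))) + (ln 4 + 2 * ln t + ln (real (card T))))"
    using Tp t nlp ln_triple_energy_le(1)[OF A] by (simp add: ln_mult ln_realpow)
  also have "ln ((D ^ 4 * real (card P) ^ 3 / real (card A) ^ 3)\<^sup>2)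
     = 8 * ln D + 6 * ln (real (card P)) - 6 * ln (real (card A))"
    using Pp D c by (simp add: ln_mult ln_realpow ln_div)
  finally have s: "8 * ln D + 6 * ln (real (card P))
      \<le> 580 + 9 * ln (real (card A)) + 2 * loglog (card A) + 2 * ln t + ln (real (card T))"
    using ln_le_self[of 4, simplified] ln_dyadic_levels_le[OF c] ln_triple_energy_le(2)[OF A] by linarith
  have "P \<noteq> {}" using Pp by auto
  then show ?thesis using that[OF P(1,2) _ P(3) W Wn D t DP tW T_def Tp e s] by blast
qed

lemma cvx_ln_diff_energy_le:
  assumes A: "cvx A" "A \<noteq> {}"
  shows "ln (real (diff_energy A)) \<le> 5000 + 10 * loglog (card A) + 32 / 13 * ln (real (card A))"
proof -
  have fA: "finite A" using A cvx_finite by blast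
  have c: "card A \<ge> 1" using fA A by (simp add: Suc_le_eq card_gt_0_iff)
  obtain P W D t T where P: "P \<subseteq> diffset A" "finite P" "P \<noteq> {}" "\<And>x. x \<in> P \<longleftrightarrow> - x \<in> P"
    and W: "finite W" "W \<noteq> {}"
    and D: "D \<ge> 1" and t: "t \<ge> 1" and DP: "\<And>x. x \<in> P \<Longrightarrow> D \<le> real (diff_rep A x)" and tW: "\<And>x. x \<in> W \<Longrightarrow> t \<le> real (diff_rep A x)"
    and T: "T = {p \<in> P \<times> P. fst p + snd p \<in> W}" "card T > 0"
    and e: "ln (real (diff_energy A)) \<le> 4 + loglog (card A) + 2 * ln D + ln (real (card P))"
    and s: "8 * ln D + 6 * ln (real (card P))
      \<le> 580 + 9 * ln (real (card A)) + 2 * loglog (card A) + 2 * ln t + ln (real (card T))"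
    by (rule spectral_step_ln[OF A], rule that)
  have "ln (t * real (card T)) \<le> 51 + ln (real (card A)) + 3 / 2 * ln (real (card P))"
    using t T popular_pairs_le_sum_energy[OF fA P(2,4) W(1) tW] by (intro ln_sum_energy_le A P) auto
  then have 1: "ln t + ln (real (card T)) \<le> 51 + ln (real (card A)) + 3 / 2 * ln (real (card P))"
    using t T by (simp add: ln_mult)
  have en2: "(D * real (card T))\<^sup>2 \<le> real (sum_energy A P) * real (sum_energy A W)"
    unfolding T using D by (intro popular_pairs_square_le_sum_energy fA P W DP) auto
  moreover have "0 < (D * real (card T))\<^sup>2" using D T by simp
  ultimately have "0 < real (sum_energy A P) * real (sum_energy A W)" by linarith
  then have pos: "0 < real (sum_energy A P)" "0 < real (sum_energy A W)" by (auto simp: zero_less_mult_iff)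
  have "ln ((D * real (card T))\<^sup>2) \<le> ln (real (sum_energy A P) * real (sum_energy A W))"
    using en2 D T pos by (subst ln_le_cancel_iff) auto
  then have "2 * (ln D + ln (real (card T))) \<le> ln (real (sum_energy A P)) + ln (real (sum_energy A W))"
    using D T pos by (simp add: ln_mult ln_realpow)
  with ln_sum_energy_le[OF A P(2,3) pos(1)] ln_sum_energy_le[OF A W pos(2)]
  have 2: "2 * ln D + 2 * ln (real (card T)) \<le> 102 + 2 * ln (real (card A)) + 3 / 2 * ln (real (card P)) + 3 / 2 * ln (real (card W))"
    by simp
  have 3: "ln (real (card P)) + 3 * ln D \<le> 576 + 3 * ln (real (card A))"
    by (rule ln_popular_diffs_le[OF A P(2,3) _ DP]) (use D in auto)
  have 4: "ln (real (card W)) + 3 * ln t \<le> 576 + 3 * ln (real (card A))"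
    by (rule ln_popular_diffs_le[OF A W _ tW]) (use t in auto)
  \<comment> \<open>Up to constants and \<open>loglog\<close>: 1/5 of \<open>1\<close> plus 4/5 of
    half of \<open>2\<close>, with \<open>card W\<close> removed by \<open>4\<close>, bounds
    \<open>card T\<close> so that \<open>t\<close> cancels in \<open>s\<close>. This gives
    \<open>8.8 * ln D + 5.1 * ln (card P) \<le> 11.8 * ln N\<close>. Adding it with weight 2/13 to
    \<open>3\<close> with weight 2.8/13 gives
    \<open>2 * ln D + ln (card P) \<le> 32/13 * ln N\<close>.\<close>
  from e s 1 2 3 4 loglog_nonneg[OF c] show ?thesis by linarith
qed

subsection \<open>Squeezing for three and four summands\<close>

definition gaps :: "real set \<Rightarrow> int \<Rightarrow> real set" where
  "gaps A h = {a' - a | a a'. a \<in> A \<and> a' \<in> A \<and> int (rk A a') - int (rk A a) = h}"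

text \<open>The trace of 2-convexity that squeezing uses. All distances \<open>h\<close> occur
  because two elements of a common block may have any index distance below its length.\<close>

definition cvx2 :: "real set \<Rightarrow> bool" where
  "cvx2 A \<longleftrightarrow> cvx A \<and> (\<forall>h. h \<noteq> 0 \<longrightarrow> cvx (gaps A h))"

lemma gaps_finite_card:
  assumes "finite A" shows "finite (gaps A h)" "card (gaps A h) \<le> card A"
proof -
  have "gaps A h \<subseteq> (\<lambda>a. (THE a'. a' \<in> A \<and> int (rk A a') - int (rk A a) = h) - a) ` A"
  proof
    fix x assume "x \<in> gaps A h"
    then obtain a a' where a: "x = a' - a" "a \<in> A" "a' \<in> A" "int (rk A a') - int (rk A a) = h"
      by (auto simp: gaps_def)
    have "(THE a'. a' \<in> A \<and> int (rk A a') - int (rk A a) = h) = a'"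
      by (rule the_equality) (use a rk_inj[OF assms] in auto)
    then show "x \<in> (\<lambda>a. (THE a'. a' \<in> A \<and> int (rk A a') - int (rk A a) = h) - a) ` A"
      using a by (intro image_eqI[of _ _ a]) auto
  qed
  then show "finite (gaps A h)" "card (gaps A h) \<le> card A"
    using assms by (auto intro: finite_subset surj_card_le)
qed

lemma gaps_uminus:
  assumes "finite A" shows "gaps (uminus ` A) h = gaps A h"
proof -
  have 1: "gaps A h \<subseteq> gaps (uminus ` A) h" if A: "finite A" for A
  proof
    fix x assume "x \<in> gaps A h"
    then obtain a a' where a: "x = a' - a" "a \<in> A" "a' \<in> A" "int (rk A a') - int (rk A a) = h"
      by (auto simp: gaps_def)
    then have "x = - a - - a'" "- a \<in> uminus ` A" "- a' \<in> uminus ` A"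
      "int (rk (uminus ` A) (- a)) - int (rk (uminus ` A) (- a')) = h"
      by (auto simp: rk_uminus A)
    then show "x \<in> gaps (uminus ` A) h" unfolding gaps_def by blast
  qed
  have "gaps (uminus ` A) h \<subseteq> gaps (uminus ` uminus ` A) h" using assms by (intro 1) auto
  then show ?thesis using 1[OF assms] by (auto simp: image_image)
qed

lemma cvx2_uminus: "cvx2 A \<Longrightarrow> cvx2 (uminus ` A)"
  by (simp add: cvx2_def cvx_uminus gaps_uminus cvx_finite)

definition near_pairs :: "nat \<Rightarrow> real set \<Rightarrow> (real \<times> real) set" where
  "near_pairs H A = {(a, a'). a \<in> A \<and> a' \<in> A \<and> int (rk A a') - int (rk A a) \<in> shifts H}"

lemma finite_near_pairs [simp]: "finite A \<Longrightarrow> finite (near_pairs H A)"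
  by (rule finite_subset[of _ "A \<times> A"]) (auto simp: near_pairs_def)

text \<open>The data that, by \<open>cvx\<close>, determine a pair of distinct elements: index
  offset and difference.\<close>

definition shift_step :: "real set \<Rightarrow> real \<times> real \<Rightarrow> int \<times> real" where
  "shift_step A p = (int (rk A (snd p)) - int (rk A (fst p)), snd p - fst p)"

lemma shift_step_inj:
  assumes "cvx A" "p \<in> near_pairs H A" "q \<in> near_pairs H A" "shift_step A p = shift_step A q"
  shows "p = q"
proof -
  obtain a a' b b' where ab: "p = (a, a')" "q = (b, b')" by (metis surj_pair)
  have "a \<noteq> a'" using assms(2) by (auto simp: ab near_pairs_def shifts_def)
  then show ?thesis
    using cvxD[OF assms(1), of a a' b b'] assms(2-4) by (auto simp: ab near_pairs_def shift_step_def)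
qed

lemma shift_step_mem:
  assumes "p \<in> near_pairs H A"
  shows "fst (shift_step A p) \<in> shifts H" "snd (shift_step A p) \<in> gaps A (fst (shift_step A p))"
proof -
  obtain a a' where p: "p = (a, a')" by (metis surj_pair)
  then have m: "a \<in> A" "a' \<in> A" "int (rk A a') - int (rk A a) \<in> shifts H"
    using assms by (auto simp: near_pairs_def)
  then show "fst (shift_step A p) \<in> shifts H" by (simp add: p shift_step_def)
  show "snd (shift_step A p) \<in> gaps A (fst (shift_step A p))"
    unfolding gaps_def p shift_step_def using m by auto
qed

lemma shifts_nonzero: "h \<in> shifts H \<Longrightarrow> h \<noteq> 0"
  by (simp add: shifts_def)

lemma card_shifts_real: "real (card (shifts H)) \<le> 2 * real H"
  using card_shifts[of H] by (metis of_nat_le_iff of_nat_mult of_nat_numeral)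

section \<open>Relations between differences at short index distance\<close>

definition near2 :: "nat \<Rightarrow> real set \<Rightarrow> real set \<Rightarrow> ((real \<times> real) \<times> (real \<times> real)) set" where
  "near2 H A B = {(p, q). p \<in> near_pairs H A \<and> q \<in> near_pairs H B \<and> fst p + fst q = snd p + snd q}"

lemma finite_near2: "finite A \<Longrightarrow> finite B \<Longrightarrow> finite (near2 H A B)"
  by (rule finite_subset[of _ "near_pairs H A \<times> near_pairs H B"]) (auto simp: near2_def)

text \<open>The first element of \<open>A\<close> and its offset give the second one; the relation
  then gives the difference in \<open>B\<close>, and with the other offset \<open>cvx\<close> gives
  the pair in \<open>B\<close>.\<close>

lemma card_near2_le:
  assumes "cvx A" "cvx B"
  shows "real (card (near2 H A B)) \<le> (2 * real H)\<^sup>2 * real (card A)"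
proof -
  have fin: "finite A" "finite B" using assms cvx_finite by auto
  have "card (near2 H A B) \<le> card (shifts H \<times> shifts H \<times> A)"
  proof (rule card_inj_on_le[of "\<lambda>(p, q). (fst (shift_step A p), fst (shift_step B q), fst p)"])
    show "inj_on (\<lambda>(p, q). (fst (shift_step A p), fst (shift_step B q), fst p)) (near2 H A B)"
    proof (rule inj_onI)
      fix x y assume xy: "x \<in> near2 H A B" "y \<in> near2 H A B"
        and g: "(\<lambda>(p, q). (fst (shift_step A p), fst (shift_step B q), fst p)) x
           = (\<lambda>(p, q). (fst (shift_step A p), fst (shift_step B q), fst p)) y"
      obtain a a' b b' where x: "x = ((a, a'), (b, b'))" by (metis surj_pair)
      obtain c c' d d' where y: "y = ((c, c'), (d, d'))" by (metis surj_pair)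
      note m = xy[unfolded x y]
      have e: "fst (shift_step A (a, a')) = fst (shift_step A (c, c'))" "fst (shift_step B (b, b')) = fst (shift_step B (d, d'))"
          "a = c" using g unfolding x y by auto
      have "a' \<in> A" "c' \<in> A" "rk A a' = rk A c'" using m e by (auto simp: near2_def near_pairs_def shift_step_def)
      then have ac: "a = c" "a' = c'" using rk_inj fin e by auto
      have "b' - b = d' - d" using m ac by (auto simp: near2_def)
      then have "(b, b') = (d, d')"
        using m e by (intro shift_step_inj[OF assms(2), of _ H]) (auto simp: near2_def shift_step_def)
      then show "x = y" using ac by (simp add: x y)
    qed
    show "(\<lambda>(p, q). (fst (shift_step A p), fst (shift_step B q), fst p)) ` near2 H A B \<subseteq> shifts H \<times> shifts H \<times> A"
      by (auto simp: near2_def near_pairs_def shift_step_def)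
  qed (use fin in simp)
  then have "real (card (near2 H A B)) \<le> real (card (shifts H)) * (real (card (shifts H)) * real (card A))"
    unfolding card_cartesian_product of_nat_mult[symmetric] of_nat_le_iff .
  also have "\<dots> \<le> (2 * real H) * ((2 * real H) * real (card A))"
    by (intro mult_mono card_shifts_real order.refl) auto
  finally show "real (card (near2 H A B)) \<le> (2 * real H)\<^sup>2 * real (card A)"
    by (simp add: power2_eq_square mult_ac)
qed

definition zero_sums_3 :: "real set \<Rightarrow> real set \<Rightarrow> real set \<Rightarrow> (real \<times> real \<times> real) set" where
  "zero_sums_3 A B C = {(a, b, c). a \<in> A \<and> b \<in> B \<and> c \<in> C \<and> a + b + c = 0}"

definition near3 :: "nat \<Rightarrow> real set \<Rightarrow> real set \<Rightarrow> real set \<Rightarrow> ((real \<times> real) \<times> (real \<times> real) \<times> (real \<times> real)) set" where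
  "near3 H A B C = {(p, q, r). p \<in> near_pairs H A \<and> q \<in> near_pairs H B \<and> r \<in> near_pairs H C \<and>
      fst p + fst q + fst r = snd p + snd q + snd r}"

lemma finite_near3: "finite A \<Longrightarrow> finite B \<Longrightarrow> finite C \<Longrightarrow> finite (near3 H A B C)"
  by (rule finite_subset[of _ "near_pairs H A \<times> near_pairs H B \<times> near_pairs H C"]) (auto simp: near3_def)

text \<open>There are at most \<open>(2 * H)^3\<close> triples of offsets. For fixed offsets a
  relation is a zero sum in three sets of differences, and by \<open>cvx\<close> no two relations
  share the same zero sum.\<close>

lemma card_near3_le:
  assumes "cvx A" "cvx B" "cvx C"
    and Z: "\<And>h i j. h \<noteq> 0 \<Longrightarrow> i \<noteq> 0 \<Longrightarrow> j \<noteq> 0 \<Longrightarrow> real (card (zero_sums_3 (gaps A h) (gaps B i) (gaps C j))) \<le> b"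
  shows "real (card (near3 H A B C)) \<le> (2 * real H) ^ 3 * b"
proof -
  have fin: "finite A" "finite B" "finite C" using assms cvx_finite by auto
  have b0: "b \<ge> 0" using Z[of 1 1 1] by (auto intro: order_trans[OF of_nat_0_le_iff])
  let ?I = "shifts H \<times> shifts H \<times> shifts H"
  let ?S = "SIGMA k:?I. zero_sums_3 (gaps A (fst k)) (gaps B (fst (snd k))) (gaps C (snd (snd k)))"
  have fz: "finite (zero_sums_3 (gaps A h) (gaps B i) (gaps C j))" for h i j
    by (rule finite_subset[of _ "gaps A h \<times> gaps B i \<times> gaps C j"]) (use fin gaps_finite_card in \<open>auto simp: zero_sums_3_def\<close>)
  let ?g = "\<lambda>(p, q, r). ((fst (shift_step A p), fst (shift_step B q), fst (shift_step C r)),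
      (snd (shift_step A p), snd (shift_step B q), snd (shift_step C r)))"
  have "card (near3 H A B C) \<le> card ?S"
  proof (rule card_inj_on_le[of ?g])
    show "inj_on ?g (near3 H A B C)"
    proof (rule inj_onI)
      fix x y assume m: "x \<in> near3 H A B C" "y \<in> near3 H A B C" and e: "?g x = ?g y"
      obtain p q r p' q' r' where xy: "x = (p, q, r)" "y = (p', q', r')" by (metis surj_pair)
      have "shift_step A p = shift_step A p'" "shift_step B q = shift_step B q'" "shift_step C r = shift_step C r'"
        using e unfolding xy by (simp_all add: prod_eq_iff)
      then show "x = y" using m assms(1-3) unfolding xy near3_def by (auto dest: shift_step_inj)
    qed
    show "?g ` near3 H A B C \<subseteq> ?S"
    proof (rule image_subsetI)
      fix x assume m: "x \<in> near3 H A B C"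
      obtain p q r where x: "x = (p, q, r)" by (metis surj_pair)
      have "p \<in> near_pairs H A" "q \<in> near_pairs H B" "r \<in> near_pairs H C"
        and "snd (shift_step A p) + snd (shift_step B q) + snd (shift_step C r) = 0"
        using m by (auto simp: x near3_def shift_step_def)
      then show "?g x \<in> ?S" by (simp add: x zero_sums_3_def shift_step_mem)
    qed
    show "finite ?S" using fz by (intro finite_SigmaI) auto
  qed
  then have "real (card (near3 H A B C)) \<le> (\<Sum>k\<in>?I. real (card (zero_sums_3 (gaps A (fst k)) (gaps B (fst (snd k))) (gaps C (snd (snd k))))))"
    using fz by (subst (asm) card_SigmaI) (auto simp flip: of_nat_sum)
  also have "\<dots> \<le> (\<Sum>k\<in>?I. b)"
    by (intro sum_mono Z) (auto dest: shifts_nonzero)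
  also have "\<dots> = real (card (shifts H)) * (real (card (shifts H)) * real (card (shifts H))) * b"
    by (simp add: card_cartesian_product)
  also have "\<dots> \<le> (2 * real H) * ((2 * real H) * (2 * real H)) * b"
    by (intro mult_mono card_shifts_real b0 order.refl) auto
  finally show "real (card (near3 H A B C)) \<le> (2 * real H) ^ 3 * b"
    by (simp add: power3_eq_cube mult_ac)
qed

definition near4 :: "nat \<Rightarrow> real set \<Rightarrow> real set \<Rightarrow> real set \<Rightarrow> real set \<Rightarrow>
    ((real \<times> real) \<times> (real \<times> real) \<times> (real \<times> real) \<times> (real \<times> real)) set" where
  "near4 H A B C D = {(p, q, r, s). p \<in> near_pairs H A \<and> q \<in> near_pairs H B \<and> r \<in> near_pairs H C \<and> s \<in> near_pairs H D \<and>
      fst p + fst q + fst r + fst s = snd p + snd q + snd r + snd s}"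

lemma finite_near4: "finite A \<Longrightarrow> finite B \<Longrightarrow> finite C \<Longrightarrow> finite D \<Longrightarrow> finite (near4 H A B C D)"
  by (rule finite_subset[of _ "near_pairs H A \<times> near_pairs H B \<times> near_pairs H C \<times> near_pairs H D"]) (auto simp: near4_def)

lemma card_near4_le:
  assumes "cvx A" "cvx B" "cvx C" "cvx D"
    and Z: "\<And>h i j k. h \<noteq> 0 \<Longrightarrow> i \<noteq> 0 \<Longrightarrow> j \<noteq> 0 \<Longrightarrow> k \<noteq> 0 \<Longrightarrow>
       real (card (zero_sums_4 (gaps A h) (gaps B i) (gaps C j) (gaps D k))) \<le> b"
  shows "real (card (near4 H A B C D)) \<le> (2 * real H) ^ 4 * b"
proof -
  have fin: "finite A" "finite B" "finite C" "finite D" using assms cvx_finite by auto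
  have b0: "b \<ge> 0" using Z[of 1 1 1 1] by (auto intro: order_trans[OF of_nat_0_le_iff])
  let ?I = "shifts H \<times> shifts H \<times> shifts H \<times> shifts H"
  let ?S = "SIGMA k:?I. zero_sums_4 (gaps A (fst k)) (gaps B (fst (snd k))) (gaps C (fst (snd (snd k)))) (gaps D (snd (snd (snd k))))"
  have fz: "finite (zero_sums_4 (gaps A h) (gaps B i) (gaps C j) (gaps D k))" for h i j k
    by (rule finite_subset[of _ "gaps A h \<times> gaps B i \<times> gaps C j \<times> gaps D k"]) (use fin gaps_finite_card in \<open>auto simp: zero_sums_4_def\<close>)
  let ?g = "\<lambda>(p, q, r, s). ((fst (shift_step A p), fst (shift_step B q), fst (shift_step C r), fst (shift_step D s)),
      (snd (shift_step A p), snd (shift_step B q), snd (shift_step C r), snd (shift_step D s)))"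
  have "card (near4 H A B C D) \<le> card ?S"
  proof (rule card_inj_on_le[of ?g])
    show "inj_on ?g (near4 H A B C D)"
    proof (rule inj_onI)
      fix x y assume m: "x \<in> near4 H A B C D" "y \<in> near4 H A B C D" and e: "?g x = ?g y"
      obtain p q r s p' q' r' s' where xy: "x = (p, q, r, s)" "y = (p', q', r', s')" by (metis surj_pair)
      have "shift_step A p = shift_step A p'" "shift_step B q = shift_step B q'" "shift_step C r = shift_step C r'"
        "shift_step D s = shift_step D s'"
        using e unfolding xy by (simp_all add: prod_eq_iff)
      then show "x = y" using m assms(1-4) unfolding xy near4_def by (auto dest: shift_step_inj)
    qed
    show "?g ` near4 H A B C D \<subseteq> ?S"
    proof (rule image_subsetI)
      fix x assume m: "x \<in> near4 H A B C D"
      obtain p q r s where x: "x = (p, q, r, s)" by (metis surj_pair)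
      have "p \<in> near_pairs H A" "q \<in> near_pairs H B" "r \<in> near_pairs H C" "s \<in> near_pairs H D"
        and "snd (shift_step A p) + snd (shift_step B q) + snd (shift_step C r) + snd (shift_step D s) = 0"
        using m by (auto simp: x near4_def shift_step_def)
      then show "?g x \<in> ?S" by (simp add: x zero_sums_4_def shift_step_mem)
    qed
    show "finite ?S" using fz by (intro finite_SigmaI) auto
  qed
  then have "real (card (near4 H A B C D)) \<le> (\<Sum>k\<in>?I. real (card (zero_sums_4 (gaps A (fst k)) (gaps B (fst (snd k)))
      (gaps C (fst (snd (snd k)))) (gaps D (snd (snd (snd k)))))))"
    using fz by (subst (asm) card_SigmaI) (auto simp flip: of_nat_sum)
  also have "\<dots> \<le> (\<Sum>k\<in>?I. b)"
    by (intro sum_mono Z) (auto dest: shifts_nonzero)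
  also have "\<dots> = real (card (shifts H)) * (real (card (shifts H)) * (real (card (shifts H)) * real (card (shifts H)))) * b"
    by (simp add: card_cartesian_product)
  also have "\<dots> \<le> (2 * real H) * ((2 * real H) * ((2 * real H) * (2 * real H))) * b"
    by (intro mult_mono card_shifts_real b0 order.refl mult_nonneg_nonneg) auto
  finally show "real (card (near4 H A B C D)) \<le> (2 * real H) ^ 4 * b"
    by (simp add: eval_nat_numeral mult_ac)
qed

section \<open>Boxes met by the solutions of an equation\<close>

definition sum3 :: "real \<times> real \<times> real \<Rightarrow> real" where
  "sum3 = (\<lambda>(a, b, c). a + b + c)"

definition sum4 :: "real \<times> real \<times> real \<times> real \<Rightarrow> real" where
  "sum4 = (\<lambda>(a, b, c, d). a + b + c + d)"

lemma rk_div_bounds: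
  assumes "finite A" "a \<in> A" "card A = N"
  shows "rk A a div H \<le> (N - 1) div H"
  using rk_less_card[OF assms(1,2)] assms(3) by (intro div_le_mono) auto

lemma div_diff_bound: 
  fixes i j K :: nat assumes "i \<le> K" "j \<le> K" shows "int i - int j \<in> {- int K .. int K}"
  using assms by auto

text \<open>Indices run up to \<open>N - 1\<close>, so differences of block numbers lie within
  \<open>(N - 1) div H\<close> of 0; \<open>H \<le> N\<close> absorbs the extra 1 into
  \<open>N / H\<close>.\<close>

lemma card_boxes_real:
  assumes "1 \<le> H" "H \<le> N"
  shows "real (2 * ((N - 1) div H) + 1) \<le> 3 * real N / real H"
proof -
  have "real ((N - 1) div H) \<le> real (N - 1) / real H" by (rule of_nat_div_le_of_nat)
  also have "\<dots> \<le> real N / real H" by (intro divide_right_mono) auto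
  finally have "real ((N - 1) div H) \<le> real N / real H" .
  moreover have "1 \<le> real N / real H" using assms by simp
  ultimately have "2 * real ((N - 1) div H) + 1 \<le> 3 * (real N / real H)" by linarith
  then show ?thesis by simp
qed

lemma card_symmetric_interval: "card {- int k .. int k} = 2 * k + 1"
  by simp

text \<open>Two distinct boxes on a line of direction \<open>(1, 1, 1)\<close> are strictly ordered
  in every coordinate, so the elements in them are too and their sums differ. Hence at most one box
  on each such line is met, and the lines are labelled by the differences to the first block
  number.\<close>

lemma card_box_differences_3:
  assumes fin: "finite A" "finite B" "finite C" and c: "card A = N" "card B = N" "card C = N"
    and P: "P \<subseteq> A \<times> B \<times> C"
  shows "card ((\<lambda>(a, b, c). (rk A a div H, rk B b div H, rk C c div H)) ` {p \<in> P. sum3 p = z})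
     \<le> (2 * ((N - 1) div H) + 1)\<^sup>2" (is "card (?f ` ?P) \<le> _")
proof -
  let ?g = "\<lambda>(i, j, k). (int j - int i, int k - int i)"
  let ?K = "{- int ((N - 1) div H) .. int ((N - 1) div H)}"
  have "card (?f ` ?P) \<le> card (?K \<times> ?K)"
  proof (rule card_inj_on_le[of ?g])
    show "inj_on ?g (?f ` ?P)"
    proof (rule inj_onI)
      fix u v assume u: "u \<in> ?f ` ?P" and v: "v \<in> ?f ` ?P" and e: "?g u = ?g v"
      obtain a b c where u': "u = ?f (a, b, c)" "(a, b, c) \<in> ?P" using u by auto
      obtain a' b' c' where v': "v = ?f (a', b', c')" "(a', b', c') \<in> ?P" using v by auto
      have s: "a + b + c = a' + b' + c'" using u' v' by (simp add: sum3_def)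
      have eq: "int (rk B b div H) - int (rk A a div H) = int (rk B b' div H) - int (rk A a' div H)"
        "int (rk C c div H) - int (rk A a div H) = int (rk C c' div H) - int (rk A a' div H)"
        using e unfolding u' v' by simp_all
      have "rk A a div H = rk A a' div H"
      proof (rule ccontr)
        assume "rk A a div H \<noteq> rk A a' div H"
        then consider "rk A a div H < rk A a' div H" "rk B b div H < rk B b' div H" "rk C c div H < rk C c' div H" |
          "rk A a div H > rk A a' div H" "rk B b div H > rk B b' div H" "rk C c div H > rk C c' div H"
          using eq by linarith
        then show False
        proof cases
          case 1
          then have "a < a'" "b < b'" "c < c'" using rk_div_less fin by blast+
          then show False using s by simp
        next
          case 2
          then have "a' < a" "b' < b" "c' < c" using rk_div_less fin by blast+
          then show False using s by simp
        qed
      qed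
      then show "u = v" using eq unfolding u' v' by simp
    qed
    show "?g ` ?f ` ?P \<subseteq> ?K \<times> ?K"
      using P rk_div_bounds[OF fin(1) _ c(1)] rk_div_bounds[OF fin(2) _ c(2)] rk_div_bounds[OF fin(3) _ c(3)]
      by (auto simp del: atLeastAtMost_iff intro!: div_diff_bound)
  qed simp
  then show ?thesis by (simp only: card_cartesian_product power2_eq_square card_symmetric_interval)
qed

lemma card_box_differences_4:
  assumes fin: "finite A" "finite B" "finite C" "finite D" and c: "card A = N" "card B = N" "card C = N" "card D = N"
    and P: "P \<subseteq> A \<times> B \<times> C \<times> D"
  shows "card ((\<lambda>(a, b, c, d). (rk A a div H, rk B b div H, rk C c div H, rk D d div H)) ` {p \<in> P. sum4 p = z})
     \<le> (2 * ((N - 1) div H) + 1) ^ 3" (is "card (?f ` ?P) \<le> _")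
proof -
  let ?g = "\<lambda>(i, j, k, l). (int j - int i, int k - int i, int l - int i)"
  let ?K = "{- int ((N - 1) div H) .. int ((N - 1) div H)}"
  have "card (?f ` ?P) \<le> card (?K \<times> ?K \<times> ?K)"
  proof (rule card_inj_on_le[of ?g])
    show "inj_on ?g (?f ` ?P)"
    proof (rule inj_onI)
      fix u v assume u: "u \<in> ?f ` ?P" and v: "v \<in> ?f ` ?P" and e: "?g u = ?g v"
      obtain a b c d where u': "u = ?f (a, b, c, d)" "(a, b, c, d) \<in> ?P" using u by auto
      obtain a' b' c' d' where v': "v = ?f (a', b', c', d')" "(a', b', c', d') \<in> ?P" using v by auto
      have s: "a + b + c + d = a' + b' + c' + d'" using u' v' by (simp add: sum4_def)
      have eq: "int (rk B b div H) - int (rk A a div H) = int (rk B b' div H) - int (rk A a' div H)"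
        "int (rk C c div H) - int (rk A a div H) = int (rk C c' div H) - int (rk A a' div H)"
        "int (rk D d div H) - int (rk A a div H) = int (rk D d' div H) - int (rk A a' div H)"
        using e unfolding u' v' by simp_all
      have "rk A a div H = rk A a' div H"
      proof (rule ccontr)
        assume "rk A a div H \<noteq> rk A a' div H"
        then consider "rk A a div H < rk A a' div H" "rk B b div H < rk B b' div H" "rk C c div H < rk C c' div H" "rk D d div H < rk D d' div H" |
          "rk A a div H > rk A a' div H" "rk B b div H > rk B b' div H" "rk C c div H > rk C c' div H" "rk D d div H > rk D d' div H"
          using eq by linarith
        then show False
        proof cases
          case 1
          then have "a < a'" "b < b'" "c < c'" "d < d'" using rk_div_less fin by blast+
          then show False using s by simp
        next
          case 2
          then have "a' < a" "b' < b" "c' < c" "d' < d" using rk_div_less fin by blast+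
          then show False using s by simp
        qed
      qed
      then show "u = v" using eq unfolding u' v' by simp
    qed
    show "?g ` ?f ` ?P \<subseteq> ?K \<times> ?K \<times> ?K"
      using P rk_div_bounds[OF fin(1) _ c(1)] rk_div_bounds[OF fin(2) _ c(2)] rk_div_bounds[OF fin(3) _ c(3)]
        rk_div_bounds[OF fin(4) _ c(4)]
      by (auto simp del: atLeastAtMost_iff intro!: div_diff_bound)
  qed simp
  then show ?thesis by (simp only: card_cartesian_product power3_eq_cube card_symmetric_interval mult.assoc)
qed

lemma card_Un_le_add: "card S \<le> x \<Longrightarrow> card T \<le> y \<Longrightarrow> card (S \<union> T) \<le> x + y"
  by (rule order_trans[OF card_Un_le add_mono])

lemma same_block_cases:
  assumes "finite A" "H \<ge> 1" "a \<in> A" "a' \<in> A" "rk A a div H = rk A a' div H"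
  shows "a = a' \<or> (a, a') \<in> near_pairs H A"
  using div_eq_imp_shift[OF assms(1,2,3,4) _ assms(5)] assms(3,4) by (auto simp: near_pairs_def)

definition box3 :: "nat \<Rightarrow> real set \<Rightarrow> real set \<Rightarrow> real set \<Rightarrow> real \<times> real \<times> real \<Rightarrow> nat \<times> nat \<times> nat" where
  "box3 H A B C = (\<lambda>(a, b, c). (rk A a div H, rk B b div H, rk C c div H))"

definition box4 :: "nat \<Rightarrow> real set \<Rightarrow> real set \<Rightarrow> real set \<Rightarrow> real set \<Rightarrow> real \<times> real \<times> real \<times> real \<Rightarrow> nat \<times> nat \<times> nat \<times> nat" where
  "box4 H A B C D = (\<lambda>(a, b, c, d). (rk A a div H, rk B b div H, rk C c div H, rk D d div H))"

text \<open>In each coordinate two representations in a common box either agree or form a near pair.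
  Equality of the sums excludes a change in exactly one coordinate, which leaves the five listed
  terms.\<close>

lemma coll_box3_le:
  assumes A: "cvx A" "cvx B" "cvx C" and H: "H \<ge> 1" and P: "P \<subseteq> A \<times> B \<times> C"
  shows "coll (\<lambda>p. (sum3 p, box3 H A B C p)) P \<le> card P + card (near3 H A B C)
     + card (near2 H A B \<times> C) + card (near2 H A C \<times> B) + card (near2 H B C \<times> A)"
proof -
  have fin: "finite A" "finite B" "finite C" using A cvx_finite by auto
  have fP: "finite P" using P fin finite_subset by blast
  let ?S = "{(p, q). p \<in> P \<and> q \<in> P \<and> (sum3 p, box3 H A B C p) = (sum3 q, box3 H A B C q)}"
  let ?f = "\<lambda>(p, q, r). ((fst p, fst q, fst r), (snd p, snd q, snd r))"
  let ?f1 = "\<lambda>((p, q), c). ((fst p, fst q, c), (snd p, snd q, c))"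
  let ?f2 = "\<lambda>((p, q), c). ((fst p, c, fst q), (snd p, c, snd q))"
  let ?f3 = "\<lambda>((p, q), c). ((c, fst p, fst q), (c, snd p, snd q))"
  let ?U = "(\<lambda>p. (p, p)) ` P \<union> ?f ` near3 H A B C \<union> ?f1 ` (near2 H A B \<times> C)
     \<union> ?f2 ` (near2 H A C \<times> B) \<union> ?f3 ` (near2 H B C \<times> A)"
  have fU: "finite ?U"
    using fP fin by (intro finite_UnI finite_imageI finite_cartesian_product finite_near2 finite_near3)
  have "?S \<subseteq> ?U"
  proof
    fix x assume x: "x \<in> ?S"
    obtain a b c a' b' c' where xx: "x = ((a, b, c), (a', b', c'))" by (metis surj_pair)
    have m: "(a, b, c) \<in> P" "a \<in> A" "b \<in> B" "c \<in> C" "a' \<in> A" "b' \<in> B" "c' \<in> C"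
      and s: "a + b + c = a' + b' + c'"
      and d: "rk A a div H = rk A a' div H" "rk B b div H = rk B b' div H" "rk C c div H = rk C c' div H"
      using x P by (auto simp: xx sum3_def box3_def)
    have near: "a = a' \<or> (a, a') \<in> near_pairs H A" "b = b' \<or> (b, b') \<in> near_pairs H B" "c = c' \<or> (c, c') \<in> near_pairs H C"
      using m d same_block_cases fin H by blast+
    have 0: "x \<in> (\<lambda>p. (p, p)) ` P" if "a = a'" "b = b'" "c = c'"
      using that m(1) by (auto simp: xx)
    have 1: "x \<in> ?f ` near3 H A B C"
      if "(a, a') \<in> near_pairs H A" "(b, b') \<in> near_pairs H B" "(c, c') \<in> near_pairs H C"
      using that s by (intro image_eqI[of _ _ "((a, a'), (b, b'), (c, c'))"]) (auto simp: xx near3_def)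
    have 2: "x \<in> ?f1 ` (near2 H A B \<times> C)" if "(a, a') \<in> near_pairs H A" "(b, b') \<in> near_pairs H B" "c = c'"
      using that s m by (intro image_eqI[of _ _ "(((a, a'), (b, b')), c)"]) (auto simp: xx near2_def)
    have 3: "x \<in> ?f2 ` (near2 H A C \<times> B)" if "(a, a') \<in> near_pairs H A" "b = b'" "(c, c') \<in> near_pairs H C"
      using that s m by (intro image_eqI[of _ _ "(((a, a'), (c, c')), b)"]) (auto simp: xx near2_def)
    have 4: "x \<in> ?f3 ` (near2 H B C \<times> A)" if "a = a'" "(b, b') \<in> near_pairs H B" "(c, c') \<in> near_pairs H C"
      using that s m by (intro image_eqI[of _ _ "(((b, b'), (c, c')), a)"]) (auto simp: xx near2_def)
    have e: "a = a' \<Longrightarrow> b = b' \<Longrightarrow> c = c'" "a = a' \<Longrightarrow> c = c' \<Longrightarrow> b = b'" "b = b' \<Longrightarrow> c = c' \<Longrightarrow> a = a'"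
      using s by auto
    show "x \<in> ?U" using near 0 1 2 3 4 e by blast
  qed
  then have "card ?S \<le> card ?U" using fU by (intro card_mono)
  also have "\<dots> \<le> card P + card (near3 H A B C) + card (near2 H A B \<times> C) + card (near2 H A C \<times> B) + card (near2 H B C \<times> A)"
    by (intro card_Un_le_add card_image_le finite_cartesian_product finite_near2 finite_near3 fP fin)
  finally show ?thesis by (simp add: coll_def)
qed

section \<open>Sums of three and of four elements\<close>

definition cbrt :: "real \<Rightarrow> real" where "cbrt x = x powr (1 / 3)"

lemma cbrt_nonneg [simp]: "cbrt x \<ge> 0"
  by (simp add: cbrt_def)

lemma le_cbrtI:
  assumes "x \<ge> 0" "x ^ 3 \<le> y" shows "x \<le> cbrt y"
proof -
  have "x = (x ^ 3) powr (1 / 3)"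
  proof (cases "x = 0")
    case False
    then have "x ^ 3 = x powr 3" using assms(1) by simp
    then show ?thesis using False assms(1) by (simp only: powr_powr) simp
  qed simp
  also have "\<dots> \<le> cbrt y" unfolding cbrt_def using assms by (intro powr_mono2) auto
  finally show ?thesis .
qed

lemma ln_cbrt: "x > 0 \<Longrightarrow> ln (cbrt x) = ln x / 3"
  by (simp add: cbrt_def ln_powr)

lemma cbrt_pos: "x > 0 \<Longrightarrow> cbrt x > 0"
  by (simp add: cbrt_def)

lemma card_zero_sums_3_gaps_le:
  assumes A: "cvx2 A" "cvx2 B" "cvx2 C" and c: "card A = N" "card B = N" "card C = N" and "h \<noteq> 0" "i \<noteq> 0" "j \<noteq> 0"
  shows "real (card (zero_sums_3 (gaps A h) (gaps B i) (gaps C j))) \<le> cbrt (576 * real N ^ 5)"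
proof (rule le_cbrtI)
  have fin: "finite A" "finite B" "finite C" using A cvx_finite by (auto simp: cvx2_def)
  show "real (card (zero_sums_3 (gaps A h) (gaps B i) (gaps C j))) ^ 3 \<le> 576 * real N ^ 5"
    unfolding zero_sums_3_def
    using gaps_finite_card[OF fin(1), of h] gaps_finite_card[OF fin(2), of i] gaps_finite_card[OF fin(3), of j] assms
    by (intro card_zero_sums_3_le) (auto simp: cvx2_def)
qed simp

lemma sums_3_ineq:
  assumes A: "cvx2 A" "cvx2 B" "cvx2 C" and c: "card A = N" "card B = N" "card C = N"
    and H: "1 \<le> H" "H \<le> N" and Z: "finite Z" and X: "X = real (card {p \<in> A \<times> B \<times> C. sum3 p \<in> Z})"
  shows "X\<^sup>2 \<le> real (card Z) * (3 * real N / real H)\<^sup>2 *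
    (X + (8 * real H ^ 3 * cbrt (576 * real N ^ 5) + 12 * real H ^ 2 * real N ^ 2))"
proof -
  define P where "P = {p \<in> A \<times> B \<times> C. sum3 p \<in> Z}"
  have cv: "cvx A" "cvx B" "cvx C" using A by (auto simp: cvx2_def)
  have fin: "finite A" "finite B" "finite C" using cv cvx_finite by auto
  have fP: "finite P" and PA: "P \<subseteq> A \<times> B \<times> C" and PZ: "sum3 ` P \<subseteq> Z" using fin by (auto simp: P_def)
  let ?M = "(2 * ((N - 1) div H) + 1)\<^sup>2"
  have "real (coll (\<lambda>p. (sum3 p, box3 H A B C p)) P) \<le> real (card P + card (near3 H A B C)
     + card (near2 H A B \<times> C) + card (near2 H A C \<times> B) + card (near2 H B C \<times> A))"
    using coll_box3_le[OF cv H(1) PA] by (simp only: of_nat_le_iff)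
  also have "\<dots> \<le> X + (8 * real H ^ 3 * cbrt (576 * real N ^ 5) + 12 * real H ^ 2 * real N ^ 2)"
  proof -
    have "real (card (near3 H A B C)) \<le> (2 * real H) ^ 3 * cbrt (576 * real N ^ 5)"
      by (intro card_near3_le cv card_zero_sums_3_gaps_le A c)
    moreover have "real (card (near2 H U V \<times> W)) \<le> 4 * real H ^ 2 * real N ^ 2"
      if "cvx U" "cvx V" "card U = N" "card W = N" for U V W
    proof -
      have "real (card (near2 H U V \<times> W)) = real (card (near2 H U V)) * real N"
        using that by (simp add: card_cartesian_product)
      also have "\<dots> \<le> ((2 * real H)\<^sup>2 * real N) * real N"
        using card_near2_le[OF that(1,2), of H] that(3) by (intro mult_right_mono) auto
      finally show ?thesis by (simp add: power2_eq_square)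
    qed
    from this[OF cv(1,2) c(1,3)] this[OF cv(1,3) c(1,2)] this[OF cv(2,3) c(2,1)]
    have "real (card (near2 H A B \<times> C)) \<le> 4 * real H ^ 2 * real N ^ 2"
      "real (card (near2 H A C \<times> B)) \<le> 4 * real H ^ 2 * real N ^ 2"
      "real (card (near2 H B C \<times> A)) \<le> 4 * real H ^ 2 * real N ^ 2" by auto
    ultimately show ?thesis unfolding of_nat_add X P_def[symmetric] by (simp add: power_mult_distrib)
  qed
  finally have G: "real (coll (\<lambda>p. (sum3 p, box3 H A B C p)) P)
      \<le> X + (8 * real H ^ 3 * cbrt (576 * real N ^ 5) + 12 * real H ^ 2 * real N ^ 2)" .
  have "coll sum3 P \<le> ?M * coll (\<lambda>p. (sum3 p, box3 H A B C p)) P"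
    by (rule coll_le_boxes[OF fP]) (use card_box_differences_3[OF fin c PA] in \<open>simp add: box3_def\<close>)
  then have "(card P)\<^sup>2 \<le> card Z * (?M * coll (\<lambda>p. (sum3 p, box3 H A B C p)) P)"
    using card_square_le_coll[OF fP Z PZ] by (meson le_trans mult_le_mono2)
  then have "real ((card P)\<^sup>2) \<le> real (card Z * (?M * coll (\<lambda>p. (sum3 p, box3 H A B C p)) P))"
    by (simp only: of_nat_le_iff)
  then have "X\<^sup>2 \<le> real (card Z) * ((real (2 * ((N - 1) div H) + 1))\<^sup>2 * real (coll (\<lambda>p. (sum3 p, box3 H A B C p)) P))"
    unfolding X P_def[symmetric] by (simp only: of_nat_mult of_nat_power)
  also have "\<dots> \<le> real (card Z) * ((3 * real N / real H)\<^sup>2 *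
      (X + (8 * real H ^ 3 * cbrt (576 * real N ^ 5) + 12 * real H ^ 2 * real N ^ 2)))"
    using G by (intro mult_left_mono mult_mono power_mono card_boxes_real H) auto
  finally show ?thesis by (simp add: mult.assoc)
qed

text \<open>The alternatives say which collisions dominate, with \<open>H^2\<close> about
  \<open>N^2 * |Z| / X\<close>. If all three coordinates change,
  \<open>X \<le> H^3 * N^(5/3)\<close> gives \<open>X^(5/2) \<le> N^(14/3) * |Z|^(3/2)\<close>; if
  two change, \<open>X \<le> H^2 * N^2\<close> gives \<open>X^2 \<le> N^4 * |Z|\<close>, up to
  constants.\<close>

lemma sums_3_ln_le:
  assumes A: "cvx2 A" "cvx2 B" "cvx2 C" and c: "card A = N" "card B = N" "card C = N"
    and Z: "finite Z" and X: "X = real (card {p \<in> A \<times> B \<times> C. sum3 p \<in> Z})" "X > 0"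
  shows "ln X \<le> 5000 + 28 / 15 * ln (real N) + 3 / 5 * ln (real (card Z)) \<or>
     ln X \<le> 5000 + 2 * ln (real N) + 1 / 2 * ln (real (card Z))"
proof -
  define P where "P = {p \<in> A \<times> B \<times> C. sum3 p \<in> Z}"
  have fin: "finite A" "finite B" "finite C" using A cvx_finite by (auto simp: cvx2_def)
  have fP: "finite P" using fin by (simp add: P_def)
  have "card P \<noteq> 0" using X unfolding P_def by simp
  then have "P \<noteq> {}" by auto
  then have "A \<noteq> {}" "Z \<noteq> {}" by (auto simp: P_def)
  then have N1: "N \<ge> 1" and zp: "real (card Z) > 0" using c fin Z by (auto simp: Suc_le_eq card_gt_0_iff)
  let ?z = "real (card Z)"
  have X3: "X \<le> real N ^ 3"
  proof -
    have "card P \<le> card (A \<times> B \<times> C)" using fin by (intro card_mono) (auto simp: P_def)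
    then have "real (card P) \<le> real (N * (N * N))" unfolding card_cartesian_product c of_nat_le_iff .
    then show ?thesis by (simp add: X(1) P_def power3_eq_cube)
  qed
  have X2: "X \<le> ?z * real N ^ 2"
  proof -
    have "card P \<le> card (Z \<times> A \<times> B)"
      by (rule card_inj_on_le[of "\<lambda>p. (sum3 p, fst p, fst (snd p))"]) (use fin Z in \<open>auto simp: P_def sum3_def inj_on_def\<close>)
    then have "real (card P) \<le> real (card Z * (N * N))" unfolding card_cartesian_product c of_nat_le_iff .
    then show ?thesis by (simp add: X(1) P_def power2_eq_square)
  qed
  have n0: "ln (real N) \<ge> 0" using N1 by simp
  show ?thesis
  proof (cases "X < 18 * ?z")
    \<comment> \<open>The optimal side would exceed \<open>N\<close> here, but
      \<open>X \<le> 18 * |Z|\<close> and \<open>X \<le> N^3\<close> already imply the first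
      alternative.\<close>
    case True
    have "ln X \<le> ln (18 * ?z)" using True X zp by (subst ln_le_cancel_iff) auto
    then have 1: "ln X \<le> ln 18 + ln ?z" using zp by (simp add: ln_mult)
    have "ln X \<le> ln (real N ^ 3)" using X3 X N1 by (subst ln_le_cancel_iff) auto
    then have 2: "ln X \<le> 3 * ln (real N)" using N1 by (simp add: ln_realpow)
    show ?thesis using 1 2 n0 ln_le_self[of 18, simplified] by linarith
  next
    case False
    \<comment> \<open>The side for which \<open>|Z| * (3 * N / y)^2 = X / 2\<close>; rounding up to
      \<open>H\<close> costs at most a factor 2.\<close>
    define y where "y = real N * sqrt (18 * ?z / X)"
    have y2: "y\<^sup>2 = 18 * ?z * real N ^ 2 / X"
      using X zp by (simp add: y_def power_mult_distrib)
    have "1\<^sup>2 \<le> y\<^sup>2" unfolding y2 using X2 X zp by (simp add: field_simps)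
    moreover have "y \<ge> 0" using X zp by (simp add: y_def)
    ultimately have y1: "1 \<le> y" by (rule power2_le_imp_le)
    have "sqrt (18 * ?z / X) \<le> 1" using False X by (simp add: field_simps)
    then have yN: "y \<le> real N" unfolding y_def by (simp add: mult_left_le)
    obtain H where H: "1 \<le> H" "H \<le> N" "y \<le> real H" "real H \<le> 2 * y"
      using ex_nat_between[OF y1 yN] .
    define G where "G = 8 * real H ^ 3 * cbrt (576 * real N ^ 5) + 12 * real H ^ 2 * real N ^ 2"
    have "X\<^sup>2 \<le> ?z * (3 * real N / real H)\<^sup>2 * (X + G)"
      unfolding G_def by (rule sums_3_ineq[OF A c H(1,2) Z X(1)])
    also have "\<dots> \<le> (X / 2) * (X + G)"
    proof (rule mult_right_mono)
      have "?z * (3 * real N / real H)\<^sup>2 \<le> ?z * (3 * real N / y)\<^sup>2"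
        using H y1 by (intro mult_left_mono power_mono divide_left_mono) auto
      also have "\<dots> = X / 2" unfolding power_divide y2 using X zp N1 by (simp add: power_mult_distrib field_simps)
      finally show "?z * (3 * real N / real H)\<^sup>2 \<le> X / 2" .
      show "0 \<le> X + G" using X by (simp add: G_def)
    qed
    finally have "X * X \<le> X * ((X + G) / 2)" by (simp add: power2_eq_square)
    then have XG: "X \<le> G" using X(2) by simp
    have "ln (real H) \<le> ln (2 * y)" using H y1 by (subst ln_le_cancel_iff) auto
    also have "\<dots> = ln 2 + ln (real N) + ln 18 / 2 + ln ?z / 2 - ln X / 2"
      using X zp N1 by (simp add: y_def ln_mult ln_sqrt ln_div add_divide_distrib diff_divide_distrib)
    finally have lnH: "ln (real H) \<le> 11 + ln (real N) + ln ?z / 2 - ln X / 2"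
      using ln_le_self[of 2, simplified] ln_le_self[of 18, simplified] by linarith
    have Np: "real N > 0" "real H > 0" using N1 H by auto
    consider "X \<le> 16 * real H ^ 3 * cbrt (576 * real N ^ 5)" | "X \<le> 24 * real H ^ 2 * real N ^ 2"
      using XG unfolding G_def by linarith
    then show ?thesis
    proof cases
      case 1
      have "ln X \<le> ln (16 * real H ^ 3 * cbrt (576 * real N ^ 5))"
        using 1 X Np by (subst ln_le_cancel_iff) (auto simp: cbrt_pos)
      also have "\<dots> = ln 16 + 3 * ln (real H) + ln 576 / 3 + 5 * ln (real N) / 3"
        using Np cbrt_pos[of "576 * real N ^ 5"] by (simp add: ln_mult ln_realpow ln_cbrt add_divide_distrib)
      finally show ?thesis
        using lnH ln_le_self[of 16, simplified] ln_le_self[of 576, simplified] by linarith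
    next
      case 2
      have "ln X \<le> ln (24 * real H ^ 2 * real N ^ 2)"
        using 2 X Np by (subst ln_le_cancel_iff) auto
      also have "\<dots> = ln 24 + 2 * ln (real H) + 2 * ln (real N)"
        using Np by (simp add: ln_mult ln_realpow)
      finally show ?thesis
        using lnH ln_le_self[of 24, simplified] by linarith
    qed
  qed
qed

text \<open>
  Pairs of representations in a common box that agree in exactly one (\<open>deg1\<close>) or two (\<open>deg2\<close>)
  coordinates. Restricting their sum to \<open>Z\<close> is essential here, since the shared coordinates are free.
\<close>

definition deg1 :: "nat \<Rightarrow> real set \<Rightarrow> real set \<Rightarrow> real set \<Rightarrow> real set \<Rightarrow> real set \<Rightarrow>
    (((real \<times> real) \<times> (real \<times> real) \<times> (real \<times> real)) \<times> real) set" where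
  "deg1 H Z A B C D = (SIGMA t:near3 H A B C. {d \<in> D. fst (fst t) + fst (fst (snd t)) + fst (snd (snd t)) + d \<in> Z})"

definition deg2 :: "nat \<Rightarrow> real set \<Rightarrow> real set \<Rightarrow> real set \<Rightarrow> real set \<Rightarrow> real set \<Rightarrow>
    (((real \<times> real) \<times> (real \<times> real)) \<times> (real \<times> real)) set" where
  "deg2 H Z A B C D = (SIGMA t:near2 H A B. {p \<in> C \<times> D. fst (fst t) + fst (snd t) + (fst p + snd p) \<in> Z})"

lemma finite_deg1: "finite A \<Longrightarrow> finite B \<Longrightarrow> finite C \<Longrightarrow> finite D \<Longrightarrow> finite (deg1 H Z A B C D)"
  unfolding deg1_def by (intro finite_SigmaI finite_near3) auto

lemma finite_deg2: "finite A \<Longrightarrow> finite B \<Longrightarrow> finite C \<Longrightarrow> finite D \<Longrightarrow> finite (deg2 H Z A B C D)"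
  unfolding deg2_def by (intro finite_SigmaI finite_near2) auto

lemma card_Sigma_le_real:
  assumes "finite I" "\<And>i. i \<in> I \<Longrightarrow> finite (F i)" "\<And>i. i \<in> I \<Longrightarrow> real (card (F i)) \<le> b"
  shows "real (card (SIGMA i:I. F i)) \<le> real (card I) * b"
proof -
  have "real (card (SIGMA i:I. F i)) = (\<Sum>i\<in>I. real (card (F i)))"
    using assms(1,2) by (simp add: card_SigmaI)
  also have "\<dots> \<le> (\<Sum>i\<in>I. b)" by (intro sum_mono assms)
  finally show ?thesis by simp
qed

text \<open>For a given relation in three coordinates the shared fourth one is fixed by the value of
  the sum in \<open>Z\<close>, which leaves at most \<open>card Z\<close> choices besides the
  trivial \<open>N\<close>.\<close>

lemma card_deg1_le:
  assumes cv: "cvx2 A" "cvx2 B" "cvx2 C" "finite D" and c: "card A = N" "card B = N" "card C = N" "card D = N" and Z: "finite Z"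
  shows "real (card (deg1 H Z A B C D)) \<le> 8 * real H ^ 3 * cbrt (576 * real N ^ 5) * min (real N) (real (card Z))"
proof -
  have cv': "cvx A" "cvx B" "cvx C" using cv by (auto simp: cvx2_def)
  have fin: "finite A" "finite B" "finite C" using cv' cvx_finite by auto
  have "real (card (deg1 H Z A B C D)) \<le> real (card (near3 H A B C)) * min (real N) (real (card Z))"
    unfolding deg1_def
  proof (rule card_Sigma_le_real)
    fix t
    let ?F = "{d \<in> D. fst (fst t) + fst (fst (snd t)) + fst (snd (snd t)) + d \<in> Z}"
    have "card ?F \<le> card D" using cv(4) by (intro card_mono) auto
    moreover have "card ?F \<le> card Z"
      by (rule card_inj_on_le[of "\<lambda>d. fst (fst t) + fst (fst (snd t)) + fst (snd (snd t)) + d"])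
         (use Z in \<open>auto simp: inj_on_def\<close>)
    ultimately show "real (card ?F) \<le> min (real N) (real (card Z))" using c by simp
  qed (use fin cv(4) in \<open>auto intro: finite_near3\<close>)
  also have "\<dots> \<le> ((2 * real H) ^ 3 * cbrt (576 * real N ^ 5)) * min (real N) (real (card Z))"
    by (intro mult_right_mono card_near3_le card_zero_sums_3_gaps_le cv cv' c) auto
  finally show ?thesis by (simp add: power_mult_distrib)
qed

text \<open>The two shared coordinates are pairs in \<open>C \<times> D\<close> with sum in a
  translate of \<open>Z\<close>, which \<open>card_sum_in_le\<close> counts.\<close>

lemma card_deg2_le:
  assumes cv: "cvx A" "cvx B" "cvx C" "cvx D" and c: "card A = N" "card B = N" "card C = N" "card D = N" and Z: "finite Z"
  shows "real (card (deg2 H Z A B C D)) \<le> 4 * real H ^ 2 * real N * min (real N ^ 2) (cbrt (576 * real N ^ 3 * real (card Z) ^ 2))"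
proof -
  have fin: "finite A" "finite B" "finite C" "finite D" using cv cvx_finite by auto
  have "real (card (deg2 H Z A B C D)) \<le> real (card (near2 H A B)) * min (real N ^ 2) (cbrt (576 * real N ^ 3 * real (card Z) ^ 2))"
    unfolding deg2_def
  proof (rule card_Sigma_le_real)
    fix t :: "(real \<times> real) \<times> (real \<times> real)"
    let ?y = "fst (fst t) + fst (snd t)"
    let ?F = "{p \<in> C \<times> D. ?y + (fst p + snd p) \<in> Z}"
    have "card ?F \<le> card (C \<times> D)" using fin by (intro card_mono) auto
    then have "real (card ?F) \<le> real (N * N)" unfolding card_cartesian_product c of_nat_le_iff .
    then have 1: "real (card ?F) \<le> real N ^ 2" by (simp add: power2_eq_square)
    have "u \<in> (\<lambda>z. z - ?y) ` Z \<longleftrightarrow> ?y + u \<in> Z" for u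
      by (auto simp: image_iff intro!: bexI[of _ "?y + u"])
    then have "?F = {p \<in> C \<times> D. fst p + snd p \<in> (\<lambda>z. z - ?y) ` Z}" by simp
    moreover have "card ((\<lambda>z. z - ?y) ` Z) = card Z" by (rule card_image) (simp add: inj_on_def)
    ultimately have "real (card ?F) ^ 3 \<le> 576 * real N * real N ^ 2 * real (card Z) ^ 2"
      using card_sum_in_le[OF cv(3) fin(4), of "(\<lambda>z. z - ?y) ` Z"] Z c by simp
    then have "real (card ?F) \<le> cbrt (576 * real N ^ 3 * real (card Z) ^ 2)"
      by (intro le_cbrtI) (auto simp: power3_eq_cube power2_eq_square mult_ac)
    with 1 show "real (card ?F) \<le> min (real N ^ 2) (cbrt (576 * real N ^ 3 * real (card Z) ^ 2))" by simp
  qed (use fin in \<open>auto intro: finite_near2\<close>)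
  also have "\<dots> \<le> ((2 * real H)\<^sup>2 * real N) * min (real N ^ 2) (cbrt (576 * real N ^ 3 * real (card Z) ^ 2))"
    using card_near2_le[OF cv(1,2), of H] c by (intro mult_right_mono) auto
  finally show ?thesis by (simp add: power_mult_distrib)
qed

text \<open>Of the 16 patterns of agreeing and differing coordinates, the four with exactly one
  difference contradict the equality of the sums. The others give 1 + 1 + 4 + 6 terms.\<close>

lemma coll_box4_le:
  assumes fin: "finite A" "finite B" "finite C" "finite D" and H: "H \<ge> 1"
    and P: "P \<subseteq> A \<times> B \<times> C \<times> D" "sum4 ` P \<subseteq> Z"
  shows "coll (\<lambda>p. (sum4 p, box4 H A B C D p)) P \<le> card P + card (near4 H A B C D) + card (deg1 H Z A B C D) + 
     card (deg1 H Z A B D C) + card (deg1 H Z A C D B) + card (deg1 H Z B C D A) + 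
     card (deg2 H Z A B C D) + card (deg2 H Z A C B D) + card (deg2 H Z A D B C) + 
     card (deg2 H Z B C A D) + card (deg2 H Z B D A C) + card (deg2 H Z C D A B)"
proof -
  have fP: "finite P" using P fin finite_subset by blast
  let ?S = "{(p, q). p \<in> P \<and> q \<in> P \<and> (sum4 p, box4 H A B C D p) = (sum4 q, box4 H A B C D q)}"
  let ?f = "\<lambda>(p, q, r, s). ((fst p, fst q, fst r, fst s), (snd p, snd q, snd r, snd s))"
  let ?f1 = "\<lambda>((p, q, r), d). ((fst p, fst q, fst r, d), (snd p, snd q, snd r, d))"
  let ?f2 = "\<lambda>((p, q, r), d). ((fst p, fst q, d, fst r), (snd p, snd q, d, snd r))"
  let ?f3 = "\<lambda>((p, q, r), d). ((fst p, d, fst q, fst r), (snd p, d, snd q, snd r))"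
  let ?f4 = "\<lambda>((p, q, r), d). ((d, fst p, fst q, fst r), (d, snd p, snd q, snd r))"
  let ?f5 = "\<lambda>((p, q), (c, d)). ((fst p, fst q, c, d), (snd p, snd q, c, d))"
  let ?f6 = "\<lambda>((p, q), (c, d)). ((fst p, c, fst q, d), (snd p, c, snd q, d))"
  let ?f7 = "\<lambda>((p, q), (c, d)). ((fst p, c, d, fst q), (snd p, c, d, snd q))"
  let ?f8 = "\<lambda>((p, q), (c, d)). ((c, fst p, fst q, d), (c, snd p, snd q, d))"
  let ?f9 = "\<lambda>((p, q), (c, d)). ((c, fst p, d, fst q), (c, snd p, d, snd q))"
  let ?f10 = "\<lambda>((p, q), (c, d)). ((c, d, fst p, fst q), (c, d, snd p, snd q))"
  let ?U = "(\<lambda>p. (p, p)) ` P \<union> ?f ` near4 H A B C D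
     \<union> ?f1 ` deg1 H Z A B C D
     \<union> ?f2 ` deg1 H Z A B D C
     \<union> ?f3 ` deg1 H Z A C D B
     \<union> ?f4 ` deg1 H Z B C D A
     \<union> ?f5 ` deg2 H Z A B C D
     \<union> ?f6 ` deg2 H Z A C B D
     \<union> ?f7 ` deg2 H Z A D B C
     \<union> ?f8 ` deg2 H Z B C A D
     \<union> ?f9 ` deg2 H Z B D A C
     \<union> ?f10 ` deg2 H Z C D A B"
  have fU: "finite ?U"
    by (intro finite_UnI finite_imageI finite_near4 finite_deg1 finite_deg2 fin fP)
  have "?S \<subseteq> ?U"
  proof
    fix x assume x: "x \<in> ?S"
    obtain a b c d a' b' c' d' where xx: "x = ((a, b, c, d), (a', b', c', d'))" by (metis surj_pair)
    have m: "(a, b, c, d) \<in> P" "a \<in> A" "b \<in> B" "c \<in> C" "d \<in> D" "a' \<in> A" "b' \<in> B" "c' \<in> C" "d' \<in> D"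
        "a + b + c + d \<in> Z" "a' + b' + c' + d' \<in> Z"
      and s: "a + b + c + d = a' + b' + c' + d'"
      and e: "rk A a div H = rk A a' div H" "rk B b div H = rk B b' div H" "rk C c div H = rk C c' div H"
        "rk D d div H = rk D d' div H"
      using x P by (auto simp: xx sum4_def box4_def image_subset_iff)
    have near: "a = a' \<or> (a, a') \<in> near_pairs H A" "b = b' \<or> (b, b') \<in> near_pairs H B"
      "c = c' \<or> (c, c') \<in> near_pairs H C" "d = d' \<or> (d, d') \<in> near_pairs H D"
      using m e same_block_cases fin H by blast+
    have same: "x \<in> (\<lambda>p. (p, p)) ` P" if "a = a'" "b = b'" "c = c'" "d = d'"
      using that m(1) by (auto simp: xx)
    have diff: "x \<in> ?f ` near4 H A B C D"
      if "(a, a') \<in> near_pairs H A" "(b, b') \<in> near_pairs H B" "(c, c') \<in> near_pairs H C" "(d, d') \<in> near_pairs H D"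
      using that s by (intro image_eqI[of _ _ "((a, a'), (b, b'), (c, c'), (d, d'))"]) (auto simp: xx near4_def)
    have c1: "x \<in> ?f1 ` deg1 H Z A B C D"
      if "(a, a') \<in> near_pairs H A" "(b, b') \<in> near_pairs H B" "(c, c') \<in> near_pairs H C" "d = d'"
      using that s m by (intro image_eqI[of _ _ "(((a, a'), (b, b'), (c, c')), d)"]) (auto simp: xx deg1_def near3_def add_ac)
    have c2: "x \<in> ?f2 ` deg1 H Z A B D C"
      if "(a, a') \<in> near_pairs H A" "(b, b') \<in> near_pairs H B" "c = c'" "(d, d') \<in> near_pairs H D"
      using that s m by (intro image_eqI[of _ _ "(((a, a'), (b, b'), (d, d')), c)"]) (auto simp: xx deg1_def near3_def add_ac)
    have c3: "x \<in> ?f3 ` deg1 H Z A C D B"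
      if "(a, a') \<in> near_pairs H A" "b = b'" "(c, c') \<in> near_pairs H C" "(d, d') \<in> near_pairs H D"
      using that s m by (intro image_eqI[of _ _ "(((a, a'), (c, c'), (d, d')), b)"]) (auto simp: xx deg1_def near3_def add_ac)
    have c4: "x \<in> ?f4 ` deg1 H Z B C D A"
      if "a = a'" "(b, b') \<in> near_pairs H B" "(c, c') \<in> near_pairs H C" "(d, d') \<in> near_pairs H D"
      using that s m by (intro image_eqI[of _ _ "(((b, b'), (c, c'), (d, d')), a)"]) (auto simp: xx deg1_def near3_def add_ac)
    have c5: "x \<in> ?f5 ` deg2 H Z A B C D"
      if "(a, a') \<in> near_pairs H A" "(b, b') \<in> near_pairs H B" "c = c'" "d = d'"
      using that s m by (intro image_eqI[of _ _ "(((a, a'), (b, b')), (c, d))"]) (auto simp: xx deg2_def near2_def add_ac)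
    have c6: "x \<in> ?f6 ` deg2 H Z A C B D"
      if "(a, a') \<in> near_pairs H A" "b = b'" "(c, c') \<in> near_pairs H C" "d = d'"
      using that s m by (intro image_eqI[of _ _ "(((a, a'), (c, c')), (b, d))"]) (auto simp: xx deg2_def near2_def add_ac)
    have c7: "x \<in> ?f7 ` deg2 H Z A D B C"
      if "(a, a') \<in> near_pairs H A" "b = b'" "c = c'" "(d, d') \<in> near_pairs H D"
      using that s m by (intro image_eqI[of _ _ "(((a, a'), (d, d')), (b, c))"]) (auto simp: xx deg2_def near2_def add_ac)
    have c8: "x \<in> ?f8 ` deg2 H Z B C A D"
      if "a = a'" "(b, b') \<in> near_pairs H B" "(c, c') \<in> near_pairs H C" "d = d'"
      using that s m by (intro image_eqI[of _ _ "(((b, b'), (c, c')), (a, d))"]) (auto simp: xx deg2_def near2_def add_ac)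
    have c9: "x \<in> ?f9 ` deg2 H Z B D A C"
      if "a = a'" "(b, b') \<in> near_pairs H B" "c = c'" "(d, d') \<in> near_pairs H D"
      using that s m by (intro image_eqI[of _ _ "(((b, b'), (d, d')), (a, c))"]) (auto simp: xx deg2_def near2_def add_ac)
    have c10: "x \<in> ?f10 ` deg2 H Z C D A B"
      if "a = a'" "b = b'" "(c, c') \<in> near_pairs H C" "(d, d') \<in> near_pairs H D"
      using that s m by (intro image_eqI[of _ _ "(((c, c'), (d, d')), (a, b))"]) (auto simp: xx deg2_def near2_def add_ac)
    have three: "a = a' \<Longrightarrow> b = b' \<Longrightarrow> c = c' \<Longrightarrow> d = d'" "a = a' \<Longrightarrow> b = b' \<Longrightarrow> d = d' \<Longrightarrow> c = c'"
      "a = a' \<Longrightarrow> c = c' \<Longrightarrow> d = d' \<Longrightarrow> b = b'" "b = b' \<Longrightarrow> c = c' \<Longrightarrow> d = d' \<Longrightarrow> a = a'"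
      using s by auto
    consider "a = a'" "b = b'" "c = c'" "d = d'" | "(a, a') \<in> near_pairs H A" "(b, b') \<in> near_pairs H B" "(c, c') \<in> near_pairs H C" "(d, d') \<in> near_pairs H D" | "(a, a') \<in> near_pairs H A" "(b, b') \<in> near_pairs H B" "(c, c') \<in> near_pairs H C" "d = d'"
      | "(a, a') \<in> near_pairs H A" "(b, b') \<in> near_pairs H B" "c = c'" "(d, d') \<in> near_pairs H D"
      | "(a, a') \<in> near_pairs H A" "b = b'" "(c, c') \<in> near_pairs H C" "(d, d') \<in> near_pairs H D"
      | "a = a'" "(b, b') \<in> near_pairs H B" "(c, c') \<in> near_pairs H C" "(d, d') \<in> near_pairs H D"
      | "(a, a') \<in> near_pairs H A" "(b, b') \<in> near_pairs H B" "c = c'" "d = d'"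
      | "(a, a') \<in> near_pairs H A" "b = b'" "(c, c') \<in> near_pairs H C" "d = d'"
      | "(a, a') \<in> near_pairs H A" "b = b'" "c = c'" "(d, d') \<in> near_pairs H D"
      | "a = a'" "(b, b') \<in> near_pairs H B" "(c, c') \<in> near_pairs H C" "d = d'"
      | "a = a'" "(b, b') \<in> near_pairs H B" "c = c'" "(d, d') \<in> near_pairs H D"
      | "a = a'" "b = b'" "(c, c') \<in> near_pairs H C" "(d, d') \<in> near_pairs H D"
      using near three by argo
    then show "x \<in> ?U"
      by cases (use same diff c1 c2 c3 c4 c5 c6 c7 c8 c9 c10 in \<open>simp_all only: Un_iff simp_thms\<close>)
  qed
  then have "card ?S \<le> card ?U" using fU by (intro card_mono)
  also have "\<dots> \<le> card P + card (near4 H A B C D) + card (deg1 H Z A B C D) + 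
     card (deg1 H Z A B D C) + card (deg1 H Z A C D B) + card (deg1 H Z B C D A) + 
     card (deg2 H Z A B C D) + card (deg2 H Z A C B D) + card (deg2 H Z A D B C) + 
     card (deg2 H Z B C A D) + card (deg2 H Z B D A C) + card (deg2 H Z C D A B)"
    by (intro card_Un_le_add card_image_le fP finite_near4 finite_deg1 finite_deg2 fin)
  finally show ?thesis by (simp only: coll_def)
qed

lemma sums_4_ineq:
  assumes A: "cvx2 A" "cvx2 B" "cvx2 C" "cvx2 D" and c: "card A = N" "card B = N" "card C = N" "card D = N"
    and e: "\<And>X h. X \<in> {A, B, C, D} \<Longrightarrow> h \<noteq> 0 \<Longrightarrow> real (diff_energy (gaps X h)) \<le> e"
    and H: "1 \<le> H" "H \<le> N" and Z: "finite Z" and X: "X = real (card {p \<in> A \<times> B \<times> C \<times> D. sum4 p \<in> Z})"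
  shows "X\<^sup>2 \<le> real (card Z) * (3 * real N / real H) ^ 3 *
    (X + (16 * real H ^ 4 * e + 32 * real H ^ 3 * cbrt (576 * real N ^ 5) * min (real N) (real (card Z))
       + 24 * real H ^ 2 * real N * min (real N ^ 2) (cbrt (576 * real N ^ 3 * real (card Z) ^ 2))))"
proof -
  define P where "P = {p \<in> A \<times> B \<times> C \<times> D. sum4 p \<in> Z}"
  have cv: "cvx A" "cvx B" "cvx C" "cvx D" using A by (auto simp: cvx2_def)
  have fin: "finite A" "finite B" "finite C" "finite D" using cv cvx_finite by auto
  have fP: "finite P" and PA: "P \<subseteq> A \<times> B \<times> C \<times> D" and PZ: "sum4 ` P \<subseteq> Z" using fin by (auto simp: P_def)
  let ?M = "(2 * ((N - 1) div H) + 1) ^ 3"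
  let ?G = "16 * real H ^ 4 * e + 32 * real H ^ 3 * cbrt (576 * real N ^ 5) * min (real N) (real (card Z))
       + 24 * real H ^ 2 * real N * min (real N ^ 2) (cbrt (576 * real N ^ 3 * real (card Z) ^ 2))"
  have "real (card (near4 H A B C D)) \<le> (2 * real H) ^ 4 * e"
    by (intro card_near4_le cv card_zero_sums_4_le gaps_finite_card fin e) auto
  then have n4: "real (card (near4 H A B C D)) \<le> 16 * real H ^ 4 * e" by (simp add: power_mult_distrib)
  let ?x = "8 * real H ^ 3 * cbrt (576 * real N ^ 5) * min (real N) (real (card Z))"
  let ?y = "4 * real H ^ 2 * real N * min (real N ^ 2) (cbrt (576 * real N ^ 3 * real (card Z) ^ 2))"
  have d1: "real (card (deg1 H Z A B C D)) \<le> ?x" "real (card (deg1 H Z A B D C)) \<le> ?x"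
    "real (card (deg1 H Z A C D B)) \<le> ?x" "real (card (deg1 H Z B C D A)) \<le> ?x"
    by (intro card_deg1_le A c fin Z)+
  have d2: "real (card (deg2 H Z A B C D)) \<le> ?y" "real (card (deg2 H Z A C B D)) \<le> ?y"
    "real (card (deg2 H Z A D B C)) \<le> ?y" "real (card (deg2 H Z B C A D)) \<le> ?y"
    "real (card (deg2 H Z B D A C)) \<le> ?y" "real (card (deg2 H Z C D A B)) \<le> ?y"
    by (intro card_deg2_le cv c Z)+
  have "real (coll (\<lambda>p. (sum4 p, box4 H A B C D p)) P) \<le> real (card P) + real (card (near4 H A B C D))
     + (real (card (deg1 H Z A B C D)) + real (card (deg1 H Z A B D C)) + real (card (deg1 H Z A C D B)) + real (card (deg1 H Z B C D A)))
     + (real (card (deg2 H Z A B C D)) + real (card (deg2 H Z A C B D)) + real (card (deg2 H Z A D B C))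
      + real (card (deg2 H Z B C A D)) + real (card (deg2 H Z B D A C)) + real (card (deg2 H Z C D A B)))"
    using of_nat_mono[OF coll_box4_le[OF fin H(1) PA PZ], where 'a=real] by simp
  also have "\<dots> \<le> real (card P) + 16 * real H ^ 4 * e + (?x + ?x + ?x + ?x) + (?y + ?y + ?y + ?y + ?y + ?y)"
    by (intro add_mono n4 d1 d2 order.refl)
  also have "\<dots> = X + ?G" by (simp add: X P_def)
  finally have G: "real (coll (\<lambda>p. (sum4 p, box4 H A B C D p)) P) \<le> X + ?G" .
  have "coll sum4 P \<le> ?M * coll (\<lambda>p. (sum4 p, box4 H A B C D p)) P"
    by (rule coll_le_boxes[OF fP]) (use card_box_differences_4[OF fin c PA] in \<open>simp add: box4_def\<close>)
  then have "(card P)\<^sup>2 \<le> card Z * (?M * coll (\<lambda>p. (sum4 p, box4 H A B C D p)) P)"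
    using card_square_le_coll[OF fP Z PZ] by (meson le_trans mult_le_mono2)
  then have "real ((card P)\<^sup>2) \<le> real (card Z * (?M * coll (\<lambda>p. (sum4 p, box4 H A B C D p)) P))"
    by (simp only: of_nat_le_iff)
  then have "X\<^sup>2 \<le> real (card Z) * ((real (2 * ((N - 1) div H) + 1)) ^ 3 * real (coll (\<lambda>p. (sum4 p, box4 H A B C D p)) P))"
    unfolding X P_def[symmetric] by (simp only: of_nat_mult of_nat_power)
  also have "\<dots> \<le> real (card Z) * ((3 * real N / real H) ^ 3 * (X + ?G))"
    using G by (intro mult_left_mono mult_mono power_mono card_boxes_real H) auto
  finally show ?thesis by (simp add: mult.assoc)
qed

text \<open>With \<open>H^3\<close> about \<open>N^3 * |Z| / X\<close>, the relations in all four
  coordinates give \<open>X^(7/3) \<le> N^(4 + 32/13) * |Z|^(4/3)\<close>, which is the claim up to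
  logarithms. The degenerate relations stay below it by interpolating the minima:
  \<open>m1 \<le> N^(6/7) * |Z|^(1/7)\<close> and, up to a constant,
  \<open>m2 \<le> N^(11/7) * |Z|^(2/7)\<close>.\<close>

lemma sums_4_ln_le:
  assumes A: "cvx2 A" "cvx2 B" "cvx2 C" "cvx2 D" and c: "card A = N" "card B = N" "card C = N" "card D = N"
    and Z: "finite Z" and X: "X = real (card {p \<in> A \<times> B \<times> C \<times> D. sum4 p \<in> Z})" "X > 0"
  shows "ln X \<le> 10000 + 10 * loglog N + 36 / 13 * ln (real N) + 4 / 7 * ln (real (card Z))"
proof -
  define P where "P = {p \<in> A \<times> B \<times> C \<times> D. sum4 p \<in> Z}"
  have fin: "finite A" "finite B" "finite C" "finite D" using A cvx_finite by (auto simp: cvx2_def)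
  have "card P \<noteq> 0" using X unfolding P_def by simp
  then have "P \<noteq> {}" by auto
  then have "A \<noteq> {}" "Z \<noteq> {}" by (auto simp: P_def)
  then have N1: "N \<ge> 1" and z1: "card Z \<ge> 1" using c fin Z by (auto simp: Suc_le_eq card_gt_0_iff)
  let ?z = "real (card Z)"
  have zp: "?z > 0" "?z \<ge> 1" using z1 by auto
  have X4: "X \<le> real N ^ 4"
  proof -
    have "card P \<le> card (A \<times> B \<times> C \<times> D)" using fin by (intro card_mono) (auto simp: P_def)
    then have "real (card P) \<le> real (N * (N * (N * N)))" unfolding card_cartesian_product c of_nat_le_iff .
    then show ?thesis by (simp add: X(1) P_def eval_nat_numeral)
  qed
  have X3: "X \<le> ?z * real N ^ 3"
  proof -
    have "card P \<le> card (Z \<times> A \<times> B \<times> C)"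
      by (rule card_inj_on_le[of "\<lambda>p. (sum4 p, fst p, fst (snd p), fst (snd (snd p)))"])
         (use fin Z in \<open>auto simp: P_def sum4_def inj_on_def\<close>)
    then have "real (card P) \<le> real (card Z * (N * (N * N)))" unfolding card_cartesian_product c of_nat_le_iff .
    then show ?thesis by (simp add: X(1) P_def power3_eq_cube)
  qed
  have n0: "ln (real N) \<ge> 0" using N1 by simp
  have l0: "loglog N \<ge> 0" by (rule loglog_nonneg[OF N1])
  have z0: "ln ?z \<ge> 0" using zp by simp
  show ?thesis
  proof (cases "X < 54 * ?z")
    case True
    have "ln X \<le> ln (54 * ?z)" using True X zp by (subst ln_le_cancel_iff) auto
    then have 1: "ln X \<le> ln 54 + ln ?z" using zp by (simp add: ln_mult)
    have "ln X \<le> ln (real N ^ 4)" using X4 X N1 by (subst ln_le_cancel_iff) auto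
    then have 2: "ln X \<le> 4 * ln (real N)" using N1 by (simp add: ln_realpow)
    show ?thesis using 1 2 n0 l0 ln_le_self[of 54, simplified] by linarith
  next
    case False
    \<comment> \<open>The energy bound for convex sets, monotone in the cardinality, applied to sets
      of at most \<open>N\<close> differences. In exponential form it also covers an empty set of
      differences.\<close>
    define e where "e = exp (5000 + 10 * loglog N + 32 / 13 * ln (real N))"
    have e: "real (diff_energy (gaps Y h)) \<le> e" if "Y \<in> {A, B, C, D}" "h \<noteq> 0" for Y h
    proof (cases "diff_energy (gaps Y h) = 0")
      case False
      have Y: "cvx (gaps Y h)" "card (gaps Y h) \<le> N"
        using that A c gaps_finite_card(2)[of Y h] fin by (auto simp: cvx2_def)
      have ne: "gaps Y h \<noteq> {}" using False by (auto simp: diff_energy_def coll_def)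
      then have c1: "card (gaps Y h) \<ge> 1" using Y cvx_finite by (auto simp: Suc_le_eq card_gt_0_iff)
      have "ln (real (diff_energy (gaps Y h))) \<le> 5000 + 10 * loglog (card (gaps Y h)) + 32 / 13 * ln (real (card (gaps Y h)))"
        by (rule cvx_ln_diff_energy_le[OF Y(1) ne])
      also have "\<dots> \<le> 5000 + 10 * loglog N + 32 / 13 * ln (real N)"
        using c1 Y(2) loglog_mono[OF c1 Y(2)] by (intro add_mono mult_left_mono order.refl) auto
      finally have "exp (ln (real (diff_energy (gaps Y h)))) \<le> e" unfolding e_def by simp
      then show ?thesis using False by simp
    qed (simp add: e_def)
    \<comment> \<open>The side for which \<open>|Z| * (3 * N / y)^3 = X / 2\<close>; it is at most
      \<open>N\<close> because \<open>X \<ge> 54 * |Z|\<close>.\<close>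
    define y where "y = real N * cbrt (54 * ?z / X)"
    have thr3: "cbrt x ^ 3 = x" if "x > 0" for x
      using that by (simp add: cbrt_def powr_powr flip: powr_realpow)
    have y3: "y ^ 3 = 54 * ?z * real N ^ 3 / X"
      using X zp by (simp add: y_def power_mult_distrib thr3)
    have yp: "y > 0" using X zp N1 by (auto simp: y_def intro!: mult_pos_pos cbrt_pos)
    have "1 ^ 3 \<le> y ^ 3" unfolding y3 using X3 X zp by (simp add: field_simps)
    then have y1: "1 \<le> y" using yp by (subst (asm) power_mono_iff) auto
    have "y ^ 3 \<le> real N ^ 3" unfolding y3 using False X N1 by (simp add: field_simps)
    then have yN: "y \<le> real N" using yp by (subst (asm) power_mono_iff) auto
    obtain H where H: "1 \<le> H" "H \<le> N" "y \<le> real H" "real H \<le> 2 * y"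
      using ex_nat_between[OF y1 yN] .
    define m1 where "m1 = min (real N) ?z"
    define m2 where "m2 = min (real N ^ 2) (cbrt (576 * real N ^ 3 * ?z ^ 2))"
    define b where "b = cbrt (576 * real N ^ 5)"
    have Np: "real N > 0" "real H > 0" using N1 H by auto
    have pos: "m1 > 0" "m2 > 0" "b > 0" "e > 0"
      using N1 zp by (auto simp: m1_def m2_def b_def e_def intro!: cbrt_pos)
    define G where "G = 16 * real H ^ 4 * e + 32 * real H ^ 3 * b * m1 + 24 * real H ^ 2 * real N * m2"
    have "X\<^sup>2 \<le> ?z * (3 * real N / real H) ^ 3 * (X + G)"
      unfolding G_def b_def m1_def m2_def by (rule sums_4_ineq[OF A c e H(1,2) Z X(1)]) auto
    also have "\<dots> \<le> (X / 2) * (X + G)"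
    proof (rule mult_right_mono)
      have "?z * (3 * real N / real H) ^ 3 \<le> ?z * (3 * real N / y) ^ 3"
        using H y1 by (intro mult_left_mono power_mono divide_left_mono) auto
      also have "\<dots> = X / 2" unfolding power_divide y3 using X zp N1 by (simp add: power_mult_distrib field_simps)
      finally show "?z * (3 * real N / real H) ^ 3 \<le> X / 2" .
      show "0 \<le> X + G" using X pos by (simp add: G_def)
    qed
    finally have "X * X \<le> X * ((X + G) / 2)" by (simp add: power2_eq_square)
    then have XG: "X \<le> G" using X(2) by simp
    have "ln (real H) \<le> ln (2 * y)" using H y1 by (subst ln_le_cancel_iff) auto
    also have "\<dots> = ln 2 + ln (real N) + ln 54 / 3 + ln ?z / 3 - ln X / 3"
      using X zp N1 cbrt_pos[of "54 * ?z / X"]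
      by (simp add: y_def ln_mult ln_cbrt ln_div add_divide_distrib diff_divide_distrib)
    finally have lnH: "ln (real H) \<le> 20 + ln (real N) + ln ?z / 3 - ln X / 3"
      using ln_le_self[of 2, simplified] ln_le_self[of 54, simplified] by linarith
    have lne: "ln e = 5000 + 10 * loglog N + 32 / 13 * ln (real N)" by (simp add: e_def)
    have lnb: "ln b = ln 576 / 3 + 5 * ln (real N) / 3"
      using Np by (simp add: b_def ln_cbrt ln_mult ln_realpow add_divide_distrib)
    have lnm1: "ln m1 \<le> ln (real N)" "ln m1 \<le> ln ?z"
      using pos(1) Np zp by (auto simp: m1_def)
    have "ln m2 \<le> ln (real N ^ 2)" "ln m2 \<le> ln (cbrt (576 * real N ^ 3 * ?z ^ 2))"
      using pos(2) Np zp by (auto simp: m2_def cbrt_pos simp del: ln_realpow)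
    then have lnm2: "ln m2 \<le> 2 * ln (real N)" "ln m2 \<le> ln 576 / 3 + ln (real N) + 2 * ln ?z / 3"
      using Np zp by (simp_all add: ln_cbrt ln_mult ln_realpow add_divide_distrib)
    consider "X \<le> 48 * real H ^ 4 * e" | "X \<le> 96 * real H ^ 3 * b * m1" | "X \<le> 72 * real H ^ 2 * real N * m2"
      using XG unfolding G_def by linarith
    then show ?thesis
    proof cases
      case 1
      have "ln X \<le> ln (48 * real H ^ 4 * e)"
        using 1 X Np pos by (subst ln_le_cancel_iff) auto
      also have "\<dots> = ln 48 + 4 * ln (real H) + ln e"
        using Np pos by (simp add: ln_mult ln_realpow)
      finally show ?thesis
        using lnH lne l0 z0 n0 ln_le_self[of 48, simplified] by linarith
    next
      case 2
      have "ln X \<le> ln (96 * real H ^ 3 * b * m1)"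
        using 2 X Np pos by (subst ln_le_cancel_iff) auto
      also have "\<dots> = ln 96 + 3 * ln (real H) + ln b + ln m1"
        using Np pos by (simp add: ln_mult ln_realpow)
      finally show ?thesis
        using lnH lnb lnm1 l0 z0 n0 ln_le_self[of 96, simplified] ln_le_self[of 576, simplified] by linarith
    next
      case 3
      have "ln X \<le> ln (72 * real H ^ 2 * real N * m2)"
        using 3 X Np pos by (subst ln_le_cancel_iff) auto
      also have "\<dots> = ln 72 + 2 * ln (real H) + ln (real N) + ln m2"
        using Np pos by (simp add: ln_mult ln_realpow)
      finally show ?thesis
        using lnH lnm2 l0 z0 n0 ln_le_self[of 72, simplified] ln_le_self[of 576, simplified] by linarith
    qed
  qed
qed

section \<open>Representations of the form \<open>a + b - c - d\<close>\<close>

definition four_reps :: "real set \<Rightarrow> real set \<Rightarrow> nat" where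
  "four_reps A Z = card {p \<in> A \<times> A \<times> (uminus ` A) \<times> (uminus ` A). sum4 p \<in> Z}"

lemma ln_four_reps_le:
  assumes A: "cvx2 A" and Z: "finite Z" and X: "0 < X" "X \<le> real (four_reps A Z)"
  shows "ln X \<le> 10000 + 10 * loglog (card A) + 36 / 13 * ln (real (card A)) + 4 / 7 * ln (real (card Z))"
proof -
  have "card (uminus ` A) = card A" by (simp add: card_image)
  then have "ln (real (four_reps A Z)) \<le> 10000 + 10 * loglog (card A) + 36 / 13 * ln (real (card A)) + 4 / 7 * ln (real (card Z))"
    using X by (intro sums_4_ln_le[OF A A cvx2_uminus[OF A] cvx2_uminus[OF A] refl refl _ _ Z]) (auto simp: four_reps_def)
  moreover have "ln X \<le> ln (real (four_reps A Z))" using X by (subst ln_le_cancel_iff) auto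
  ultimately show ?thesis by linarith
qed

text \<open>The last summand is moved to the side of \<open>Z\<close>: \<open>a + b - c\<close> must
  equal a sum in \<open>A + Z\<close>. Pigeonholing on the number of representations in
  \<open>A + Z\<close> leaves a set \<open>W\<close> of level \<open>\<kappa>\<close>, and the bound
  for three summands applies to \<open>W\<close>. Since \<open>W\<close> is small when
  \<open>\<kappa>\<close> is large, this uses the energy of no set of differences.\<close>

lemma ln_four_reps_le':
  assumes A: "cvx2 A" and Z: "finite Z" and X: "0 < X" "X \<le> real (four_reps A Z)"
  shows "ln X \<le> 10000 + loglog (card A) + 37 / 15 * ln (real (card A)) + 4 / 5 * ln (real (card Z)) \<or>
    ln X \<le> 10000 + loglog (card A) + 5 / 2 * ln (real (card A)) + 3 / 4 * ln (real (card Z))"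
proof -
  let ?N = "card A" and ?B = "uminus ` A"
  have cA: "cvx A" using A by (simp add: cvx2_def)
  have fA: "finite A" using cA by (rule cvx_finite)
  have cB: "card ?B = ?N" by (simp add: card_image)
  define g where "g = (\<lambda>w. card {p \<in> A \<times> Z. fst p + snd p = w})"
  define T where "T = {t \<in> A \<times> A \<times> ?B. 1 \<le> g (sum3 t)}"
  have fT: "finite T" using fA by (simp add: T_def)
  have gN: "g w \<le> ?N" for w
    unfolding g_def by (rule card_inj_on_le[of fst]) (use fA in \<open>auto simp: inj_on_def\<close>)
  let ?S = "{p \<in> A \<times> A \<times> ?B \<times> ?B. sum4 p \<in> Z}"
  have fg: "finite {p \<in> A \<times> Z. fst p + snd p = w}" for w using fA Z by simp
  have "four_reps A Z \<le> card (SIGMA t:T. {p \<in> A \<times> Z. fst p + snd p = sum3 t})"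
    unfolding four_reps_def
  proof (rule card_inj_on_le[of "\<lambda>p. ((fst p, fst (snd p), fst (snd (snd p))), (- snd (snd (snd p)), sum4 p))"])
    show "(\<lambda>p. ((fst p, fst (snd p), fst (snd (snd p))), (- snd (snd (snd p)), sum4 p))) ` ?S
       \<subseteq> (SIGMA t:T. {p \<in> A \<times> Z. fst p + snd p = sum3 t})"
    proof (rule image_subsetI)
      fix x assume x: "x \<in> ?S"
      obtain a b c d where xx: "x = (a, b, c, d)" by (metis surj_pair)
      have m: "a \<in> A" "b \<in> A" "c \<in> ?B" "- d \<in> A" "a + b + c + d \<in> Z" using x by (auto simp: xx sum4_def)
      then have q: "(- d, a + b + c + d) \<in> {p \<in> A \<times> Z. fst p + snd p = sum3 (a, b, c)}" by (simp add: sum3_def)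
      then have "g (sum3 (a, b, c)) > 0" unfolding g_def card_gt_0_iff using fg by blast
      then show "((fst x, fst (snd x), fst (snd (snd x))), (- snd (snd (snd x)), sum4 x))
         \<in> (SIGMA t:T. {p \<in> A \<times> Z. fst p + snd p = sum3 t})"
        using m q by (simp add: xx T_def sum4_def Suc_le_eq)
    qed
    show "finite (SIGMA t:T. {p \<in> A \<times> Z. fst p + snd p = sum3 t})" using fT fg by (intro finite_SigmaI) auto
  qed (auto simp: inj_on_def)
  also have "\<dots> = (\<Sum>t\<in>T. g (sum3 t))" using fT fg by (simp add: card_SigmaI g_def)
  finally have 1: "real (four_reps A Z) \<le> (\<Sum>t\<in>T. real (g (sum3 t)))"
    by (simp only: of_nat_sum[symmetric] of_nat_le_iff)
  have "\<exists>k. (\<Sum>t\<in>T. real (g (sum3 t))) \<le> real (dyadic_levels ?N) *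
     (\<Sum>t | t \<in> T \<and> 2 ^ k \<le> g (sum3 t) \<and> g (sum3 t) < 2 ^ Suc k. real (g (sum3 t)))"
    by (rule dyadic_pigeonhole) (use fT gN in \<open>auto simp: T_def\<close>)
  then obtain k where k: "(\<Sum>t\<in>T. real (g (sum3 t))) \<le> real (dyadic_levels ?N) *
     (\<Sum>t | t \<in> T \<and> 2 ^ k \<le> g (sum3 t) \<and> g (sum3 t) < 2 ^ Suc k. real (g (sum3 t)))" by blast
  define W where "W = {w \<in> (\<lambda>p. fst p + snd p) ` (A \<times> Z). 2 ^ k \<le> g w \<and> g w < 2 ^ Suc k}"
  define \<kappa> :: real where "\<kappa> = 2 ^ k"
  have \<kappa>: "\<kappa> \<ge> 1" by (simp add: \<kappa>_def)
  have fW: "finite W" using fA Z by (simp add: W_def)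
  have gW: "\<kappa> \<le> real (g w)" "real (g w) \<le> 2 * \<kappa>" if "2 ^ k \<le> g w" "g w < 2 ^ Suc k" for w
  proof -
    have "2 ^ k \<le> g w" "g w \<le> 2 * 2 ^ k" using that by auto
    then have "real (2 ^ k) \<le> real (g w)" "real (g w) \<le> real (2 * 2 ^ k)" by (simp_all only: of_nat_le_iff)
    then show "\<kappa> \<le> real (g w)" "real (g w) \<le> 2 * \<kappa>" by (auto simp: \<kappa>_def)
  qed
  define Y where "Y = real (card {p \<in> A \<times> A \<times> ?B. sum3 p \<in> W})"
  have "(\<Sum>t | t \<in> T \<and> 2 ^ k \<le> g (sum3 t) \<and> g (sum3 t) < 2 ^ Suc k. real (g (sum3 t)))
     \<le> (\<Sum>t | t \<in> T \<and> 2 ^ k \<le> g (sum3 t) \<and> g (sum3 t) < 2 ^ Suc k. 2 * \<kappa>)"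
    by (intro sum_mono) (use gW in auto)
  also have "\<dots> = real (card {t. t \<in> T \<and> 2 ^ k \<le> g (sum3 t) \<and> g (sum3 t) < 2 ^ Suc k}) * (2 * \<kappa>)" by simp
  also have "\<dots> \<le> Y * (2 * \<kappa>)"
  proof (intro mult_right_mono)
    have "{t. t \<in> T \<and> 2 ^ k \<le> g (sum3 t) \<and> g (sum3 t) < 2 ^ Suc k} \<subseteq> {p \<in> A \<times> A \<times> ?B. sum3 p \<in> W}"
    proof
      fix t assume t: "t \<in> {t. t \<in> T \<and> 2 ^ k \<le> g (sum3 t) \<and> g (sum3 t) < 2 ^ Suc k}"
      then have "g (sum3 t) > 0" by (simp add: T_def)
      then have "sum3 t \<in> (\<lambda>p. fst p + snd p) ` (A \<times> Z)" unfolding g_def card_gt_0_iff by force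
      then show "t \<in> {p \<in> A \<times> A \<times> ?B. sum3 p \<in> W}" using t by (simp add: W_def T_def)
    qed
    then show "real (card {t. t \<in> T \<and> 2 ^ k \<le> g (sum3 t) \<and> g (sum3 t) < 2 ^ Suc k}) \<le> Y"
      unfolding Y_def of_nat_le_iff by (rule card_mono[rotated]) (use fA in simp)
  qed (use \<kappa> in simp)
  finally have 2: "X \<le> real (dyadic_levels ?N) * (Y * (2 * \<kappa>))"
    using X(2) 1 k by (meson mult_left_mono of_nat_0_le_iff order_trans)
  have Yp: "Y > 0" using 2 X by (cases "Y = 0") (auto simp: Y_def)
  have "card {p \<in> A \<times> A \<times> ?B. sum3 p \<in> W} \<noteq> 0" using Yp unfolding Y_def by simp
  then have "{p \<in> A \<times> A \<times> ?B. sum3 p \<in> W} \<noteq> {}" by (metis card.empty)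
  then have ne: "A \<noteq> {}" "W \<noteq> {}" by auto
  then have "Z \<noteq> {}" by (auto simp: W_def)
  then have cp: "?N \<ge> 1" "real ?N > 0" "real (card Z) > 0" "real (card W) > 0"
    using ne fA Z fW by (auto simp: Suc_le_eq card_gt_0_iff)
  have nlp: "real (dyadic_levels ?N) > 0" using dyadic_levels_le(1)[OF cp(1)] by linarith
  have "ln X \<le> ln (real (dyadic_levels ?N) * (Y * (2 * \<kappa>)))"
    using 2 X Yp \<kappa> nlp by (subst ln_le_cancel_iff) auto
  also have "\<dots> = ln (real (dyadic_levels ?N)) + ln Y + ln 2 + ln \<kappa>"
    using Yp \<kappa> nlp by (simp add: ln_mult)
  finally have 3: "ln X \<le> loglog ?N + ln Y + 2 + ln \<kappa>"
    using ln_dyadic_levels_le[OF cp(1)] ln_le_self[of 2, simplified] by linarith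
  have pop: "\<kappa> \<le> real (card {p \<in> A \<times> Z. fst p + snd p = w})" if "w \<in> W" for w
    using gW(1)[of w] that by (simp add: W_def g_def)
  have "real (card W) * \<kappa> \<le> (\<Sum>w\<in>W. real (card {p \<in> A \<times> Z. fst p + snd p = w}))"
    using sum_mono[of W "\<lambda>_. \<kappa>", OF pop] by simp
  also have "\<dots> \<le> real (card (A \<times> Z))"
    by (subst card_eq_sum_fibres[of "A \<times> Z" "(\<lambda>p. fst p + snd p) ` (A \<times> Z)" "\<lambda>p. fst p + snd p"])
       (use fA Z in \<open>auto simp: W_def intro!: sum_mono2\<close>)
  finally have "ln (real (card W) * \<kappa>) \<le> ln (real ?N * real (card Z))"
    using cp \<kappa> by (subst ln_le_cancel_iff) (auto simp: card_cartesian_product)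
  then have 4: "ln (real (card W)) + ln \<kappa> \<le> ln (real ?N) + ln (real (card Z))"
    using cp \<kappa> by (simp add: ln_mult)
  have "ln (real (card W) * \<kappa> ^ 3) \<le> ln (576 * real ?N * real (card Z) ^ 2)"
    using card_popular_sums_le[OF cA Z fW _ pop] cp \<kappa> by (subst ln_le_cancel_iff) auto
  then have 5: "ln (real (card W)) + 3 * ln \<kappa> \<le> ln 576 + ln (real ?N) + 2 * ln (real (card Z))"
    using cp \<kappa> by (simp add: ln_mult ln_realpow)
  have "ln Y \<le> 5000 + 28 / 15 * ln (real ?N) + 3 / 5 * ln (real (card W)) \<or>
     ln Y \<le> 5000 + 2 * ln (real ?N) + 1 / 2 * ln (real (card W))"
    by (rule sums_3_ln_le[OF A A cvx2_uminus[OF A] refl refl cB fW Y_def Yp])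
  \<comment> \<open>Besides \<open>X \<le> Y * \<kappa>\<close>, up to logarithms, one has
    \<open>|W| * \<kappa> \<le> N * |Z|\<close> and \<open>|W| * \<kappa>^3 \<le> N * |Z|^2\<close>.
    Powers 2/5 and 1/5 of these combine to \<open>|W|^(3/5) * \<kappa>\<close>, powers 1/4 and 1/4
    to \<open>|W|^(1/2) * \<kappa>\<close>.\<close>
  then show ?thesis
  proof
    assume "ln Y \<le> 5000 + 28 / 15 * ln (real ?N) + 3 / 5 * ln (real (card W))"
    then have "ln X \<le> 10000 + loglog (card A) + 37 / 15 * ln (real (card A)) + 4 / 5 * ln (real (card Z))"
      using 3 4 5 ln_le_self[of 576, simplified] by linarith
    then show ?thesis ..
  next
    assume "ln Y \<le> 5000 + 2 * ln (real ?N) + 1 / 2 * ln (real (card W))"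
    then have "ln X \<le> 10000 + loglog (card A) + 5 / 2 * ln (real (card A)) + 3 / 4 * ln (real (card Z))"
      using 3 4 5 ln_le_self[of 576, simplified] by linarith
    then show ?thesis ..
  qed
qed

subsection \<open>Differences, sums and energy\<close>

lemma popular_pairs_le_four_reps:
  assumes A: "finite A" and P: "finite P" and D: "D \<ge> 0" "\<And>x. x \<in> P \<Longrightarrow> D \<le> real (diff_rep A x)"
  shows "D\<^sup>2 * real (card {p \<in> P \<times> P. fst p + snd p \<in> W}) \<le> real (four_reps A W)"
proof -
  let ?T = "{p \<in> P \<times> P. fst p + snd p \<in> W}"
  let ?R = "\<lambda>x. {p \<in> A \<times> A. fst p - snd p = x}"
  have fT: "finite ?T" using P by simp
  have fR: "finite (?R x)" for x using A by simp
  have "D\<^sup>2 * real (card ?T) = (\<Sum>t\<in>?T. D * D)" by (simp add: power2_eq_square mult.commute)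
  also have "\<dots> \<le> (\<Sum>t\<in>?T. real (card (?R (fst t) \<times> ?R (snd t))))"
    unfolding card_cartesian_product of_nat_mult diff_rep_def[symmetric]
    by (intro sum_mono mult_mono D) (use D in auto)
  also have "\<dots> = real (card (SIGMA t:?T. ?R (fst t) \<times> ?R (snd t)))"
    using fT fR by (subst card_SigmaI) auto
  also have "card (SIGMA t:?T. ?R (fst t) \<times> ?R (snd t)) \<le> four_reps A W"
    unfolding four_reps_def
  proof (rule card_inj_on_le[of "\<lambda>(t, p, q). (fst p, fst q, - snd p, - snd q)"])
    show "inj_on (\<lambda>(t, p, q). (fst p, fst q, - snd p, - snd q)) (SIGMA t:?T. ?R (fst t) \<times> ?R (snd t))"
      by (rule inj_onI) (auto simp: prod_eq_iff)
    show "(\<lambda>(t, p, q). (fst p, fst q, - snd p, - snd q)) ` (SIGMA t:?T. ?R (fst t) \<times> ?R (snd t))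
      \<subseteq> {p \<in> A \<times> A \<times> uminus ` A \<times> uminus ` A. sum4 p \<in> W}"
      by (auto simp: sum4_def algebra_simps)
  qed (use A in simp)
  finally show ?thesis by simp
qed

lemma sum_unpopular_le:
  assumes A: "finite A" and Y: "finite Y" "f ` P \<subseteq> Y" "finite P" and \<theta>: "\<theta> \<ge> 0"
  shows "real (card {p \<in> P. real (card {q \<in> P. f q = f p}) < \<theta>}) \<le> \<theta> * real (card Y)"
proof -
  let ?B = "{p \<in> P. real (card {q \<in> P. f q = f p}) < \<theta>}"
  have "real (card ?B) = (\<Sum>y\<in>Y. real (card {p \<in> ?B. f p = y}))"
    by (subst card_eq_sum_fibres[of ?B Y f]) (use Y in auto)
  also have "\<dots> \<le> (\<Sum>y\<in>Y. \<theta>)"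
  proof (rule sum_mono)
    fix y
    show "real (card {p \<in> ?B. f p = y}) \<le> \<theta>"
    proof (cases "{p \<in> ?B. f p = y} = {}")
      case False
      then obtain p where "p \<in> P" "f p = y" "real (card {q \<in> P. f q = y}) < \<theta>" by auto
      moreover have "card {p \<in> ?B. f p = y} \<le> card {q \<in> P. f q = y}"
        using Y by (intro card_mono) auto
      ultimately show ?thesis by linarith
    next
      case True
      show ?thesis unfolding True using \<theta> by simp
    qed
  qed
  finally show ?thesis by (simp add: mult.commute)
qed

text \<open>A positive proportion of the triples in \<open>A\<close> have all three differences
  popular. Cauchy-Schwarz with the third energy yields, up to logarithms, at least
  \<open>N^3\<close> pairs of popular differences with popular sum. Each of them accounts for
  \<open>\<Delta>^2\<close> representations \<open>a + b - c - d\<close> of an element of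
  \<open>W\<close>, which four-fold squeezing limits.\<close>

lemma cvx2_ln_diffset_ge:
  assumes A: "cvx2 A" "A \<noteq> {}"
  shows "385 / 234 * ln (real (card A)) \<le> 10000 + 10 * loglog (card A) + ln (real (card (diffset A)))"
proof -
  have cA: "cvx A" using A by (simp add: cvx2_def)
  have fA: "finite A" using cA by (rule cvx_finite)
  define N where "N = card A"
  let ?D = "diffset A"
  note fD = card_diffset_le(1)[OF fA]
  have N1: "N \<ge> 1" "real N > 0" using fA A by (auto simp: N_def Suc_le_eq card_gt_0_iff)
  obtain a0 where "a0 \<in> A" using A by blast
  then have "a0 - a0 \<in> ?D" unfolding diffset_def by blast
  then have "?D \<noteq> {}" by blast
  then have d: "real (card ?D) > 0" using fD by (simp add: card_gt_0_iff)
  \<comment> \<open>A quarter of the average number of representations: each of the three conditions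
    on a triple then fails for at most a quarter of all triples.\<close>
  define \<Delta> where "\<Delta> = real N ^ 2 / (4 * real (card ?D))"
  have \<Delta>: "\<Delta> > 0" using N1 d by (simp add: \<Delta>_def)
  define W where "W = {x \<in> ?D. \<Delta> \<le> real (diff_rep A x)}"
  have fW: "finite W" using fD by (simp add: W_def)
  define B where "B = {p \<in> A \<times> A. fst p - snd p \<notin> W}"
  have fB: "finite B" using fA by (simp add: B_def)
  have B: "real (card B) \<le> real N ^ 2 / 4"
  proof -
    have "B = {p \<in> A \<times> A. real (card {q \<in> A \<times> A. fst q - snd q = fst p - snd p}) < \<Delta>}"
      unfolding B_def W_def diff_rep_def diffset_def by force
    also have "real (card \<dots>) \<le> \<Delta> * real (card ?D)"
    proof (rule sum_unpopular_le[OF fA fD])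
      show "(\<lambda>q. fst q - snd q) ` (A \<times> A) \<subseteq> diffset A" by (force simp: diffset_def)
    qed (use fA \<Delta> in auto)
    finally show ?thesis using d by (simp add: \<Delta>_def)
  qed
  define F where "F = (\<lambda>(a, b, c). (a - b :: real, b - c :: real))"
  define T where "T = {(a, b, c). a \<in> A \<and> b \<in> A \<and> c \<in> A \<and> a - b \<in> W \<and> b - c \<in> W \<and> a - c \<in> W}"
  have TA: "T \<subseteq> A \<times> A \<times> A" by (auto simp: T_def)
  have fT: "finite T" using TA fA finite_subset by blast
  have "card (A \<times> A \<times> A) \<le> card (T \<union> (\<lambda>(p, c). (fst p, snd p, c)) ` (B \<times> A)
      \<union> (\<lambda>(p, c). (c, fst p, snd p)) ` (B \<times> A) \<union> (\<lambda>(p, c). (fst p, c, snd p)) ` (B \<times> A))"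
  proof (rule card_mono)
    show "A \<times> A \<times> A \<subseteq> T \<union> (\<lambda>(p, c). (fst p, snd p, c)) ` (B \<times> A)
      \<union> (\<lambda>(p, c). (c, fst p, snd p)) ` (B \<times> A) \<union> (\<lambda>(p, c). (fst p, c, snd p)) ` (B \<times> A)"
    proof
      fix x assume "x \<in> A \<times> A \<times> A"
      then obtain a b c where x: "x = (a, b, c)" "a \<in> A" "b \<in> A" "c \<in> A" by auto
      have 1: "x \<in> (\<lambda>(p, c). (fst p, snd p, c)) ` (B \<times> A)" if "a - b \<notin> W"
        using that x by (intro image_eqI[of _ _ "((a, b), c)"]) (auto simp: B_def)
      have 2: "x \<in> (\<lambda>(p, c). (c, fst p, snd p)) ` (B \<times> A)" if "b - c \<notin> W"
        using that x by (intro image_eqI[of _ _ "((b, c), a)"]) (auto simp: B_def)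
      have 3: "x \<in> (\<lambda>(p, c). (fst p, c, snd p)) ` (B \<times> A)" if "a - c \<notin> W"
        using that x by (intro image_eqI[of _ _ "((a, c), b)"]) (auto simp: B_def)
      have 4: "x \<in> T" if "a - b \<in> W" "b - c \<in> W" "a - c \<in> W" using that x by (auto simp: T_def)
      show "x \<in> T \<union> (\<lambda>(p, c). (fst p, snd p, c)) ` (B \<times> A)
        \<union> (\<lambda>(p, c). (c, fst p, snd p)) ` (B \<times> A) \<union> (\<lambda>(p, c). (fst p, c, snd p)) ` (B \<times> A)"
        using 1 2 3 4 unfolding Un_iff by blast
    qed
  qed (use fT fB fA in auto)
  also have "\<dots> \<le> card T + card (B \<times> A) + card (B \<times> A) + card (B \<times> A)"
    by (intro card_Un_le_add card_image_le order.refl) (use fB fA in auto)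
  finally have "real (card (A \<times> A \<times> A)) \<le> real (card T + card (B \<times> A) + card (B \<times> A) + card (B \<times> A))"
    by (simp only: of_nat_le_iff)
  then have "real N ^ 3 \<le> real (card T) + 3 * (real (card B) * real N)"
    by (simp add: card_cartesian_product N_def power3_eq_cube mult_ac)
  moreover have "real (card B) * real N \<le> real N ^ 2 / 4 * real N"
    by (intro mult_right_mono B) auto
  ultimately have T: "real N ^ 3 / 4 \<le> real (card T)" by (simp add: power2_eq_square power3_eq_cube)
  let ?Q = "{p \<in> W \<times> W. fst p + snd p \<in> W}"
  have fQ: "finite ?Q" using fW by simp
  have "(card T)\<^sup>2 \<le> card ?Q * coll F T"
    by (rule card_square_le_coll[OF fT fQ]) (auto simp: T_def F_def)
  also have "\<dots> \<le> card ?Q * triple_energy A"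
  proof (rule mult_le_mono2)
    show "coll F T \<le> triple_energy A" unfolding coll_def triple_energy_def F_def[symmetric]
      by (rule card_mono) (use fA TA in \<open>auto intro: finite_subset[of _ "(A \<times> A \<times> A) \<times> (A \<times> A \<times> A)"]\<close>)
  qed
  finally have TQ: "(real (card T))\<^sup>2 \<le> real (card ?Q) * real (triple_energy A)"
    by (rule real_square_le_mult)
  have T0: "0 < real N ^ 3 / 4" using N1 by simp
  then have Tp: "0 < real (card T)" using T by linarith
  then have Qp: "0 < real (card ?Q)" using TQ by (cases "card ?Q = 0") auto
  then have "?Q \<noteq> {}" by (metis card.empty of_nat_0 less_irrefl)
  then have "W \<noteq> {}" by blast
  then have Wp: "real (card W) > 0" using fW by (simp add: card_gt_0_iff)
  note triple_energy = ln_triple_energy_le[OF cA A(2)]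
  have "ln (real N ^ 3 / 4) \<le> ln (real (card T))" using T T0 Tp by (subst ln_le_cancel_iff) auto
  then have 1: "3 * ln (real N) - ln 4 \<le> ln (real (card T))" using N1 by (simp add: ln_div ln_realpow)
  have "ln ((real (card T))\<^sup>2) \<le> ln (real (card ?Q) * real (triple_energy A))"
    using TQ Tp Qp triple_energy(1) by (subst ln_le_cancel_iff) auto
  then have 2: "2 * ln (real (card T)) \<le> ln (real (card ?Q)) + ln (real (triple_energy A))"
    using Tp Qp triple_energy(1) by (simp add: ln_mult ln_realpow)
  have "ln (\<Delta>\<^sup>2 * real (card ?Q)) \<le> 10000 + 10 * loglog (card A) + 36 / 13 * ln (real (card A)) + 4 / 7 * ln (real (card W))"
    by (rule ln_four_reps_le[OF A(1) fW]) (use \<Delta> Qp popular_pairs_le_four_reps[OF fA fW, of \<Delta> W] in \<open>auto simp: W_def\<close>)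
  then have 3: "2 * ln \<Delta> + ln (real (card ?Q)) \<le> 10000 + 10 * loglog (card A) + 36 / 13 * ln (real (card A)) + 4 / 7 * ln (real (card W))"
    using \<Delta> Qp by (simp add: ln_mult ln_realpow)
  have 4: "ln \<Delta> = 2 * ln (real N) - ln 4 - ln (real (card ?D))"
    using N1 d by (simp add: \<Delta>_def ln_div ln_mult ln_realpow)
  have "card W \<le> card ?D" using fD by (intro card_mono) (auto simp: W_def)
  then have 5: "ln (real (card W)) \<le> ln (real (card ?D))" using Wp d by simp
  \<comment> \<open>For \<open>|A - A| = N^d\<close> the exponents satisfy
    \<open>2 * (2 - d) + 3 \<le> 36/13 + 4/7 * d\<close>, that is
    \<open>d \<ge> 385/234\<close>.\<close>
  show ?thesis
    using 1 2 3 4 5 triple_energy(2) ln_le_self[of 4, simplified] loglog_nonneg[OF N1(1)] unfolding N_def[symmetric] by linarith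
qed

section \<open>Lower bound for the sum set\<close>

lemma card_sumset_le:
  assumes "finite A" shows "finite (sumset A)" "(\<lambda>p. fst p + snd p) ` (A \<times> A) = sumset A"
proof -
  show "(\<lambda>p. fst p + snd p) ` (A \<times> A) = sumset A" by (force simp: sumset_def)
  then show "finite (sumset A)" using assms by (metis finite_cartesian_product finite_imageI)
qed

lemma coll_sum_le_diff_energy:
  assumes "finite A" shows "coll (\<lambda>p. fst p + snd p) (A \<times> A) \<le> diff_energy A"
  using coll_sum_square_le[OF assms assms] by (simp add: power2_eq_square[symmetric] power2_nat_le_eq_le)

text \<open>The two equations say \<open>a - a' = b' - b = c - c'\<close>; exchanging the middle
  entries restores the differences of the third energy.\<close>

lemma triple_energy_reflected:
  assumes "finite A" "T \<subseteq> A \<times> A \<times> A"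
  shows "coll (\<lambda>(a, b, c). (a + b, b + c)) T \<le> triple_energy A"
  unfolding coll_def triple_energy_def
proof (rule card_inj_on_le[of "\<lambda>((a, b, c), (a', b', c')). ((a, b', c), (a', b, c'))"])
  let ?S = "{(p, q). p \<in> T \<and> q \<in> T \<and> (\<lambda>(a, b, c). (a + b, b + c)) p = (\<lambda>(a, b, c). (a + b, b + c)) q}"
  let ?E = "{(p, q). p \<in> A \<times> A \<times> A \<and> q \<in> A \<times> A \<times> A \<and>
     (\<lambda>(a, b, c). (a - b, b - c)) p = (\<lambda>(a, b, c). (a - b, b - c)) q}"
  show "inj_on (\<lambda>((a, b, c), (a', b', c')). ((a, b', c), (a', b, c'))) ?S"
    by (rule inj_onI) (auto split: prod.splits)
  show "finite ?E" by (rule finite_subset[of _ "(A \<times> A \<times> A) \<times> (A \<times> A \<times> A)"]) (use assms in auto)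
  show "(\<lambda>((a, b, c), (a', b', c')). ((a, b', c), (a', b, c'))) ` ?S \<subseteq> ?E"
  proof (rule image_subsetI)
    fix x assume x: "x \<in> ?S"
    obtain a b c a' b' c' where xx: "x = ((a, b, c), (a', b', c'))" by (metis surj_pair)
    have "(a, b, c) \<in> A \<times> A \<times> A" "(a', b', c') \<in> A \<times> A \<times> A" "a + b = a' + b'" "b + c = b' + c'"
      using x assms(2) by (auto simp: xx)
    then show "(\<lambda>((a, b, c), (a', b', c')). ((a, b', c), (a', b, c'))) x \<in> ?E"
      by (auto simp: xx)
  qed
qed

lemma popular_sums_le_four_reps:
  assumes A: "finite A" and S: "finite S" and \<theta>: "\<theta> \<ge> 0" "\<And>w. w \<in> S \<Longrightarrow> \<theta> \<le> real (card {p \<in> A \<times> A. fst p + snd p = w})"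
  shows "\<theta>\<^sup>2 * real (card {p \<in> S \<times> S. fst p - snd p \<in> W}) \<le> real (four_reps A W)"
proof -
  let ?T = "{p \<in> S \<times> S. fst p - snd p \<in> W}"
  let ?R = "\<lambda>x. {p \<in> A \<times> A. fst p + snd p = x}"
  have fT: "finite ?T" using S by simp
  have fR: "finite (?R x)" for x using A by simp
  have "\<theta>\<^sup>2 * real (card ?T) = (\<Sum>t\<in>?T. \<theta> * \<theta>)" by (simp add: power2_eq_square mult.commute)
  also have "\<dots> \<le> (\<Sum>t\<in>?T. real (card (?R (fst t) \<times> ?R (snd t))))"
    unfolding card_cartesian_product of_nat_mult
    by (intro sum_mono mult_mono \<theta>) (use \<theta> in auto)
  also have "\<dots> = real (card (SIGMA t:?T. ?R (fst t) \<times> ?R (snd t)))"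
    using fT fR by (subst card_SigmaI) auto
  also have "card (SIGMA t:?T. ?R (fst t) \<times> ?R (snd t)) \<le> four_reps A W"
    unfolding four_reps_def
  proof (rule card_inj_on_le[of "\<lambda>(t, p, q). (fst p, snd p, - fst q, - snd q)"])
    show "inj_on (\<lambda>(t, p, q). (fst p, snd p, - fst q, - snd q)) (SIGMA t:?T. ?R (fst t) \<times> ?R (snd t))"
      by (rule inj_onI) (auto simp: prod_eq_iff)
    show "(\<lambda>(t, p, q). (fst p, snd p, - fst q, - snd q)) ` (SIGMA t:?T. ?R (fst t) \<times> ?R (snd t))
      \<subseteq> {p \<in> A \<times> A \<times> uminus ` A \<times> uminus ` A. sum4 p \<in> W}"
      by (auto simp: sum4_def algebra_simps)
  qed (use A in simp)
  finally show ?thesis by simp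
qed

text \<open>The relation is \<open>(a + b) - (b + c) = a - c\<close>, with both sums popular and
  \<open>a - c\<close> in a level set \<open>P\<close> that carries the energy. To make these
  conditions compatible, \<open>P\<close> is taken for a subset \<open>A'\<close> whose elements
  have popular sums with most of \<open>A\<close>. The size of \<open>P\<close> is tied to the sum
  set, because a small sum set forces a large energy.\<close>

lemma cvx2_ln_sumset_ge:
  assumes A: "cvx2 A" "A \<noteq> {}"
  shows "619 / 390 * ln (real (card A)) \<le> 10000 + 10 * loglog (card A) + ln (real (card (sumset A)))"
proof -
  have cA: "cvx A" using A by (simp add: cvx2_def)
  have fA: "finite A" using cA by (rule cvx_finite)
  define N where "N = card A"
  let ?S = "sumset A"
  note fS = card_sumset_le(1)[OF fA]
  have N1: "N \<ge> 1" "real N > 0" using fA A by (auto simp: N_def Suc_le_eq card_gt_0_iff)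
  obtain a0 where "a0 \<in> A" using A by blast
  then have "a0 + a0 \<in> ?S" unfolding sumset_def by blast
  then have "?S \<noteq> {}" by blast
  then have s: "real (card ?S) > 0" using fS by (simp add: card_gt_0_iff)
  define \<theta> where "\<theta> = real N ^ 2 / (8 * real (card ?S))"
  have \<theta>: "\<theta> > 0" using N1 s by (simp add: \<theta>_def)
  define S' where "S' = {w \<in> ?S. \<theta> \<le> real (card {p \<in> A \<times> A. fst p + snd p = w})}"
  have fS': "finite S'" using fS by (simp add: S'_def)
  define B where "B = {p \<in> A \<times> A. fst p + snd p \<notin> S'}"
  have B: "real (card B) \<le> real N ^ 2 / 8"
  proof -
    have "B = {p \<in> A \<times> A. real (card {q \<in> A \<times> A. fst q + snd q = fst p + snd p}) < \<theta>}"
      unfolding B_def S'_def card_sumset_le(2)[OF fA, symmetric] by force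
    also have "real (card \<dots>) \<le> \<theta> * real (card ?S)"
      by (rule sum_unpopular_le[OF fA fS]) (use fA \<theta> card_sumset_le(2)[OF fA] in auto)
    finally show ?thesis using s by (simp add: \<theta>_def)
  qed
  define bad where "bad = (\<lambda>a. {b \<in> A. a + b \<notin> S'})"
  have fbad: "finite (bad a)" for a using fA by (simp add: bad_def)
  \<comment> \<open>At most \<open>N^2 / 8\<close> pairs have an unpopular sum, so at most
    \<open>N / 2\<close> elements have more than \<open>N / 4\<close> bad partners. Any two elements
    of \<open>A'\<close> therefore share at least \<open>N / 2\<close> good partners.\<close>
  define A' where "A' = {a \<in> A. real (card (bad a)) \<le> real N / 4}"
  have A'A: "A' \<subseteq> A" and fA': "finite A'" using fA by (auto simp: A'_def)
  have "real N / 2 \<le> real (card A')"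
  proof -
    have "real (card (A - A')) * (real N / 4) = (\<Sum>a\<in>A - A'. real N / 4)" by simp
    also have "\<dots> \<le> (\<Sum>a\<in>A - A'. real (card (bad a)))" by (rule sum_mono) (auto simp: A'_def)
    also have "\<dots> = real (card (SIGMA a:A - A'. bad a))" using fA fbad by (simp add: card_SigmaI)
    also have "\<dots> \<le> real (card B)" unfolding of_nat_le_iff
      by (rule card_mono) (use fA in \<open>auto simp: B_def bad_def\<close>)
    finally have "real (card (A - A')) * (real N / 4) \<le> real N * real N / 8"
      using B unfolding power2_eq_square by linarith
    then have "real (card (A - A')) \<le> real N / 2" using N1 by (simp add: field_simps)
    moreover have "card (A - A') = N - card A'" "card A' \<le> N"
      using fA A'A by (simp_all add: N_def card_Diff_subset fA' card_mono)
    ultimately show ?thesis by (simp add: of_nat_diff)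
  qed
  then have A'p: "real (card A') > 0" "card A' \<ge> 1" "ln (real N) - ln 2 \<le> ln (real (card A'))"
  proof -
    assume h: "real N / 2 \<le> real (card A')"
    then show p: "real (card A') > 0" using N1 by linarith
    then show "card A' \<ge> 1" by simp
    have "ln (real N / 2) \<le> ln (real (card A'))" using h p N1 by (subst ln_le_cancel_iff) auto
    then show "ln (real N) - ln 2 \<le> ln (real (card A'))" using N1 by (simp add: ln_div)
  qed
  have lam': "loglog (card A') \<le> loglog N"
    using A'p(2) A'A fA by (intro loglog_mono) (auto simp: N_def card_mono)
  obtain P k where P: "P \<subseteq> diffset A'" "finite P" "\<And>x. x \<in> P \<Longrightarrow> 2 ^ k \<le> diff_rep A' x"
    "real (diff_energy A') \<le> real (dyadic_levels (card A')) * (4 * (2 ^ k)\<^sup>2 * real (card P))"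
    by (rule popular_level_set[OF fA'], rule that)
  define D :: real where "D = 2 ^ k"
  have D1: "D \<ge> 1" by (simp add: D_def)
  have DP': "D \<le> real (diff_rep A' x)" if "x \<in> P" for x
  proof -
    have "real (2 ^ k) \<le> real (diff_rep A' x)" using P(3)[OF that] by (simp only: of_nat_le_iff)
    then show ?thesis by (simp add: D_def)
  qed
  have DP: "D \<le> real (diff_rep A x)" if "x \<in> P" for x
  proof -
    have "diff_rep A' x \<le> diff_rep A x" unfolding diff_rep_def by (rule card_mono) (use A'A fA in auto)
    then show ?thesis using DP'[OF that] by linarith
  qed
  have e1: "real (card A') ^ 4 \<le> real (card ?S) * real (diff_energy A')"
  proof -
    have "(card (A' \<times> A'))\<^sup>2 \<le> card ?S * coll (\<lambda>p. fst p + snd p) (A' \<times> A')"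
      by (rule card_square_le_coll) (use fA' fS A'A card_sumset_le(2)[OF fA] in auto)
    also have "\<dots> \<le> card ?S * diff_energy A'" by (intro mult_le_mono2 coll_sum_le_diff_energy fA')
    finally have "(real (card (A' \<times> A')))\<^sup>2 \<le> real (card ?S) * real (diff_energy A')" by (rule real_square_le_mult)
    then show ?thesis by (simp add: card_cartesian_product eval_nat_numeral mult_ac)
  qed
  have dep: "real (diff_energy A') > 0"
  proof -
    have "0 < real (card A') ^ 4" using A'p by simp
    then have "0 < real (card ?S) * real (diff_energy A')" using e1 by linarith
    then show ?thesis using s by (simp add: zero_less_mult_iff)
  qed
  have nlp: "real (dyadic_levels (card A')) > 0" using dyadic_levels_le(1)[OF A'p(2)] by linarith
  have Pp: "real (card P) > 0" using dep P(4) by (cases "card P = 0") auto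
  then have Pn: "P \<noteq> {}" by auto
  have "ln (real (card A') ^ 4) \<le> ln (real (card ?S) * real (diff_energy A'))"
    using e1 A'p s dep by (subst ln_le_cancel_iff) auto
  then have 1: "4 * ln (real (card A')) \<le> ln (real (card ?S)) + ln (real (diff_energy A'))"
    using A'p s dep by (simp add: ln_mult ln_realpow)
  have "ln (real (diff_energy A')) \<le> ln (real (dyadic_levels (card A')) * (4 * D\<^sup>2 * real (card P)))"
    using P(4) dep Pp D1 nlp unfolding D_def by (subst ln_le_cancel_iff) auto
  also have "\<dots> = ln (real (dyadic_levels (card A'))) + ln 4 + 2 * ln D + ln (real (card P))"
    using Pp D1 nlp by (simp add: ln_mult ln_realpow)
  finally have 2: "ln (real (diff_energy A')) \<le> loglog N + 4 + 2 * ln D + ln (real (card P))"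
    using lam' ln_dyadic_levels_le[OF A'p(2)] ln_le_self[of 4, simplified] by linarith
  have 3: "ln (real (card P)) + 3 * ln D \<le> 576 + 3 * ln (real N)"
    unfolding N_def by (rule ln_popular_diffs_le[OF cA A(2) P(2) Pn _ DP]) (use D1 in auto)
  define T where "T = {(a, b, c). a \<in> A' \<and> c \<in> A' \<and> b \<in> A \<and> a - c \<in> P \<and> a + b \<in> S' \<and> b + c \<in> S'}"
  have TA: "T \<subseteq> A \<times> A \<times> A" using A'A by (auto simp: T_def)
  have fT: "finite T" using TA fA finite_subset by blast
  define V where "V = {p \<in> A' \<times> A'. fst p - snd p \<in> P}"
  have fV: "finite V" using fA' by (simp add: V_def)
  have V: "real (card P) * D \<le> real (card V)"
  proof -
    have "D * real (card P) \<le> real (card (SIGMA t:P. {p \<in> A' \<times> A'. fst p - snd p = t}))"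
      by (rule sum_popular_diff_rep_le[OF fA' P(2) DP'])
    also have "\<dots> \<le> real (card V)" unfolding of_nat_le_iff
      by (rule card_inj_on_le[of snd]) (use fA' in \<open>auto simp: inj_on_def V_def\<close>)
    finally show ?thesis by (simp add: mult.commute)
  qed
  have "real (card V) * (real N / 2) = (\<Sum>p\<in>V. real N / 2)" by simp
  also have "\<dots> \<le> (\<Sum>p\<in>V. real (card (A - bad (fst p) - bad (snd p))))"
  proof (rule sum_mono)
    fix p assume "p \<in> V"
    then have b: "real (card (bad (fst p))) \<le> real N / 4" "real (card (bad (snd p))) \<le> real N / 4"
      by (auto simp: V_def A'_def)
    have "card A \<le> card ((A - bad (fst p) - bad (snd p)) \<union> bad (fst p) \<union> bad (snd p))"
      by (rule card_mono) (use fA fbad in auto)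
    also have "\<dots> \<le> card (A - bad (fst p) - bad (snd p)) + card (bad (fst p)) + card (bad (snd p))"
      by (intro card_Un_le_add order.refl)
    finally show "real N / 2 \<le> real (card (A - bad (fst p) - bad (snd p)))" using b by (simp add: N_def)
  qed
  also have "\<dots> = real (card (SIGMA p:V. A - bad (fst p) - bad (snd p)))"
    using fV fA by (simp add: card_SigmaI)
  also have "\<dots> \<le> real (card T)" unfolding of_nat_le_iff
  proof (rule card_inj_on_le[of "\<lambda>(p, b). (fst p, b, snd p)"])
    show "(\<lambda>(p, b). (fst p, b, snd p)) ` (SIGMA p:V. A - bad (fst p) - bad (snd p)) \<subseteq> T"
      by (auto simp: T_def V_def bad_def add.commute)
  qed (use fT in \<open>auto simp: inj_on_def\<close>)
  finally have VT: "real (card V) * (real N / 2) \<le> real (card T)" .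
  have T: "real (card P) * D * (real N / 2) \<le> real (card T)"
    using order_trans[OF mult_right_mono[OF V] VT] by simp
  let ?Q = "{p \<in> S' \<times> S'. fst p - snd p \<in> P}"
  have fQ: "finite ?Q" using fS' by simp
  have "(card T)\<^sup>2 \<le> card ?Q * coll (\<lambda>(a, b, c). (a + b, b + c)) T"
    by (rule card_square_le_coll[OF fT fQ]) (auto simp: T_def)
  also have "\<dots> \<le> card ?Q * triple_energy A" by (intro mult_le_mono2 triple_energy_reflected fA TA)
  finally have TQ: "(real (card T))\<^sup>2 \<le> real (card ?Q) * real (triple_energy A)"
    by (rule real_square_le_mult)
  have T0: "0 < real (card P) * D * (real N / 2)" using N1 Pp D1 by simp
  then have Tp: "0 < real (card T)" using T by linarith
  then have Qp: "0 < real (card ?Q)" using TQ by (cases "card ?Q = 0") auto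
  note triple_energy = ln_triple_energy_le[OF cA A(2)]
  have "ln (real (card P) * D * (real N / 2)) \<le> ln (real (card T))" using T T0 Tp by (subst ln_le_cancel_iff) auto
  then have 4: "ln (real (card P)) + ln D + ln (real N) - ln 2 \<le> ln (real (card T))"
    using N1 Pp D1 by (simp add: ln_div ln_mult)
  have "ln ((real (card T))\<^sup>2) \<le> ln (real (card ?Q) * real (triple_energy A))"
    using TQ Tp Qp triple_energy(1) by (subst ln_le_cancel_iff) auto
  then have 5: "2 * ln (real (card T)) \<le> ln (real (card ?Q)) + ln (real (triple_energy A))"
    using Tp Qp triple_energy(1) by (simp add: ln_mult ln_realpow)
  have "ln (\<theta>\<^sup>2 * real (card ?Q)) \<le> 10000 + 10 * loglog (card A) + 36 / 13 * ln (real (card A)) + 4 / 7 * ln (real (card P))"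
    by (rule ln_four_reps_le[OF A(1) P(2)]) (use \<theta> Qp popular_sums_le_four_reps[OF fA fS', of \<theta> P] in \<open>auto simp: S'_def\<close>)
  then have 6: "2 * ln \<theta> + ln (real (card ?Q)) \<le> 10000 + 10 * loglog N + 36 / 13 * ln (real N) + 4 / 7 * ln (real (card P))"
    using \<theta> Qp by (simp add: ln_mult ln_realpow N_def)
  have 7: "ln \<theta> = 2 * ln (real N) - ln 8 - ln (real (card ?S))"
    using N1 s by (simp add: \<theta>_def ln_div ln_mult ln_realpow)
  \<comment> \<open>Let \<open>|A + A| = N^s\<close>, \<open>|P| = N^p\<close> and
    \<open>D = N^x\<close>. Up to logarithms \<open>2 * s \<ge> 3/13 + 10/7 * p + 2 * x\<close>, and
    the last two terms equal \<open>16/7 * (2 * x + p) - 6/7 * (p + 3 * x)\<close>. With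
    \<open>2 * x + p \<ge> 4 - s\<close> and \<open>p + 3 * x \<le> 3\<close> this gives
    \<open>s \<ge> 619/390\<close>.\<close>
  show ?thesis
    using 1 2 3 4 5 6 7 A'p(3) triple_energy(2)[folded N_def] ln_le_self[of 2, simplified] ln_le_self[of 8, simplified] loglog_nonneg[OF N1(1)]
    unfolding N_def[symmetric] by linarith
qed

text \<open>Eliminating \<open>card T\<close> and \<open>card W\<close> bounds
  \<open>10 * ln D + 6 * ln (card P)\<close> in terms of \<open>ln t\<close>. One eighth of this
  plus one quarter of \<open>3\<close> is a bound for \<open>2 * ln D + ln (card P)\<close>, hence
  for the energy. Four-fold squeezing gives the slope 2/7 in \<open>ln t\<close> before the factor
  1/8, the other estimate -2/5 or -1/4, so the worst \<open>t\<close> lies in between.\<close>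

lemma cvx2_ln_diff_energy_le:
  assumes A: "cvx2 A" "A \<noteq> {}"
  shows "ln (real (diff_energy A)) \<le> 10000 + 10 * loglog (card A) + 2455398 / 1000000 * ln (real (card A))"
proof -
  have cA: "cvx A" using A by (simp add: cvx2_def)
  have fA: "finite A" using cA by (rule cvx_finite)
  have c: "card A \<ge> 1" using fA A by (simp add: Suc_le_eq card_gt_0_iff)
  then have n0: "ln (real (card A)) \<ge> 0" by simp
  obtain P W D t T where P: "P \<subseteq> diffset A" "finite P" "P \<noteq> {}" and W: "finite W" "W \<noteq> {}"
    and D: "D \<ge> 1" and t: "t \<ge> 1" and DP: "\<And>x. x \<in> P \<Longrightarrow> D \<le> real (diff_rep A x)" and tW: "\<And>x. x \<in> W \<Longrightarrow> t \<le> real (diff_rep A x)"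
    and T: "T = {p \<in> P \<times> P. fst p + snd p \<in> W}" "card T > 0"
    and e: "ln (real (diff_energy A)) \<le> 4 + loglog (card A) + 2 * ln D + ln (real (card P))"
    and s: "8 * ln D + 6 * ln (real (card P))
      \<le> 580 + 9 * ln (real (card A)) + 2 * loglog (card A) + 2 * ln t + ln (real (card T))"
    by (rule spectral_step_ln[OF cA A(2)], rule that)
  have 3: "ln (real (card P)) + 3 * ln D \<le> 576 + 3 * ln (real (card A))"
    by (rule ln_popular_diffs_le[OF cA A(2) P(2,3) _ DP]) (use D in auto)
  have 4: "ln (real (card W)) + 3 * ln t \<le> 576 + 3 * ln (real (card A))"
    by (rule ln_popular_diffs_le[OF cA A(2) W _ tW]) (use t in auto)
  define X where "X = D\<^sup>2 * real (card T)"
  have X: "0 < X" "X \<le> real (four_reps A W)"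
    using D T(2) popular_pairs_le_four_reps[OF fA P(2) _ DP, of W] by (auto simp: X_def T(1))
  have x: "ln X = 2 * ln D + ln (real (card T))" using D T(2) by (simp add: X_def ln_mult ln_realpow)
  note l0 = loglog_nonneg[OF c]
  \<comment> \<open>The two bounds for \<open>four_reps A W\<close> balance at \<open>t = N^(523/936)\<close>, where \<open>523/936 \<approx> 0.55876\<close>.\<close>
  show ?thesis
  proof (cases "ln t \<le> 5588 / 10000 * ln (real (card A))")
    case True
    then show ?thesis using ln_four_reps_le[OF A(1) W(1) X] x e s 3 4 l0 n0 by linarith
  next
    case False
    then show ?thesis using ln_four_reps_le'[OF A(1) W(1) X] x e s 3 4 l0 n0 by linarith
  qed
qed

subsection \<open>2-convex sequences\<close>

lemma strict_increasing_on_initial: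
  fixes w :: "nat \<Rightarrow> real"
  assumes "\<And>i. i + 1 < n \<Longrightarrow> w i < w (i + 1)" "i < j" "j < n"
  shows "w i < w j"
  using assms(2,3)
proof (induction j)
  case (Suc j)
  have "w j < w (Suc j)" using assms(1)[of j] Suc by simp
  then show ?case using Suc by (cases "i = j") auto
qed simp

text \<open>Going from \<open>h\<close> to \<open>h + 1\<close> adds a second difference of the same
  sign. The factor \<open>c\<close> carries that sign, so increasing and decreasing first
  differences are treated together.\<close>

lemma long_differences_monotone:
  fixes u :: "nat \<Rightarrow> real"
  assumes "\<And>i. i + 2 < n \<Longrightarrow> c * (u (i + 2) - 2 * u (i + 1) + u i) > 0" "h \<ge> 1" "i + 1 + h < n"
  shows "c * (u (i + h) - u i) < c * (u (i + 1 + h) - u (i + 1))"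
  using assms(2,3)
proof (induction h rule: nat_induct_at_least)
  case base
  then show ?case using assms(1)[of i] by (simp add: algebra_simps)
next
  case (Suc h)
  then have "c * (u (i + h) - u i) < c * (u (i + 1 + h) - u (i + 1))" by simp
  moreover have "c * (u (i + h + 2) - 2 * u (i + h + 1) + u (i + h)) > 0"
    using assms(1)[of "i + h"] Suc.prems by simp
  ultimately show ?case by (simp add: algebra_simps)
qed

lemma rk_sequence:
  fixes g :: "nat \<Rightarrow> real"
  assumes g: "\<And>i j. i < j \<Longrightarrow> j < n \<Longrightarrow> g i < g j" and i: "i < n"
  shows "rk (g ` {..<n}) (g i) = i"
proof -
  have "{x \<in> g ` {..<n}. x < g i} = g ` {..<i}"
  proof
    show "{x \<in> g ` {..<n}. x < g i} \<subseteq> g ` {..<i}"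
    proof
      fix x assume "x \<in> {x \<in> g ` {..<n}. x < g i}"
      then obtain j where j: "j < n" "x = g j" "g j < g i" by auto
      then have "\<not> i \<le> j" using g[of i j] by (cases "i = j") auto
      then show "x \<in> g ` {..<i}" using j by auto
    qed
    show "g ` {..<i} \<subseteq> {x \<in> g ` {..<n}. x < g i}" using g i by auto
  qed
  moreover have "inj_on g {..<i}"
    by (rule inj_onI) (metis g i less_irrefl lessThan_iff linorder_neqE_nat order.strict_trans)
  ultimately show ?thesis by (simp add: rk_def card_image)
qed

text \<open>For a fixed positive offset the differences are strictly monotone in the base index and
  thus determine it; a negative offset is handled by exchanging the ends of both pairs.\<close>

lemma cvx_sequence:
  fixes g :: "nat \<Rightarrow> real"
  assumes g: "\<And>i. i + 1 < n \<Longrightarrow> g i < g (i + 1)"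
    and c: "\<And>i. i + 2 < n \<Longrightarrow> c * (g (i + 2) - 2 * g (i + 1) + g i) > 0"
  shows "cvx (g ` {..<n})"
proof -
  have mono: "g i < g j" if "i < j" "j < n" for i j by (rule strict_increasing_on_initial[of n g i j, OF g that])
  have rk: "rk (g ` {..<n}) (g i) = i" if "i < n" for i by (rule rk_sequence[of n g i, OF mono that])
  have inj: "i = j" if h: "h \<ge> 1" "i + h < n" "j + h < n" "g (i + h) - g i = g (j + h) - g j" for i j h
  proof (rule ccontr)
    define w where "w = (\<lambda>i. c * (g (i + h) - g i))"
    have w: "w i < w (i + 1)" if "i + 1 < n - h" for i
      unfolding w_def using long_differences_monotone[of n c g h i, OF c h(1)] that by simp
    assume "i \<noteq> j"
    then consider "i < j" | "j < i" by linarith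
    then show False
    proof cases
      case 1
      have "w i < w j" by (rule strict_increasing_on_initial[of "n - h" w i j, OF w 1]) (use h in auto)
      then show False using h by (simp add: w_def)
    next
      case 2
      have "w j < w i" by (rule strict_increasing_on_initial[of "n - h" w j i, OF w 2]) (use h in auto)
      then show False using h by (simp add: w_def)
    qed
  qed
  show ?thesis unfolding cvx_def
  proof (intro conjI ballI impI)
    fix a a' b b' assume m: "a \<in> g ` {..<n}" "a' \<in> g ` {..<n}" "b \<in> g ` {..<n}" "b' \<in> g ` {..<n}" and ne: "a \<noteq> a'"
      and r: "int (rk (g ` {..<n}) a') - int (rk (g ` {..<n}) a) = int (rk (g ` {..<n}) b') - int (rk (g ` {..<n}) b)"
      and d: "a' - a = b' - b"
    obtain i i' j j' where ij: "a = g i" "a' = g i'" "b = g j" "b' = g j'" "i < n" "i' < n" "j < n" "j' < n"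
      using m by blast
    have r': "int i' - int i = int j' - int j" using r ij rk by simp
    have "i \<noteq> i'" using ne ij by auto
    then consider "i < i'" | "i' < i" by linarith
    then show "a = b"
    proof cases
      case 1
      then have "i' = i + (i' - i)" "j' = j + (i' - i)" using r' by linarith+
      then have "i = j" using inj[of "i' - i" i j] 1 ij d by simp
      then show ?thesis using ij by simp
    next
      case 2
      then have e: "i = i' + (i - i')" "j = j' + (i - i')" using r' by linarith+
      have "g (i' + (i - i')) - g i' = g (j' + (i - i')) - g j'" using d ij e by simp
      then have "i' = j'" using inj[of "i - i'" i' j'] 2 ij e by simp
      then show ?thesis using ij e by simp
    qed
  qed simp
qed

lemma gaps_minus: "gaps A (- h) = uminus ` gaps A h"
proof
  show "gaps A (- h) \<subseteq> uminus ` gaps A h"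
  proof
    fix x assume "x \<in> gaps A (- h)"
    then obtain a a' where a: "x = a' - a" "a \<in> A" "a' \<in> A" "int (rk A a') - int (rk A a) = - h" by (auto simp: gaps_def)
    then have "a - a' \<in> gaps A h" unfolding gaps_def by force
    then show "x \<in> uminus ` gaps A h" using a by (intro image_eqI[of _ _ "a - a'"]) auto
  qed
  show "uminus ` gaps A h \<subseteq> gaps A (- h)"
  proof (rule image_subsetI)
    fix x assume "x \<in> gaps A h"
    then obtain a a' where a: "x = a' - a" "a \<in> A" "a' \<in> A" "int (rk A a') - int (rk A a) = h" by (auto simp: gaps_def)
    have "int (rk A a) - int (rk A a') = - h" "- x = a - a'" using a by auto
    then show "- x \<in> gaps A (- h)" unfolding gaps_def using a by blast
  qed
qed

text \<open>Consecutive differences at index distance \<open>h\<close> change with the sign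
  \<open>s\<close>, and their second differences are \<open>\<gamma> (i + h) - \<gamma> i\<close>
  with \<open>\<gamma>\<close> the second differences of \<open>g\<close>, so of sign
  \<open>t\<close>. For \<open>s = -1\<close> they decrease and are reflected before
  \<open>cvx_sequence\<close> applies; negative distances are reflections of positive ones.\<close>

lemma cvx2_sequence:
  fixes g :: "nat \<Rightarrow> real"
  assumes g: "\<And>i. i + 1 < n \<Longrightarrow> g i < g (i + 1)"
    and s: "\<And>i. i + 2 < n \<Longrightarrow> s * (g (i + 2) - 2 * g (i + 1) + g i) > 0" "s = 1 \<or> s = -1"
    and t: "\<And>i j. i < j \<Longrightarrow> j + 2 < n \<Longrightarrow>
      t * (g (i + 2) - 2 * g (i + 1) + g i) < t * (g (j + 2) - 2 * g (j + 1) + g j)"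
  shows "cvx2 (g ` {..<n})"
proof -
  let ?A = "g ` {..<n}"
  have mono: "g i < g j" if "i < j" "j < n" for i j by (rule strict_increasing_on_initial[of n g i j, OF g that])
  have rk: "rk ?A (g i) = i" if "i < n" for i by (rule rk_sequence[of n g i, OF mono that])
  have pos: "cvx (gaps ?A (int h))" if h: "h \<ge> 1" for h
  proof -
    define d where "d = (\<lambda>i. g (i + h) - g i)"
    have gaps: "gaps ?A (int h) = d ` {..<n - h}"
    proof
      show "gaps ?A (int h) \<subseteq> d ` {..<n - h}"
      proof
        fix x assume "x \<in> gaps ?A (int h)"
        then obtain i j where ij: "x = g j - g i" "i < n" "j < n" "int (rk ?A (g j)) - int (rk ?A (g i)) = int h"
          unfolding gaps_def by auto
        then have "j = i + h" using rk by simp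
        then show "x \<in> d ` {..<n - h}" using ij by (auto simp: d_def)
      qed
      show "d ` {..<n - h} \<subseteq> gaps ?A (int h)"
      proof (rule image_subsetI)
        fix i assume "i \<in> {..<n - h}"
        then have "i < n" "i + h < n" by auto
        moreover from this have "int (rk ?A (g (i + h))) - int (rk ?A (g i)) = int h" using rk by simp
        ultimately show "d i \<in> gaps ?A (int h)" unfolding gaps_def d_def by blast
      qed
    qed
    have d1: "s * d i < s * d (i + 1)" if "i + 1 < n - h" for i
      unfolding d_def using long_differences_monotone[of n s g h i, OF s(1) h] that by simp
    have d2: "t * (d (i + 2) - 2 * d (i + 1) + d i) > 0" if "i + 2 < n - h" for i
      using t[of i "i + h"] that h by (simp add: d_def algebra_simps)
    show ?thesis
    proof (cases "s = 1")
      case True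
      then show ?thesis unfolding gaps using d1 d2 by (intro cvx_sequence[of _ _ t]) auto
    next
      case False
      then have "s = -1" using s(2) by simp
      have "cvx ((\<lambda>i. - d i) ` {..<n - h})"
      proof (rule cvx_sequence[of _ _ "- t"])
        show "- d i < - d (i + 1)" if "i + 1 < n - h" for i using d1[OF that] \<open>s = -1\<close> by simp
        show "- t * (- d (i + 2) - 2 * - d (i + 1) + - d i) > 0" if "i + 2 < n - h" for i
          using d2[OF that] by (simp add: algebra_simps)
      qed
      then have "cvx (uminus ` (\<lambda>i. - d i) ` {..<n - h})" by (rule cvx_uminus)
      then show ?thesis by (simp add: gaps image_image)
    qed
  qed
  have "cvx (gaps ?A h)" if "h \<noteq> 0" for h
  proof (cases "h > 0")
    case True
    then show ?thesis using pos[of "nat h"] by simp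
  next
    case False
    then have "h = - int (nat (- h))" "nat (- h) \<ge> 1" using that by auto
    then show ?thesis using cvx_uminus[OF pos[of "nat (- h)"]] by (metis gaps_minus)
  qed
  moreover have "cvx ?A" by (rule cvx_sequence[OF g s(1)])
  ultimately show ?thesis by (simp add: cvx2_def)
qed

lemma length_diffs: "length (diffs xs) = length xs - 1"
  by (simp add: diffs_def)

lemma nth_diffs: "i + 1 < length xs \<Longrightarrow> diffs xs ! i = xs ! (i + 1) - xs ! i"
  by (simp add: diffs_def nth_tl)

text \<open>
  The second differences \<open>\<gamma>\<close> are monotone, hence change sign at most once. A single vanishing \<open>\<gamma> k\<close> is
  avoided by letting the two pieces overlap in one element only.
\<close>

lemma convex_set_2_decomposition:
  assumes "convex_set 2 A"
  obtains A1 A2 where "A = A1 \<union> A2" "cvx2 A1" "cvx2 A2"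
proof -
  have fA: "finite A" using assms by (simp add: convex_set_def)
  define xs where "xs = sorted_list_of_set A"
  define n where "n = length xs"
  define f where "f = (\<lambda>i. xs ! i)"
  have A: "A = f ` {..<n}"
    using fA set_sorted_list_of_set[of A] by (auto simp: f_def n_def xs_def set_conv_nth image_def)
  have sorted: "sorted_wrt (<) xs" by (simp add: xs_def)
  have mono: "f i < f (i + 1)" if "i + 1 < n" for i
    using that sorted by (simp add: f_def n_def sorted_wrt_nth_less)
  define \<gamma> where "\<gamma> = (\<lambda>i. f (i + 2) - 2 * f (i + 1) + f i)"
  have nth: "diffs (diffs xs) ! i = \<gamma> i" if "i + 2 < n" for i
    using that by (simp add: nth_diffs length_diffs \<gamma>_def f_def n_def)
  have len: "length (diffs (diffs xs)) = n - 2" by (simp add: length_diffs n_def)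
  have "sorted_wrt (<) (diffs (diffs xs)) \<or> sorted_wrt (>) (diffs (diffs xs))"
    using assms by (simp add: convex_set_def xs_def numeral_2_eq_2)
  then obtain t :: real where t1: "t = 1 \<or> t = -1" and t: "\<And>i j. i < j \<Longrightarrow> j + 2 < n \<Longrightarrow> t * \<gamma> i < t * \<gamma> j"
  proof
    assume h: "sorted_wrt (<) (diffs (diffs xs))"
    show ?thesis
    proof (rule that[of 1])
      show "1 * \<gamma> i < 1 * \<gamma> j" if "i < j" "j + 2 < n" for i j
        using sorted_wrt_nth_less[OF h that(1)] that nth len by simp
    qed simp
  next
    assume h: "sorted_wrt (>) (diffs (diffs xs))"
    show ?thesis
    proof (rule that[of "-1"])
      show "-1 * \<gamma> i < -1 * \<gamma> j" if "i < j" "j + 2 < n" for i j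
        using sorted_wrt_nth_less[OF h that(1)] that nth len by simp
    qed simp
  qed
  \<comment> \<open>The first disjunct holds once no second difference starts at \<open>i\<close>,
    so the least index exists even if all second differences have the same sign.\<close>
  define Q where "Q = (\<lambda>i. n \<le> i + 2 \<or> t * \<gamma> i \<ge> 0)"
  define k where "k = (LEAST i. Q i)"
  have "Q n" by (simp add: Q_def)
  then have Qk: "Q k" unfolding k_def by (rule LeastI)
  have below: "t * \<gamma> i < 0" if "i < k" for i
    using not_less_Least[of i Q] that by (simp add: k_def Q_def)
  have above: "t * \<gamma> i > 0" if "k < i" "i + 2 < n" for i
  proof -
    have "t * \<gamma> k \<ge> 0" using Qk that by (auto simp: Q_def)
    then show ?thesis using t[OF that] by linarith
  qed
  have t1': "t = 1 \<or> t = -1" "- t = 1 \<or> - t = -1" using t1 by auto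
  have 1: "cvx2 (f ` {..<min n (k + 2)})"
  proof (rule cvx2_sequence[of _ _ "- t" t])
    show "f i < f (i + 1)" if "i + 1 < min n (k + 2)" for i using mono that by simp
    show "0 < - t * (f (i + 2) - 2 * f (i + 1) + f i)" if "i + 2 < min n (k + 2)" for i
      using below[of i] that by (simp add: \<gamma>_def)
    show "t * (f (i + 2) - 2 * f (i + 1) + f i) < t * (f (j + 2) - 2 * f (j + 1) + f j)"
      if "i < j" "j + 2 < min n (k + 2)" for i j
      using t[of i j] that by (simp add: \<gamma>_def)
  qed (rule t1')
  define g where "g = (\<lambda>i. f (k + 1 + i))"
  have 2: "cvx2 (g ` {..<n - (k + 1)})"
  proof (rule cvx2_sequence[of _ _ t t])
    show "g i < g (i + 1)" if "i + 1 < n - (k + 1)" for i using mono[of "k + 1 + i"] that by (simp add: g_def)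
    show "0 < t * (g (i + 2) - 2 * g (i + 1) + g i)" if "i + 2 < n - (k + 1)" for i
      using above[of "k + 1 + i"] that by (simp add: \<gamma>_def g_def)
    show "t * (g (i + 2) - 2 * g (i + 1) + g i) < t * (g (j + 2) - 2 * g (j + 1) + g j)"
      if "i < j" "j + 2 < n - (k + 1)" for i j
      using t[of "k + 1 + i" "k + 1 + j"] that by (simp add: \<gamma>_def g_def)
  qed (rule t1')
  have "{..<n} = {..<min n (k + 2)} \<union> (\<lambda>i. k + 1 + i) ` {..<n - (k + 1)}"
  proof (rule set_eqI)
    fix i
    show "i \<in> {..<n} \<longleftrightarrow> i \<in> {..<min n (k + 2)} \<union> (\<lambda>i. k + 1 + i) ` {..<n - (k + 1)}"
      by (cases "i < k + 1") (auto intro!: image_eqI[of _ _ "i - (k + 1)"])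
  qed
  then have "A = f ` {..<min n (k + 2)} \<union> g ` {..<n - (k + 1)}"
    unfolding A g_def by (metis image_Un image_image)
  then show ?thesis using 1 2 that by blast
qed

text \<open>One of the two pieces of \<open>A\<close> contains at least half of it, and
  \<open>G\<close> is monotone, so passing to that piece costs only a constant factor.\<close>

lemma gtrsim_from_cvx2:
  fixes G :: "real set \<Rightarrow> real set"
  assumes \<alpha>: "1 \<le> \<alpha>" "\<alpha> \<le> 2" and K: "K > 0"
    and G: "\<And>A. finite A \<Longrightarrow> finite (G A)" "\<And>A B. A \<subseteq> B \<Longrightarrow> G A \<subseteq> G B" "\<And>A. A \<noteq> {} \<Longrightarrow> G A \<noteq> {}"
    and bound: "\<And>A. cvx2 A \<Longrightarrow> A \<noteq> {} \<Longrightarrow> \<alpha> * ln (real (card A)) \<le> K + K * loglog (card A) + ln (real (card (G A)))"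
  shows "\<exists>c>0. \<exists>C>0. \<forall>A. convex_set 2 A \<longrightarrow> gtrsim_bound c C (real (card (G A))) (real (card A) powr \<alpha>)"
proof (intro exI conjI allI impI)
  \<comment> \<open>The 2 covers the loss \<open>\<alpha> * ln 2\<close> from halving;
    \<open>5 * K\<close> is \<open>K\<close> plus the bound \<open>4 * K\<close> for
    \<open>K * ln 4\<close>.\<close>
  show "exp (- 2 - 5 * K) > 0" "K > 0" using K by auto
  fix A assume A: "convex_set 2 A"
  then have fA: "finite A" by (simp add: convex_set_def)
  \<comment> \<open>For fewer than two elements the lower bound is 0, because
    \<open>0 powr x = 0\<close>: the cardinality vanishes, or the logarithm of 1 does.\<close>
  consider "card A = 0" | "card A = 1" | "card A \<ge> 2" by linarith
  then show "gtrsim_bound (exp (- 2 - 5 * K)) K (real (card (G A))) (real (card A) powr \<alpha>)"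
  proof cases
    case 3
    obtain A1 A2 where A12: "A = A1 \<union> A2" "cvx2 A1" "cvx2 A2" using convex_set_2_decomposition[OF A] .
    have "card A \<le> card A1 + card A2" unfolding A12(1) by (rule card_Un_le)
    then have "\<exists>B. B \<subseteq> A \<and> cvx2 B \<and> card A \<le> 2 * card B"
    proof (cases "card A1 \<le> card A2")
      case True
      then show ?thesis using A12 \<open>card A \<le> card A1 + card A2\<close> by (intro exI[of _ A2]) auto
    next
      case False
      then show ?thesis using A12 \<open>card A \<le> card A1 + card A2\<close> by (intro exI[of _ A1]) auto
    qed
    then obtain B where B: "B \<subseteq> A" "cvx2 B" "card A \<le> 2 * card B" by blast
    have fB: "finite B" using B fA finite_subset by blast
    have B1: "card B \<ge> 1" "card B \<le> card A" using B 3 fA by (auto simp: card_mono)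
    then have "B \<noteq> {}" by auto
    define n where "n = ln (real (card A))"
    have "ln 2 \<ge> (1 / 2 :: real)" using ln_le_minus_one[of "1 / 2 :: real"] by (simp add: ln_div)
    moreover have "ln 2 \<le> n" using 3 by (simp add: n_def)
    ultimately have n2: "n \<ge> 1 / 2" by linarith
    have "real (card A) \<le> 2 * real (card B)" using B(3) by linarith
    then have "n \<le> ln (2 * real (card B))" unfolding n_def using 3 B1 by (subst ln_le_cancel_iff) auto
    then have nB: "n \<le> ln 2 + ln (real (card B))" using B1 by (simp add: ln_mult)
    have "\<alpha> * n \<le> \<alpha> * (1 + ln (real (card B)))"
      using nB ln_le_minus_one[of "2::real"] \<alpha> by (intro mult_left_mono) auto
    also have "\<dots> \<le> 2 + \<alpha> * ln (real (card B))" using \<alpha> by (simp add: algebra_simps)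
    also have "\<dots> \<le> 2 + (K + K * loglog (card B) + ln (real (card (G B))))"
      using bound[OF B(2) \<open>B \<noteq> {}\<close>] by simp
    also have "\<dots> \<le> 2 + (K + K * loglog (card A) + ln (real (card (G A))))"
    proof -
      have "K * loglog (card B) \<le> K * loglog (card A)" using K B1 by (intro mult_left_mono loglog_mono) auto
      moreover have "0 < card (G B)" "card (G B) \<le> card (G A)"
        using G fA fB B(1) \<open>B \<noteq> {}\<close> by (auto simp: card_gt_0_iff intro!: card_mono)
      then have "ln (real (card (G B))) \<le> ln (real (card (G A)))" by simp
      ultimately show ?thesis by linarith
    qed
    also have "K * loglog (card A) \<le> K * (4 + ln (\<alpha> * n))"
    proof (rule mult_left_mono)
      \<comment> \<open>The target contains the logarithm \<open>\<alpha> * n\<close> of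
        \<open>card A powr \<alpha>\<close>. Two elements ensure \<open>n \<ge> 1 / 2\<close>, hence
        \<open>1 + 2 * n \<le> 4 * n\<close>.\<close>
      have "loglog (card A) \<le> ln (4 * (\<alpha> * n))" unfolding loglog_def n_def[symmetric]
      proof (subst ln_le_cancel_iff)
        have "1 * n \<le> \<alpha> * n" using \<alpha> n2 by (intro mult_right_mono) auto
        then show "1 + 2 * n \<le> 4 * (\<alpha> * n)" using n2 by linarith
      qed (use n2 \<alpha> in auto)
      also have "\<dots> = ln 4 + ln (\<alpha> * n)" using \<alpha> n2 by (simp add: ln_mult)
      finally show "loglog (card A) \<le> 4 + ln (\<alpha> * n)" using ln_le_self[of 4, simplified] by linarith
    qed (use K in simp)
    finally have main: "- 2 - 5 * K + \<alpha> * n - K * ln (\<alpha> * n) \<le> ln (real (card (G A)))"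
      by (simp add: algebra_simps)
    have "A \<noteq> {}" using 3 by auto
    then have Gp: "real (card (G A)) > 0" using G fA by (simp add: card_gt_0_iff)
    have an: "\<alpha> * n > 0" using \<alpha> n2 by simp
    have "exp (- 2 - 5 * K) * (real (card A) powr \<alpha>) * (ln (real (card A) powr \<alpha>)) powr (- K)
       = exp (- 2 - 5 * K) * exp (\<alpha> * n) * exp (- K * ln (\<alpha> * n))"
      using 3 an \<alpha> by (simp add: powr_def n_def)
    also have "\<dots> = exp (- 2 - 5 * K + \<alpha> * n - K * ln (\<alpha> * n))"
      by (simp add: exp_add[symmetric])
    also have "\<dots> \<le> exp (ln (real (card (G A))))" using main by simp
    also have "\<dots> = real (card (G A))" using Gp by simp
    finally show ?thesis by (simp add: gtrsim_bound_def)
  qed (simp_all add: gtrsim_bound_def)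
qed

text \<open>Sorting each of the four variables by the piece it belongs to gives 16 mixed counts,
  each at most \<open>E\<close> by Cauchy-Schwarz.\<close>

lemma add_energy_Un_le:
  assumes fin: "finite A" "finite B" and E: "real (diff_energy A) \<le> E" "real (diff_energy B) \<le> E"
  shows "real (add_energy (A \<union> B)) \<le> 16 * E"
proof -
  let ?I = "{A, B} \<times> {A, B} \<times> {A, B} \<times> {A, B}"
  let ?F = "\<lambda>(X, Y, U, V). zero_sums_4 X Y (uminus ` U) (uminus ` V)"
  have diff_energy_uminus: "diff_energy (uminus ` X) = diff_energy X" for X
    unfolding diff_energy_def coll_def
    by (rule bij_betw_same_card[of "\<lambda>(p, q). ((- fst p, - snd p), (- fst q, - snd q))"],
        rule bij_betw_byWitness[of _ "\<lambda>(p, q). ((- fst p, - snd p), (- fst q, - snd q))"]) auto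
  have E0: "E \<ge> 0" using E(1) by linarith
  have b: "real (card (?F i)) \<le> E" if "i \<in> ?I" for i
  proof -
    obtain X Y U V where i: "i = (X, Y, U, V)" by (metis surj_pair)
    have "X \<in> {A, B}" "Y \<in> {A, B}" "U \<in> {A, B}" "V \<in> {A, B}" using that by (auto simp: i)
    then show ?thesis unfolding i prod.case
      by (intro card_zero_sums_4_le) (use fin E in \<open>auto simp: diff_energy_uminus\<close>)
  qed
  have "finite (zero_sums_4 X Y U V)" if "finite X" "finite Y" "finite U" "finite V" for X Y U V
    by (rule finite_subset[of _ "X \<times> Y \<times> U \<times> V"]) (use that in \<open>auto simp: zero_sums_4_def\<close>)
  then have fF: "finite (?F i)" if "i \<in> ?I" for i using that fin by auto
  have "add_energy (A \<union> B) \<le> card (\<Union>i\<in>?I. ?F i)"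
    unfolding add_energy_def
  proof (rule card_inj_on_le[of "\<lambda>(a, b, c, d). (a, b, - c, - d)"])
    show "inj_on (\<lambda>(a, b, c, d). (a, b, - c, - d)) {(a1, a2, a3, a4).
       a1 \<in> A \<union> B \<and> a2 \<in> A \<union> B \<and> a3 \<in> A \<union> B \<and> a4 \<in> A \<union> B \<and> a1 + a2 = a3 + a4}"
      by (auto simp: inj_on_def)
    show "(\<lambda>(a, b, c, d). (a, b, - c, - d)) ` {(a1, a2, a3, a4).
       a1 \<in> A \<union> B \<and> a2 \<in> A \<union> B \<and> a3 \<in> A \<union> B \<and> a4 \<in> A \<union> B \<and> a1 + a2 = a3 + a4} \<subseteq> (\<Union>i\<in>?I. ?F i)"
    proof (rule image_subsetI)
      fix x assume x: "x \<in> {(a1, a2, a3, a4).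
       a1 \<in> A \<union> B \<and> a2 \<in> A \<union> B \<and> a3 \<in> A \<union> B \<and> a4 \<in> A \<union> B \<and> a1 + a2 = a3 + a4}"
      obtain a b c d where xx: "x = (a, b, c, d)" by (metis surj_pair)
      have "a \<in> A \<union> B" "b \<in> A \<union> B" "c \<in> A \<union> B" "d \<in> A \<union> B" and s: "a + b = c + d" using x by (auto simp: xx)
      moreover have "\<exists>X\<in>{A, B}. y \<in> X" if "y \<in> A \<union> B" for y using that by blast
      ultimately obtain X Y U V where "X \<in> {A, B}" "Y \<in> {A, B}" "U \<in> {A, B}" "V \<in> {A, B}"
        and m: "a \<in> X" "b \<in> Y" "c \<in> U" "d \<in> V"
        by meson
      then have i: "(X, Y, U, V) \<in> ?I" by (intro SigmaI)
      have "(a, b, - c, - d) \<in> ?F (X, Y, U, V)" using m s by (auto simp: zero_sums_4_def)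
      with i have "(a, b, - c, - d) \<in> (\<Union>i\<in>?I. ?F i)" by (rule UN_I)
      then show "(\<lambda>(a, b, c, d). (a, b, - c, - d)) x \<in> (\<Union>i\<in>?I. ?F i)" unfolding xx prod.case .
    qed
    show "finite (\<Union>i\<in>?I. ?F i)" using fF by (intro finite_UN_I) auto
  qed
  also have "\<dots> \<le> (\<Sum>i\<in>?I. card (?F i))" by (rule card_UN_le) simp
  finally have "real (add_energy (A \<union> B)) \<le> (\<Sum>i\<in>?I. real (card (?F i)))"
    by (simp only: of_nat_sum[symmetric] of_nat_le_iff)
  also have "\<dots> \<le> (\<Sum>i\<in>?I. E)" by (intro sum_mono b)
  also have "\<dots> = real (card ?I) * E" by simp
  also have "\<dots> \<le> 16 * E"
  proof (rule mult_right_mono)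
    have "card {A, B} \<le> 2" by (simp add: card_insert_if)
    then have "card {A, B} * (card {A, B} * (card {A, B} * card {A, B})) \<le> 2 * (2 * (2 * 2))"
      by (intro mult_le_mono)
    then show "real (card ?I) \<le> 16" unfolding card_cartesian_product by linarith
  qed (rule E0)
  finally show ?thesis .
qed

lemma convex_set_2_add_energy_le:
  "\<exists>N0::nat. \<forall>A. convex_set 2 A \<and> card A \<ge> N0 \<longrightarrow> real (add_energy A) \<le> real (card A) powr 2.4554"
proof -
  \<comment> \<open>The margin 2.4554 - 2.455398 = 2/1000000 in the exponent swallows the constants
    and the power of the logarithm.\<close>
  have "eventually (\<lambda>N::nat. ln 16 + 10000 + 10 * ln (1 + 2 * ln (real N)) \<le> 2 / 1000000 * ln (real N)) sequentially"
    by real_asymp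
  then obtain N0 where N0: "\<And>N. N \<ge> N0 \<Longrightarrow> ln 16 + 10000 + 10 * loglog N \<le> 2 / 1000000 * ln (real N)"
    unfolding eventually_sequentially loglog_def by blast
  show ?thesis
  proof (intro exI[of _ "max 1 N0"] allI impI, elim conjE)
    fix A assume A: "convex_set 2 A" and "max 1 N0 \<le> card A"
    then have N: "card A \<ge> 1" "card A \<ge> N0" by auto
    have fA: "finite A" using A by (simp add: convex_set_def)
    obtain A1 A2 where A12: "A = A1 \<union> A2" "cvx2 A1" "cvx2 A2" using convex_set_2_decomposition[OF A] .
    define E where "E = exp (10000 + 10 * loglog (card A) + 2455398 / 1000000 * ln (real (card A)))"
    have E: "real (diff_energy B) \<le> E" if "cvx2 B" "B \<subseteq> A" for B
    proof (cases "diff_energy B = 0")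
      case False
      then have "B \<noteq> {}" by (auto simp: diff_energy_def coll_def)
      then have B1: "card B \<ge> 1" "card B \<le> card A"
        using that(2) fA finite_subset by (auto simp: Suc_le_eq card_gt_0_iff card_mono)
      have "ln (real (diff_energy B)) \<le> 10000 + 10 * loglog (card B) + 2455398 / 1000000 * ln (real (card B))"
        by (rule cvx2_ln_diff_energy_le[OF that(1) \<open>B \<noteq> {}\<close>])
      also have "\<dots> \<le> 10000 + 10 * loglog (card A) + 2455398 / 1000000 * ln (real (card A))"
        using B1 by (intro add_mono mult_left_mono loglog_mono order.refl) auto
      finally have "exp (ln (real (diff_energy B))) \<le> E" unfolding E_def by simp
      then show ?thesis using False by simp
    qed (simp add: E_def)
    have "real (add_energy A) \<le> 16 * E"
      unfolding A12(1) using A12 fA by (intro add_energy_Un_le E) auto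
    also have "\<dots> = exp (ln 16 + (10000 + 10 * loglog (card A) + 2455398 / 1000000 * ln (real (card A))))"
      by (simp add: E_def exp_add)
    also have "\<dots> \<le> exp (2.4554 * ln (real (card A)))"
      using N0[OF N(2)] by simp
    also have "\<dots> = real (card A) powr 2.4554" using N by (simp add: powr_def)
    finally show "real (add_energy A) \<le> real (card A) powr 2.4554" .
  qed
qed

theorem theorem6p2:
  shows "(\<exists>c>0. \<exists>C>0. \<forall>A. convex_set 2 A \<longrightarrow>
            gtrsim_bound c C (real (card (diffset A))) (real (card A) powr (1 + 151/234)))
       \<and> (\<exists>c>0. \<exists>C>0. \<forall>A. convex_set 2 A \<longrightarrow>
            gtrsim_bound c C (real (card (sumset A))) (real (card A) powr (1 + 229/390)))
       \<and> (\<exists>N0::nat. \<forall>A. convex_set 2 A \<and> card A \<ge> N0 \<longrightarrow>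
            real (add_energy A) \<le> real (card A) powr 2.4554)"
proof (intro conjI convex_set_2_add_energy_le)
  \<comment> \<open>\<open>gtrsim_from_cvx2\<close> takes the same constant for both error
    terms.\<close>
  have weaken: "\<alpha> * n \<le> 10000 + 10000 * loglog m + x"
    if "\<alpha> * n \<le> 10000 + 10 * loglog m + x" "m \<ge> 1" for \<alpha> n x m
    using that loglog_nonneg[of m] by linarith
  show "\<exists>c>0. \<exists>C>0. \<forall>A. convex_set 2 A \<longrightarrow>
            gtrsim_bound c C (real (card (diffset A))) (real (card A) powr (1 + 151/234))"
  proof (rule gtrsim_from_cvx2[where K = 10000])
    fix A assume A: "cvx2 A" "A \<noteq> {}"
    then have "card A \<ge> 1" using cvx_finite by (auto simp: cvx2_def Suc_le_eq card_gt_0_iff)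
    then show "(1 + 151 / 234) * ln (real (card A)) \<le> 10000 + 10000 * loglog (card A) + ln (real (card (diffset A)))"
      using cvx2_ln_diffset_ge[OF A] by (intro weaken) simp_all
  next
    show "finite (diffset A)" if "finite A" for A using card_diffset_le(1)[OF that] .
  qed (auto simp: diffset_def)
  show "\<exists>c>0. \<exists>C>0. \<forall>A. convex_set 2 A \<longrightarrow>
            gtrsim_bound c C (real (card (sumset A))) (real (card A) powr (1 + 229/390))"
  proof (rule gtrsim_from_cvx2[where K = 10000])
    fix A assume A: "cvx2 A" "A \<noteq> {}"
    then have "card A \<ge> 1" using cvx_finite by (auto simp: cvx2_def Suc_le_eq card_gt_0_iff)
    then show "(1 + 229 / 390) * ln (real (card A)) \<le> 10000 + 10000 * loglog (card A) + ln (real (card (sumset A)))"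
      using cvx2_ln_sumset_ge[OF A] by (intro weaken) simp_all
  next
    show "finite (sumset A)" if "finite A" for A using card_sumset_le(1)[OF that] .
  qed (auto simp: sumset_def)
qed

end
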